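(* Every $g\in SL(2,\mathbb{R})$ has an optimal factorization of the form $$g=\exp(t_1A_1)\cdots\exp(t_6A_6),\qquad A_k\in\{P,\,Q,\,P+Q\},\ t_k\in\mathbb{R}\quad(k=1,\dots,6).$$
   Context: $P=\begin{pmatrix}0&1\\0&0\end{pmatrix}$, $Q=\begin{pmatrix}0&0\\1&0\end{pmatrix}$, and $\exp$ is the matrix exponential. The factorization cost of $g\in SL(2,\mathbb{R})$ is $$\mathcal{T}(g)=\inf\Big\{\sum_{i=1}^k|t_i| : g=\exp(t_1A_1)\cdots\exp(t_kA_k),\ k\in\mathbb{N},\ t_i\in\mathbb{R},\ A_i\in\{P,Q\}\Big\}.$$ A factor $\exp(tP)$ or $\exp(tQ)$ has cost $|t|$; a factor $\exp(t(P+Q))=\exp\big(2t\cdot\tfrac12(P+Q)\big)$ has cost $2|t|$ (the admissible directions are the elements of the convex hull of $\{\pm P,\pm Q\}$, which contains $\pm\frac12(P+Q)$). The cost of a product of such factors is the sum of the costs of its factors. A factorization of $g$ is called optimal if its cost equals $\mathcal{T}(g)$. *)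

theory Defs
  imports "HOL-Analysis.Analysis"
begin

definition SL2 :: "(real^2^2) set" where
  "SL2 = {g. det g = 1}"

definition mat_P :: "real^2^2" where
  "mat_P = vector [vector [0, 1], vector [0, 0]]"

definition mat_Q :: "real^2^2" where
  "mat_Q = vector [vector [0, 0], vector [1, 0]]"

(* The library's "exp" and "^" do not apply to matrices: "*" on vectors is componentwise,
   the matrix product is "**". *)
primrec mpow :: "real^'n^'n \<Rightarrow> nat \<Rightarrow> real^'n^'n" where
  "mpow A 0 = mat 1"
| "mpow A (Suc n) = A ** mpow A n"

definition mexp :: "real^'n^'n \<Rightarrow> real^'n^'n" where
  "mexp A = (\<Sum>n. mpow A n /\<^sub>R fact n)"

(* A word [(t\<^sub>1, A\<^sub>1), ..., (t\<^sub>k, A\<^sub>k)] stands for the formal product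
   exp (t\<^sub>1 A\<^sub>1) ... exp (t\<^sub>k A\<^sub>k); the empty word stands for the identity. *)
type_synonym fword = "(real \<times> (real^2^2)) list"

definition word_prod :: "fword \<Rightarrow> real^2^2" where
  "word_prod w = foldr (\<lambda>(t, A) g. mexp (t *\<^sub>R A) ** g) w (mat 1)"

definition words_over :: "(real^2^2) set \<Rightarrow> fword set" where
  "words_over S = {w. \<forall>(t, A) \<in> set w. A \<in> S}"

definition factorization_cost :: "real^2^2 \<Rightarrow> real" where
  "factorization_cost g = Inf {(\<Sum>(t, A) \<leftarrow> w. \<bar>t\<bar>) | w. w \<in> words_over {mat_P, mat_Q} \<and> g = word_prod w}"

(* Only meant for A in {P, Q, P + Q}. The factor 2 comes from
   exp (t (P + Q)) = exp (2 t (P + Q) / 2), where (P + Q) / 2 is an admissible direction. *)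
definition factor_cost :: "real \<times> (real^2^2) \<Rightarrow> real" where
  "factor_cost = (\<lambda>(t, A). if A = mat_P + mat_Q then 2 * \<bar>t\<bar> else \<bar>t\<bar>)"

definition word_cost :: "fword \<Rightarrow> real" where
  "word_cost w = (\<Sum>f \<leftarrow> w. factor_cost f)"

definition optimal_factorization :: "real^2^2 \<Rightarrow> fword \<Rightarrow> bool" where
  "optimal_factorization g w \<longleftrightarrow>
     w \<in> words_over {mat_P, mat_Q, mat_P + mat_Q} \<and>
     g = word_prod w \<and> word_cost w = factorization_cost g"

end

theory Submission
  imports Defs
begin

text \<open>
Write $P^t$, $Q^t$, $S^t$ for the exponentials of $tP$, $tQ$, $t(P+Q)$. A word is a list of such
letters, $P^t$ and $Q^t$ costing $|t|$ and the diagonal letter $S^t$ costing $2|t|$. The identity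
$S^{2\,\mathrm{artanh}\,u} = Q^u P^{2u/(1-u^2)} Q^u$ has a shear side that exceeds the cost of the
diagonal side only by $O(u^3)$. Cutting $S^t$ into many pieces therefore gives shear words with the
same product and almost the same cost (\<open>diagonal_by_shears\<close>), and the factorization cost is the
infimum of the costs of all words in the three letters. It has to be shown that this infimum is
attained by a word with six letters.

Existence. A word whose times all have one sign equals some $X^a S^s Y^b$ with $X, Y \in \{P, Q\}$
and times of that sign, at no greater cost (\<open>nonneg_word_to_block\<close>). So a word with at most $n$
changes of sign can be brought into a bounded number of letters, and compactness yields a cheapest
word among those with a given product and at most $n$ changes of sign (\<open>minimiser_exists\<close>).

Shape. Let $w$ be such a cheapest word, and among its equally expensive rewritings one of least weight,
which essentially counts letters (\<open>tight\<close>). Any four alternating shears lie in a curve of four-letter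
words with the same product (\<open>slide_eval\<close>), so the derivative of the cost along this curve vanishes
(\<open>window_stationary\<close>); next to a diagonal letter the same works after replacing a small end of that
letter by three shears (\<open>diagonal_window_stationary\<close>, \<open>diagonal_corner_length\<close>). These equations
and a few explicit rewritings leave hardly any words:

  \<^item> Five consecutive shears have strictly alternating signs (\<open>shear_five_zigzag\<close>). In a longer
    zigzag all inner times equal some $t$; if $t^2 < 2$, making two of them unequal is cheaper
    (\<open>short_zigzag_not_cheap\<close>), and if $t^2 \ge 2$, five of them have a cheaper rewriting with
    fewer turns (\<open>long_zigzag_not_cheap\<close>). So there are at most six shears in a row.

  \<^item> A diagonal letter has neighbours of its own sign. If its time is positive and three letters
    follow it, these are $X^{r} Y^{-2r} X^{d}$ with $r = \sqrt 2$ (\<open>diagonal_right_three\<close>), and there are never four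
    (\<open>diagonal_right_length\<close>). Here the identity $S^s X^r Y^{-r} = X^r Y^{-r} S^{-s}$ matters: it
    moves a diagonal letter through a word without changing the cost, and from its new place it
    often exposes a word that can be shortened. By symmetry there are at most three letters before
    the diagonal letter, and three on both sides are impossible (\<open>seven_letters_not_cheap\<close>).

Hence $w$ has at most six letters (\<open>tight_length\<close>). As every word can be reduced to six letters, which have at most seven changes of
sign, the minimum for $n = 7$ is the minimum over all words.
\<close>

section \<open>Products of shears and diagonal letters\<close>

definition mk :: "real \<Rightarrow> real \<Rightarrow> real \<Rightarrow> real \<Rightarrow> real^2^2" where
  "mk a b c d = vector [vector [a, b], vector [c, d]]"

lemma mk_nth [simp]: "mk a b c d $ 1 $ 1 = a" "mk a b c d $ 1 $ 2 = b"
  "mk a b c d $ 2 $ 1 = c" "mk a b c d $ 2 $ 2 = d"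
  by (simp_all add: mk_def)

lemma mk_eq_iff [simp]: "mk a b c d = mk a' b' c' d' \<longleftrightarrow> a = a' \<and> b = b' \<and> c = c' \<and> d = d'"
  by (metis mk_nth)

lemma mk_mult: "mk a b c d ** mk a' b' c' d' =
    mk (a * a' + b * c') (a * b' + b * d') (c * a' + d * c') (c * b' + d * d')"
  by (simp add: vec_eq_iff forall_2 matrix_matrix_mult_def sum_2)

lemma mat_1_mk: "mat 1 = mk 1 0 0 1"
  by (simp add: vec_eq_iff forall_2 mat_def)

lemma mk_surj: "g = mk (g $ 1 $ 1) (g $ 1 $ 2) (g $ 2 $ 1) (g $ 2 $ 2)"
  by (simp add: vec_eq_iff forall_2)

lemma det_mk [simp]: "det (mk a b c d) = a * d - b * c"
  by (simp add: det_2)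

datatype letter = LP | LQ | LS

text \<open>The entry $(l, t)$ stands for the exponential of $t$ times the direction \<open>gen l\<close>.\<close>

type_synonym word = "(letter \<times> real) list"

fun shear :: "letter \<Rightarrow> real \<Rightarrow> real^2^2" where
  "shear LP t = mk 1 t 0 1"
| "shear LQ t = mk 1 0 t 1"
| "shear LS t = mk (cosh t) (sinh t) (sinh t) (cosh t)"

fun gen :: "letter \<Rightarrow> real^2^2" where
  "gen LP = mat_P"
| "gen LQ = mat_Q"
| "gen LS = mat_P + mat_Q"

lemma gen_mk: "gen l = (case l of LP \<Rightarrow> mk 0 1 0 0 | LQ \<Rightarrow> mk 0 0 1 0 | LS \<Rightarrow> mk 0 1 1 0)"
  by (cases l) (simp_all add: vec_eq_iff forall_2 mat_P_def mat_Q_def)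

lemma mexp_nilpotent:
  fixes A :: "real^'n^'n"
  assumes "A ** A = 0"
  shows "mexp A = mat 1 + A"
proof -
  have "mpow A (Suc (Suc n)) = 0" for n
    using assms by (simp add: matrix_mul_assoc)
  then have "(\<lambda>n. mpow A n /\<^sub>R fact n) sums (\<Sum>n\<in>{0, Suc 0}. mpow A n /\<^sub>R fact n)"
  proof (intro sums_finite)
    fix n assume "n \<notin> {0, Suc 0}"
    then obtain k where "n = Suc (Suc k)"
      by (metis insertCI not0_implies_Suc)
    then show "mpow A n /\<^sub>R fact n = 0"
      using \<open>\<And>n. mpow A (Suc (Suc n)) = 0\<close> by (simp del: mpow.simps)
  qed simp
  then show ?thesis
    unfolding mexp_def by (simp add: sums_iff)
qed

text \<open>The even powers of $tA$ are multiples of the identity and the odd ones multiples of $A$, so the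
exponential series splits into those of $\cosh$ and $\sinh$.\<close>

lemma mexp_involution:
  fixes A :: "real^'n^'n"
  assumes "A ** A = mat 1"
  shows "mexp (t *\<^sub>R A) = cosh t *\<^sub>R mat 1 + sinh t *\<^sub>R A"
proof -
  have pow: "mpow (t *\<^sub>R A) n = t ^ n *\<^sub>R (if even n then mat 1 else A)" for n
    by (induction n) (simp_all add: scalar_matrix_assoc[symmetric] matrix_scalar_ac assms)
  have "(\<lambda>n. (if even n then t ^ n /\<^sub>R fact n else 0) *\<^sub>R mat 1 +
             (if even n then 0 else t ^ n /\<^sub>R fact n) *\<^sub>R A) sums
        (cosh t *\<^sub>R mat 1 + sinh t *\<^sub>R A)"
    by (intro sums_add sums_scaleR_left cosh_converges sinh_converges)
  moreover have "(if even n then t ^ n /\<^sub>R fact n else 0) *\<^sub>R mat 1 +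
             (if even n then 0 else t ^ n /\<^sub>R fact n) *\<^sub>R A = mpow (t *\<^sub>R A) n /\<^sub>R fact n" for n
    by (simp add: pow)
  ultimately show ?thesis
    unfolding mexp_def by (simp add: sums_iff)
qed

lemma mexp_gen: "mexp (t *\<^sub>R gen l) = shear l t"
proof (cases "l = LS")
  case True
  have "gen LS ** gen LS = mat 1"
    by (simp only: gen_mk) (simp add: mk_mult mat_1_mk)
  then have "mexp (t *\<^sub>R gen LS) = cosh t *\<^sub>R mat 1 + sinh t *\<^sub>R gen LS"
    by (rule mexp_involution)
  also have "\<dots> = shear LS t"
    by (simp only: gen_mk) (simp add: vec_eq_iff forall_2 mat_1_mk)
  finally show ?thesis using True by simp
next
  case False
  have "(t *\<^sub>R gen l) ** (t *\<^sub>R gen l) = 0"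
    using False by (cases l; simp only: gen_mk) (simp_all add: vec_eq_iff forall_2 matrix_matrix_mult_def sum_2)
  then have "mexp (t *\<^sub>R gen l) = mat 1 + t *\<^sub>R gen l"
    by (rule mexp_nilpotent)
  also have "\<dots> = shear l t"
    using False by (cases l; simp only: gen_mk) (simp_all add: vec_eq_iff forall_2 mat_1_mk)
  finally show ?thesis .
qed

definition eval :: "word \<Rightarrow> real^2^2" where
  "eval w = foldr (\<lambda>(l, t) g. shear l t ** g) w (mat 1)"

fun speed :: "letter \<Rightarrow> real" where
  "speed LP = 1" | "speed LQ = 1" | "speed LS = 2"

definition cost :: "word \<Rightarrow> real" where
  "cost w = (\<Sum>(l, t) \<leftarrow> w. speed l * \<bar>t\<bar>)"

lemma eval_simps [simp]: "eval [] = mat 1" "eval ((l, t) # w) = shear l t ** eval w"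
  by (simp_all add: eval_def)

lemma eval_append [simp]: "eval (u @ v) = eval u ** eval v"
  by (induction u) (auto simp: matrix_mul_assoc)

lemma cost_simps [simp]: "cost [] = 0" "cost ((l, t) # w) = speed l * \<bar>t\<bar> + cost w"
  by (simp_all add: cost_def)

lemma cost_append [simp]: "cost (u @ v) = cost u + cost v"
  by (simp add: cost_def)

lemma speed_pos [simp]: "0 < speed l" "0 \<le> speed l" by (cases l; simp)+

lemma cost_nonneg [simp]: "0 \<le> cost w"
  by (induction w) auto

section \<open>Sign changes and cheap words\<close>

text \<open>The number of sign changes among the times of \<open>w\<close> when the sign before the word is prescribed to be
\<open>s\<close> and the sign after it to be \<open>r\<close> (\<open>True\<close> is positive); zero times are skipped. With both ends
prescribed the count is a $2 \times 2$ matrix, and concatenation of words is a product of such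
matrices over (min, +), see \<open>flips_append_le\<close> and \<open>flips_append_split\<close>.\<close>

fun flips :: "bool \<Rightarrow> word \<Rightarrow> bool \<Rightarrow> nat" where
  "flips s [] r = of_bool (s \<noteq> r)"
| "flips s ((l, t) # w) r = (if t = 0 then flips s w r else of_bool (s \<noteq> (0 < t)) + flips (0 < t) w r)"

lemma flips_switch: "flips s w r \<le> of_bool (s \<noteq> s') + flips s' w r"
proof (induction w arbitrary: s s')
  case (Cons a w)
  obtain l t where "a = (l, t)" by fastforce
  then show ?case using Cons by (cases "t = 0") (auto simp: of_bool_def)
qed (auto simp: of_bool_def)

lemma flips_append_le: "flips s (u @ v) r \<le> flips s u q + flips q v r"
proof (induction u arbitrary: s)
  case Nil
  then show ?case using flips_switch by simp
next
  case (Cons a u)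
  obtain l t where "a = (l, t)" by fastforce
  then show ?case using Cons by (simp add: add.assoc)
qed

lemma flips_append_split: "\<exists>q. flips s (u @ v) r = flips s u q + flips q v r"
proof (induction u arbitrary: s)
  case Nil
  show ?case by (rule exI[of _ s]) simp
next
  case (Cons a u)
  obtain l t where "a = (l, t)" by fastforce
  then show ?case using Cons by (cases "t = 0") (auto simp: add.assoc)
qed

lemma flips_singleton_sym: "flips s [a] r = flips r [a] s"
  by (cases a) auto

lemma flips_rev_le: "flips s (rev w) r \<le> flips r w s"
proof (induction w arbitrary: r s)
  case (Cons a w)
  obtain q where "flips r ([a] @ w) s = flips r [a] q + flips q w s"
    using flips_append_split by blast
  moreover have "flips s (rev w @ [a]) r \<le> flips s (rev w) q + flips q [a] r"
    by (rule flips_append_le)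
  ultimately show ?case using Cons[of s q] flips_singleton_sym[of q a r] by simp
qed simp

lemma flips_rev: "flips s (rev w) r = flips r w s"
  using flips_rev_le[of s w r] flips_rev_le[of r "rev w" s] by simp

text \<open>If \<open>u \<preceq> w\<close>, then \<open>u\<close> can replace \<open>w\<close> inside every word without producing more sign changes.\<close>

definition prec :: "word \<Rightarrow> word \<Rightarrow> bool" (infix "\<preceq>" 50) where
  "u \<preceq> w \<longleftrightarrow> (\<forall>s r. flips s u r \<le> flips s w r)"

lemma prec_refl [simp]: "w \<preceq> w"
  by (simp add: prec_def)

lemma prec_trans: "u \<preceq> v \<Longrightarrow> v \<preceq> w \<Longrightarrow> u \<preceq> w"
  unfolding prec_def by (meson le_trans)

lemma prec_append:
  assumes "u' \<preceq> u" "v' \<preceq> v"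
  shows "u' @ v' \<preceq> u @ v"
  unfolding prec_def
proof (intro allI)
  fix s r
  obtain q where "flips s (u @ v) r = flips s u q + flips q v r"
    using flips_append_split by blast
  then show "flips s (u' @ v') r \<le> flips s (u @ v) r"
    using flips_append_le[of s u' v' r q] assms unfolding prec_def
    by (metis (no_types, lifting) add_mono le_trans)
qed

lemma prec_rev: "u \<preceq> w \<Longrightarrow> rev u \<preceq> rev w"
  by (simp add: prec_def flips_rev)

definition neg :: "word \<Rightarrow> word" where
  "neg w = map (\<lambda>(l, t). (l, - t)) w"

lemma neg_simps [simp]: "neg [] = []" "neg ((l, t) # w) = (l, - t) # neg w"
  "neg (u @ v) = neg u @ neg v" "neg (neg w) = w" "length (neg w) = length w"
  by (auto simp: neg_def case_prod_beta intro: map_idI)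

lemma flips_neg: "flips s (neg w) r = flips (\<not> s) w (\<not> r)"
proof (induction w arbitrary: s)
  case (Cons a w)
  obtain l t where "a = (l, t)" by fastforce
  then show ?case using Cons by (cases "t = 0"; cases "0 < t") auto
qed auto

lemma prec_neg: "u \<preceq> w \<Longrightarrow> neg u \<preceq> neg w"
  by (simp add: prec_def flips_neg)

lemma eval_neg_eq: "eval u = eval v \<Longrightarrow> eval (neg u) = eval (neg v)"
proof -
  define f :: "real^2^2 \<Rightarrow> real^2^2" where "f g = mk (g$1$1) (- g$1$2) (- g$2$1) (g$2$2)" for g
  have f_mult: "f (g ** h) = f g ** f h" for g h
    by (simp add: f_def vec_eq_iff forall_2 matrix_matrix_mult_def sum_2)
  have "eval (neg w) = f (eval w)" for w
  proof (induction w)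
    case Nil
    show ?case by (simp add: f_def mat_1_mk)
  next
    case (Cons a w)
    obtain l t where "a = (l, t)" by fastforce
    moreover have "shear l (- t) = f (shear l t)"
      by (cases l) (simp_all add: f_def)
    ultimately show ?case using Cons by (simp add: f_mult)
  qed
  then show "eval u = eval v \<Longrightarrow> eval (neg u) = eval (neg v)" by simp
qed

lemma eval_rev_eq: "eval u = eval v \<Longrightarrow> eval (rev u) = eval (rev v)"
proof -
  define f :: "real^2^2 \<Rightarrow> real^2^2" where "f g = mk (g$2$2) (g$1$2) (g$2$1) (g$1$1)" for g
  have f_mult: "f (g ** h) = f h ** f g" for g h
    by (simp add: f_def vec_eq_iff forall_2 matrix_matrix_mult_def sum_2)
  have "eval (rev w) = f (eval w)" for w
  proof (induction w)
    case Nil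
    show ?case by (simp add: f_def mat_1_mk)
  next
    case (Cons a w)
    obtain l t where "a = (l, t)" by fastforce
    moreover have "shear l t = f (shear l t)"
      by (cases l) (simp_all add: f_def)
    ultimately show ?case using Cons by (simp add: f_mult)
  qed
  then show "eval u = eval v \<Longrightarrow> eval (rev u) = eval (rev v)" by simp
qed

lemma cost_neg [simp]: "cost (neg w) = cost w"
  by (induction w) auto

lemma cost_rev [simp]: "cost (rev w) = cost w"
  by (induction w) auto

text \<open>Minimality is required only among words without additional sign changes, because only there a
cheapest word is known to exist beforehand. The property passes to factors, so that it can be
refuted by looking at a few consecutive letters.\<close>

definition cheap :: "word \<Rightarrow> bool" where
  "cheap w \<longleftrightarrow> (\<forall>v. v \<preceq> w \<longrightarrow> eval v = eval w \<longrightarrow> cost w \<le> cost v)"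

lemma cheapD: "cheap w \<Longrightarrow> v \<preceq> w \<Longrightarrow> eval v = eval w \<Longrightarrow> cost w \<le> cost v"
  by (simp add: cheap_def)

lemma cheap_replace: "cheap w \<Longrightarrow> v \<preceq> w \<Longrightarrow> eval v = eval w \<Longrightarrow> cost v \<le> cost w \<Longrightarrow> cheap v"
  unfolding cheap_def by (metis order_trans prec_trans)

lemma cheap_factor:
  assumes "cheap (x @ u @ y)"
  shows "cheap u"
  unfolding cheap_def
proof (intro allI impI)
  fix v assume "v \<preceq> u" "eval v = eval u"
  then have "cost (x @ u @ y) \<le> cost (x @ v @ y)"
    by (intro cheapD[OF assms]) (auto intro!: prec_append)
  then show "cost u \<le> cost v" by simp
qed

lemma cheap_tl: "cheap (a # w) \<Longrightarrow> cheap w"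
  using cheap_factor[of "[a]" w "[]"] by simp

lemma cheap_init: "cheap (u @ v) \<Longrightarrow> cheap u"
  using cheap_factor[of "[]" u v] by simp

lemma cheap_neg: "cheap (neg w) \<longleftrightarrow> cheap w"
proof -
  have "cheap w \<Longrightarrow> cheap (neg w)" for w
    unfolding cheap_def by (metis cost_neg eval_neg_eq neg_simps(4) prec_neg)
  then show ?thesis by (metis neg_simps(4))
qed

lemma cheap_rev: "cheap (rev w) \<longleftrightarrow> cheap w"
proof -
  have "cheap w \<Longrightarrow> cheap (rev w)" for w
    unfolding cheap_def by (metis cost_rev eval_rev_eq prec_rev rev_rev_ident)
  then show ?thesis by (metis rev_rev_ident)
qed

section \<open>Sliding four alternating shears\<close>

definition shear_pair :: "letter \<Rightarrow> letter \<Rightarrow> bool" where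
  "shear_pair X Y \<longleftrightarrow> X = LP \<and> Y = LQ \<or> X = LQ \<and> Y = LP"

lemma shear_pair_sym: "shear_pair X Y \<Longrightarrow> shear_pair Y X" by (auto simp: shear_pair_def)

lemma shear_pair_speed: assumes "shear_pair X Y" shows "speed X = 1" "speed Y = 1"
  using assms by (auto simp: shear_pair_def)



lemma shear_add: "shear l s ** shear l t = shear l (s + t)"
  by (cases l) (simp_all add: mk_mult cosh_add sinh_add algebra_simps)

lemma shear_0 [simp]: "shear l 0 = mat 1"
  by (cases l) (simp_all add: mat_1_mk)

text \<open>The product of four alternating shears lies in a three-dimensional group, so there is a curve of
such words with the same product. It is the substance of the identity
$X^x Y^{bc/c'} X^{c'} = Y^b X^c Y^{bx/c'}$, which holds exactly for $c' = c - (1 + bc)x$.\<close>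

lemma slide_eval:
  assumes "shear_pair X Y" and c': "c' = c - (1 + b * c) * x" "c' \<noteq> 0"
  shows "eval [(X, a + x), (Y, b * c / c'), (X, c'), (Y, d - b * x / c')] = eval [(X, a), (Y, b), (X, c), (Y, d)]"
proof -
  have 1: "x * (b * c / c') = b * (x * c / c')" "x + c' * (x * (b * c / c') + 1) = c" 
    "b * c / c' = b + (b * c + 1) * (b * x / c')" "(b * c / c') * c' = b * c"
    using assms(3) unfolding c'(1) by (simp_all add: divide_simps) (simp_all add: algebra_simps)
  have core: "shear X x ** (shear Y (b * c / c') ** shear X c') = shear Y b ** (shear X c ** shear Y (b * x / c'))"
    using \<open>shear_pair X Y\<close> 1 assms(3) unfolding shear_pair_def
    by (auto simp: mk_mult algebra_simps add_divide_distrib)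
  have "eval [(X, a + x), (Y, b * c / c'), (X, c'), (Y, d - b * x / c')]
      = shear X a ** (shear X x ** (shear Y (b * c / c') ** shear X c')) ** shear Y (d - b * x / c')"
    by (simp add: shear_add[symmetric] matrix_mul_assoc)
  also have "\<dots> = shear X a ** shear Y b ** shear X c ** (shear Y (b * x / c') ** shear Y (d - b * x / c'))"
    unfolding core by (simp only: matrix_mul_assoc)
  also have "\<dots> = eval [(X, a), (Y, b), (X, c), (Y, d)]"
    by (simp add: shear_add matrix_mul_assoc)
  finally show ?thesis .
qed

lemma prec_same_sgn:
  assumes "list_all2 (\<lambda>(l, t) (l', t'). sgn t = sgn t') v w"
  shows "v \<preceq> w"
proof -
  have "flips s v r = flips s w r" for s r
    using assms
  proof (induction arbitrary: s rule: list_all2_induct)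
    case (Cons x xs y ys)
    then show ?case by (cases x; cases y) (auto simp: sgn_if split: if_splits)
  qed simp
  then show ?thesis by (simp add: prec_def)
qed

lemma eventually_sgn_eq:
  fixes f :: "real \<Rightarrow> real"
  assumes "(f \<longlongrightarrow> l) F" "l \<noteq> 0"
  shows "eventually (\<lambda>x. sgn (f x) = sgn l) F"
proof (cases "l > 0")
  case True
  show ?thesis by (rule eventually_mono[OF order_tendstoD(1)[OF assms(1) True]]) (use True in auto)
next
  case False
  then have l: "l < 0" using assms(2) by simp
  show ?thesis by (rule eventually_mono[OF order_tendstoD(2)[OF assms(1) l]]) (use l in auto)
qed

text \<open>With \<open>x * h x\<close> as the change of cost along a curve, a nonzero limit of \<open>h\<close> means that one of the
two directions makes the cost smaller.\<close>

lemma descent_direction: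
  fixes h :: "real \<Rightarrow> real"
  assumes h: "(h \<longlongrightarrow> l) (at 0)" "l \<noteq> 0" and P: "eventually P (at 0)"
  shows "\<exists>x. P x \<and> x * h x < 0"
proof (cases "l > 0")
  case True
  have "eventually P (at_left 0)" "eventually (\<lambda>x. h x > 0) (at_left 0)" "eventually (\<lambda>x. x < 0) (at_left (0::real))"
    using P order_tendstoD(1)[OF h(1) True] by (simp_all add: eventually_at_split eventually_at_filter[of "\<lambda>x. x < 0"])
  then have "eventually (\<lambda>x. P x \<and> x * h x < 0) (at_left 0)"
    by eventually_elim (auto intro: mult_neg_pos)
  then show ?thesis
    using eventually_happens'[OF trivial_limit_at_left_real] by blast
next
  case False
  then have l: "l < 0" using assms(2) by simp
  have "eventually P (at_right 0)" "eventually (\<lambda>x. h x < 0) (at_right 0)" "eventually (\<lambda>x. x > 0) (at_right (0::real))"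
    using P order_tendstoD(2)[OF h(1) l] by (simp_all add: eventually_at_split eventually_at_filter[of "\<lambda>x. 0 < x"])
  then have "eventually (\<lambda>x. P x \<and> x * h x < 0) (at_right 0)"
    by eventually_elim (auto intro: mult_pos_neg)
  then show ?thesis
    using eventually_happens'[OF trivial_limit_at_right_real] by blast
qed

lemma abs_sgn_mult: "\<bar>x::real\<bar> = sgn x * x"
  by (simp add: sgn_if)

text \<open>The left side is $c$ times the derivative at $x = 0$ of the cost along the curve of \<open>slide_eval\<close>,
where small $x$ of either sign leaves all four signs unchanged.\<close>

lemma window_stationary:
  assumes "shear_pair X Y" and cheap: "cheap [(X, a), (Y, b), (X, c), (Y, d)]"
    and nz: "a \<noteq> 0" "b \<noteq> 0" "c \<noteq> 0" "d \<noteq> 0"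
  shows "c * (sgn a - sgn c * (1 + b * c)) + b * (sgn b * (1 + b * c) - sgn d) = 0"
proof (rule ccontr)
  assume neq: "\<not> ?thesis"
  define c' where "c' x = c - (1 + b * c) * x" for x
  define h where "h x = sgn a - sgn c * (1 + b * c) + b / c' x * (sgn b * (1 + b * c) - sgn d)" for x
  have lim: "(c' \<longlongrightarrow> c) (at 0)" unfolding c'_def by (auto intro!: tendsto_eq_intros)
  have "eventually (\<lambda>x. sgn (a + x) = sgn a \<and> sgn (c' x) = sgn c \<and>
      sgn (d - b * x / c' x) = sgn d) (at 0)"
    using nz by (intro eventually_conj eventually_sgn_eq) (auto intro!: tendsto_eq_intros lim)
  moreover have "(h \<longlongrightarrow> sgn a - sgn c * (1 + b * c) + b / c * (sgn b * (1 + b * c) - sgn d)) (at 0)"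
    unfolding h_def using nz by (intro tendsto_intros lim)
  moreover have "sgn a - sgn c * (1 + b * c) + b / c * (sgn b * (1 + b * c) - sgn d) \<noteq> 0"
    using neq nz by (simp add: field_simps)
  ultimately obtain x where x: "sgn (a + x) = sgn a" "sgn (c' x) = sgn c"
      "sgn (d - b * x / c' x) = sgn d" "x * h x < 0"
    using descent_direction by blast
  have c'0: "c' x \<noteq> 0" using x(2) nz by (metis sgn_zero_iff)
  have sgnb: "sgn (b * c / c' x) = sgn b"
    using x(2) nz by (simp add: sgn_mult sgn_divide)
  let ?v = "[(X, a + x), (Y, b * c / c' x), (X, c' x), (Y, d - b * x / c' x)]"
  have "cost [(X, a), (Y, b), (X, c), (Y, d)] \<le> cost ?v"
    using x sgnb by (intro cheapD[OF cheap] prec_same_sgn slide_eval[OF \<open>shear_pair X Y\<close> _ c'0]) (auto simp: c'_def)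
  moreover have "cost ?v - cost [(X, a), (Y, b), (X, c), (Y, d)] = x * h x"
  proof -
    have "b * c / c' x - b = b * (1 + b * c) * x / c' x"
      using c'0 by (simp add: field_simps c'_def)
    then have 1: "b * c / c' x = b + b * (1 + b * c) * x / c' x" by simp
    have "\<bar>a + x\<bar> = sgn a * (a + x)" "\<bar>b * c / c' x\<bar> = sgn b * (b * c / c' x)"
      "\<bar>c' x\<bar> = sgn c * c' x" "\<bar>d - b * x / c' x\<bar> = sgn d * (d - b * x / c' x)"
      using x sgnb by (metis abs_sgn_mult)+
    then have "cost ?v - cost [(X, a), (Y, b), (X, c), (Y, d)] =
        sgn a * x + sgn b * (b * c / c' x - b) + sgn c * (c' x - c) - sgn d * (b * x / c' x)"
      using shear_pair_speed[OF \<open>shear_pair X Y\<close>] by (simp add: abs_sgn_mult[of a] abs_sgn_mult[of b]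
          abs_sgn_mult[of c] abs_sgn_mult[of d] right_diff_distrib distrib_left)
    also have "\<dots> = x * h x"
      unfolding 1 by (simp add: h_def c'_def algebra_simps add_divide_distrib diff_divide_distrib)
    finally show ?thesis .
  qed
  ultimately show False using x(4) by simp
qed

section \<open>Diagonal letters as three shears\<close>

lemma tip_sinh_cosh:
  fixes u :: real assumes "0 < u" "u < 1"
  shows "cosh (2 * artanh u) = (1 + u\<^sup>2) / (1 - u\<^sup>2)" "sinh (2 * artanh u) = 2 * u / (1 - u\<^sup>2)"
proof -
  have u: "1 - u\<^sup>2 \<noteq> 0" using assms by (simp add: abs_square_less_1 less_imp_neq power2_eq_1_iff)
  have "2 * artanh u = ln ((1 + u) / (1 - u))" by (simp add: artanh_def)
  then show "cosh (2 * artanh u) = (1 + u\<^sup>2) / (1 - u\<^sup>2)" "sinh (2 * artanh u) = 2 * u / (1 - u\<^sup>2)"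
    using assms u by (simp_all add: cosh_ln_real sinh_ln_real divide_simps power2_eq_square)
      (simp_all add: algebra_simps)
qed

lemma tip_eval:
  assumes "shear_pair X Y" "0 < u" "u < 1"
  shows "eval [(X, u), (Y, 2 * u / (1 - u\<^sup>2)), (X, u)] = shear LS (2 * artanh u)"
proof -
  have "1 - u\<^sup>2 \<noteq> 0" using assms by (simp add: less_imp_neq power2_eq_1_iff)
  then show ?thesis
    using assms(1) unfolding shear_pair_def
    by (auto simp: mk_mult mat_1_mk tip_sinh_cosh[OF assms(2,3)])
      (auto simp: divide_simps power2_eq_square, auto simp: algebra_simps)
qed

text \<open>Because of the second inequality the diagonal letter is cheaper than the three shears of \<open>tip_eval\<close>.\<close>

lemma artanh_bounds:
  fixes u :: real assumes "0 < u" "u < 1"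
  shows "u \<le> artanh u" "4 * artanh u < 2 * u + 2 * u / (1 - u\<^sup>2)"
proof -
  have sq: "x\<^sup>2 < 1" if "0 \<le> x" "x \<le> u" for x
    using that assms by (simp add: abs_square_less_1)
  have "artanh 0 - 0 \<le> artanh u - u"
  proof (rule DERIV_nonneg_imp_nondecreasing[of 0 u "\<lambda>x. artanh x - x"])
    fix x assume x: "0 \<le> x" "x \<le> u"
    show "\<exists>y. ((\<lambda>x. artanh x - x) has_real_derivative y) (at x) \<and> 0 \<le> y"
      using sq[OF x] x assms
      by (intro exI[of _ "1 / (1 - x\<^sup>2) - 1"]) (auto intro!: derivative_eq_intros simp: field_simps)
  qed (use assms in simp)
  then show "u \<le> artanh u" by simp
  have "2 * 0 + 2 * 0 / (1 - 0\<^sup>2) - 4 * artanh 0 < 2 * u + 2 * u / (1 - u\<^sup>2) - 4 * artanh u"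
  proof (rule DERIV_pos_imp_increasing_open[of 0 u "\<lambda>x. 2 * x + 2 * x / (1 - x\<^sup>2) - 4 * artanh x"])
    fix x assume x: "0 < x" "x < u"
    have s: "x\<^sup>2 < 1" using sq[of x] x by simp
    have "0 < 2 + (2 * (1 - x\<^sup>2) + 4 * x\<^sup>2) / (1 - x\<^sup>2)\<^sup>2 - 4 / (1 - x\<^sup>2)"
    proof -
      have "2 + (2 * (1 - x\<^sup>2) + 4 * x\<^sup>2) / (1 - x\<^sup>2)\<^sup>2 - 4 / (1 - x\<^sup>2) = 2 * x\<^sup>2 * (1 + x\<^sup>2) / (1 - x\<^sup>2)\<^sup>2"
        using s by (simp add: divide_simps power2_eq_square) (simp add: algebra_simps)
      also have "\<dots> > 0" using s x by (auto intro!: divide_pos_pos mult_pos_pos add_pos_pos)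
      finally show ?thesis .
    qed
    moreover have "((\<lambda>x. 2 * x + 2 * x / (1 - x\<^sup>2) - 4 * artanh x) has_real_derivative
        2 + (2 * (1 - x\<^sup>2) + 4 * x\<^sup>2) / (1 - x\<^sup>2)\<^sup>2 - 4 / (1 - x\<^sup>2)) (at x)"
      using s x assms by (auto intro!: derivative_eq_intros simp: power2_eq_square algebra_simps)
    ultimately show "\<exists>y. ((\<lambda>x. 2 * x + 2 * x / (1 - x\<^sup>2) - 4 * artanh x) has_real_derivative y) (at x) \<and> 0 < y"
      by blast
  next
    show "continuous_on {0..u} (\<lambda>x. 2 * x + 2 * x / (1 - x\<^sup>2) - 4 * artanh x)"
    proof (intro continuous_intros)
      show "\<forall>x\<in>{0..u}. 1 - x\<^sup>2 \<noteq> 0" using sq by force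
    qed (use assms in auto)
  qed (use assms in simp)
  then show "4 * artanh u < 2 * u + 2 * u / (1 - u\<^sup>2)" by simp
qed

section \<open>Words of shears that are not cheap\<close>

lemma ex_small:
  assumes "eventually P (at_right (0::real))"
  shows "\<exists>x>0. P x"
proof -
  have "eventually (\<lambda>x::real. 0 < x) (at_right 0)"
    by (simp add: eventually_at_filter)
  with assms have "eventually (\<lambda>x. 0 < x \<and> P x) (at_right 0)"
    by eventually_elim simp
  then show ?thesis
    using eventually_happens'[OF trivial_limit_at_right_real] by blast
qed

text \<open>Sliding with a fourth letter $Y^0$ and $x = -y < 0$ turns the word into four positive letters and
changes the cost by $bcy\,(1 - b/c')$, which is negative while $c' < b$.\<close>

lemma staircase_not_cheap_aux:
  assumes XY: "shear_pair X Y" and pos: "0 < a" "0 < b" "0 < c" and cb: "c < b"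
  shows "\<not> cheap [(X, a), (Y, b), (X, c)]"
proof
  assume cheap: "cheap [(X, a), (Y, b), (X, c)]"
  \<comment> \<open>half of what keeps the first letter positive and $c' < b$\<close>
  define y where "y = min (a / 2) ((b - c) / (2 * (1 + b * c)))"
  have y: "0 < y" "y < a" using pos cb by (auto simp: y_def intro!: divide_pos_pos mult_pos_pos add_pos_pos)
  have "(1 + b * c) * y \<le> (1 + b * c) * ((b - c) / (2 * (1 + b * c)))"
    using pos by (intro mult_left_mono) (auto simp: y_def)
  also have "\<dots> = (b - c) / 2" using mult_pos_pos[OF pos(2,3)] by (simp add: field_simps)
  finally have "(1 + b * c) * y \<le> (b - c) / 2" .
  define c' where "c' = c - (1 + b * c) * (- y)"
  have c': "c < c'" "c' < b" using \<open>(1 + b * c) * y \<le> (b - c) / 2\<close> y pos cb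
    by (auto simp: c'_def) (simp add: add_pos_pos)
  let ?v = "[(X, a + (- y)), (Y, b * c / c'), (X, c'), (Y, 0 - b * (- y) / c')]"
  have e: "eval ?v = eval [(X, a), (Y, b), (X, c)]"
    using slide_eval[OF XY c'_def, of a 0] c' pos by simp
  have "cost [(X, a), (Y, b), (X, c)] \<le> cost ?v"
    using pos c' y by (intro cheapD[OF cheap] e) (auto simp: prec_def)
  moreover have "cost ?v = a - y + b * c / c' + c' + b * y / c'"
    using pos c' y shear_pair_speed[OF XY] by simp
  ultimately have "b + c \<le> - y + b * c / c' + c' + b * y / c'"
    using pos shear_pair_speed[OF XY] by simp
  then have "(b + c) * c' \<le> (- y + c') * c' + b * c + b * y"
    using c' pos by (simp add: field_simps)
  moreover have "(- y + c') * c' + b * c + b * y - (b + c) * c' = b * c * y * (c' - b)"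
    unfolding c'_def by algebra
  moreover have "b * c * y * (c' - b) < 0"
    using pos y c' by (intro mult_pos_neg mult_pos_pos) auto
  ultimately show False by simp
qed

text \<open>If $b$ exceeds $a$ or $c$, sliding helps. Otherwise $b = 2u/(1-u^2)$ for some $u \le b$, both outer
letters have $X^u$ to spare, and $X^u Y^b X^u$ is a diagonal letter at a lower cost.\<close>

lemma staircase_not_cheap:
  assumes XY: "shear_pair X Y" and pos: "0 < a" "0 < b" "0 < c"
  shows "\<not> cheap [(X, a), (Y, b), (X, c)]"
proof
  assume cheap: "cheap [(X, a), (Y, b), (X, c)]"
  then have "cheap [(X, c), (Y, b), (X, a)]"
    using cheap_rev[of "[(X, a), (Y, b), (X, c)]"] by simp
  with cheap have bac: "b \<le> c" "b \<le> a"
    using staircase_not_cheap_aux[OF XY] pos by (meson not_le)+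
  define r where "r = sqrt (1 + b\<^sup>2)"
  \<comment> \<open>the positive root of $2u/(1 - u^2) = b$, that is $u = \tanh(\mathrm{arsinh}(b)/2)$\<close>
  define u where "u = b / (1 + r)"
  have r: "1 < r" "r\<^sup>2 = 1 + b\<^sup>2" using pos by (auto simp: r_def real_less_rsqrt)
  have u: "0 < u" "u < 1" "u \<le> b"
  proof -
    show "0 < u" "u \<le> b" using pos r by (auto simp: u_def divide_simps mult_le_cancel_left1)
    have "b < r" using pos by (auto simp: r_def intro: real_less_rsqrt)
    then show "u < 1" using r by (simp add: u_def divide_simps)
  qed
  have ub: "2 * u / (1 - u\<^sup>2) = b"
  proof -
    have "(1 + r) * u = b" using r by (simp add: u_def)
    moreover have "(2 * u - b * (1 - u\<^sup>2)) * (1 + r)\<^sup>2 =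
        2 * ((1 + r) * u) * (1 + r) - b * ((1 + r)\<^sup>2 - ((1 + r) * u)\<^sup>2)"
      by (simp add: algebra_simps power2_eq_square)
    ultimately have "(2 * u - b * (1 - u\<^sup>2)) * (1 + r)\<^sup>2 = 2 * b * (1 + r) - b * ((1 + r)\<^sup>2 - b\<^sup>2)"
      by simp
    also have "\<dots> = 0" using r(2) by algebra
    finally have "2 * u = b * (1 - u\<^sup>2)" using r(1) by simp
    moreover have "u\<^sup>2 < 1" using u by (simp add: abs_square_less_1)
    ultimately show ?thesis by (simp add: divide_simps)
  qed
  let ?v = "[(X, a - u), (LS, 2 * artanh u), (X, c - u)]"
  have "eval ?v = shear X (a - u) ** (eval [(X, u), (Y, b), (X, u)] ** shear X (c - u))"
    using tip_eval[OF XY u(1,2)] by (simp add: ub del: shear.simps)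
  also have "\<dots> = (shear X (a - u) ** shear X u) ** shear Y b ** (shear X u ** shear X (c - u))"
    by (simp add: matrix_mul_assoc del: shear.simps)
  also have "\<dots> = eval [(X, a), (Y, b), (X, c)]"
    by (simp add: shear_add matrix_mul_assoc)
  finally have e: "eval ?v = eval [(X, a), (Y, b), (X, c)]" .
  have ar: "0 < artanh u" "4 * artanh u < 2 * u + b"
    using artanh_bounds[OF u(1,2)] u by (auto simp: ub)
  have "cost [(X, a), (Y, b), (X, c)] \<le> cost ?v"
    using pos bac u ar by (intro cheapD[OF cheap] e) (auto simp: prec_def)
  then show False
    using pos bac u ar shear_pair_speed[OF XY] by simp
qed

text \<open>When the middle product of a window is $-2$, sliding leaves the cost unchanged. If $bc > 2$, split
$X^b$ so that the part next to the turn is $X^{2/c}$ and slide from $Y^0$: this inserts a positive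
$Y^y$ into the middle of $X^b$ at no cost and creates a staircase, which can then be improved.\<close>

lemma turn_product_le_2:
  assumes XY: "shear_pair X Y" and pos: "0 < b" "0 < c" "0 < d"
    and cheap: "cheap [(X, b), (Y, - c), (X, - d)]"
  shows "b * c \<le> 2"
proof (rule ccontr)
  assume "\<not> b * c \<le> 2"
  then have bc: "0 < b - 2 / c" using pos by (simp add: field_simps)
  have "((\<lambda>y. 2 * y / (c * (c - y))) \<longlongrightarrow> 0) (at_right 0)"
    using pos by (auto intro!: tendsto_eq_intros)
  then have "eventually (\<lambda>y. 2 * y / (c * (c - y)) < d) (at_right 0)"
    using pos by (simp add: order_tendstoD)
  moreover have "eventually (\<lambda>y. y < c) (at_right 0)"
    using pos by (simp add: order_tendstoD(2)[OF tendsto_ident_at])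
  ultimately have "eventually (\<lambda>y. 2 * y / (c * (c - y)) < d \<and> y < c) (at_right 0)"
    by (rule eventually_conj)
  then obtain y where y: "0 < y" "y < c" "2 * y / (c * (c - y)) < d"
    using ex_small by blast
  \<comment> \<open>the window $Y^0 X^{2/c} Y^{-c} X^{-d}$ after sliding by $y$\<close>
  let ?v = "[(X, b - 2 / c), (Y, y), (X, 2 / (c - y)), (Y, - (c - y)), (X, - (d - 2 * y / (c * (c - y))))]"
  have "eval ?v = shear X (b - 2 / c) ** eval [(Y, 0 + y), (X, (2 / c) * (- c) / (y - c)), (Y, y - c), (X, - d - (2 / c) * y / (y - c))]"
  proof -
    have "(2 / c) * (- c) / (y - c) = 2 / (c - y)" "- d - (2 / c) * y / (y - c) = - (d - 2 * y / (c * (c - y)))"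
      using pos y by (simp_all add: divide_simps) (simp_all add: algebra_simps)
    then show ?thesis by (simp only:) (simp del: shear.simps)
  qed
  also have "\<dots> = shear X (b - 2 / c) ** eval [(Y, 0), (X, 2 / c), (Y, - c), (X, - d)]"
    using pos y by (subst slide_eval[OF shear_pair_sym[OF XY]]) auto
  also have "\<dots> = (shear X (b - 2 / c) ** shear X (2 / c)) ** shear Y (- c) ** shear X (- d)"
    by (simp add: matrix_mul_assoc del: shear.simps)
  also have "\<dots> = eval [(X, b), (Y, - c), (X, - d)]"
    by (simp add: shear_add matrix_mul_assoc del: shear.simps)
  finally have e: "eval ?v = eval [(X, b), (Y, - c), (X, - d)]" .
  have "2 / (c - y) = 2 / c + 2 * y / (c * (c - y))"
    using y pos by (simp add: divide_simps)
  then have "cost ?v = cost [(X, b), (Y, - c), (X, - d)]"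
    using pos y bc shear_pair_speed[OF XY] by simp
  moreover have "?v \<preceq> [(X, b), (Y, - c), (X, - d)]"
    using pos y bc by (auto simp: prec_def)
  ultimately have "cheap ?v"
    using cheap_replace[OF cheap _ e] by simp
  then have "cheap [(X, b - 2 / c), (Y, y), (X, 2 / (c - y))]"
    using cheap_init[of "[(X, b - 2 / c), (Y, y), (X, 2 / (c - y))]"] by simp
  then show False
    using staircase_not_cheap[OF XY, of "b - 2 / c" y "2 / (c - y)"] y bc by simp
qed

text \<open>Stationarity forces $bc = c^2 + 2$, which is incompatible with \<open>turn_product_le_2\<close>.\<close>

lemma zigzag_then_straight_not_cheap:
  assumes XY: "shear_pair X Y" and pos: "0 < a" "0 < b" "0 < c" "0 < d"
  shows "\<not> cheap [(X, a), (Y, - b), (X, c), (Y, d)]"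
proof
  assume cheap: "cheap [(X, a), (Y, - b), (X, c), (Y, d)]"
  have "c * (1 - (1 - b * c)) - b * (- (1 - b * c) - 1) = 0"
    using window_stationary[OF XY cheap] pos by simp
  then have "b * (c\<^sup>2 + 2 - b * c) = 0" by algebra
  then have "b * c = c\<^sup>2 + 2" using pos by simp
  moreover have "b * c \<le> 2"
  proof (rule turn_product_le_2[OF shear_pair_sym[OF XY] pos(2-4)])
    show "cheap [(Y, b), (X, - c), (Y, - d)]"
      using cheap_tl[OF cheap] cheap_neg[of "[(Y, b), (X, - c), (Y, - d)]"] by simp
  qed
  ultimately show False using pos by simp
qed

text \<open>The product of the inner three letters has one off-diagonal entry $g$ and the diagonal entries
$1 + cd$ and $1 + bc$. If $g$ is kept, the outer letters can be adapted so that both diagonal entries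
of the whole product are kept; the fourth entry follows from the determinant.\<close>

lemma five_eval:
  assumes "shear_pair X Y" "g = b + d + b * c * d" "g = b' + d' + b' * c' * d'" "g \<noteq> 0"
    and "a' = a + (c * d - c' * d') / g" "e' = e + (b * c - b' * c') / g"
  shows "eval [(X, a'), (Y, b'), (X, c'), (Y, d'), (X, e')] = eval [(X, a), (Y, b), (X, c), (Y, d), (X, e)]"
proof -
  have a: "a' * g = a * g + c * d - c' * d'" and e: "e' * g = e * g + b * c - b' * c'"
    using assms(4) by (simp_all add: assms(5,6) field_simps)
  have 1: "1 + c' * d' + a' * g = 1 + c * d + a * g" "1 + b' * c' + e' * g = 1 + b * c + e * g"
    using a e by simp_all
  have "g * (c' + e' * (1 + c' * d') + a' * (1 + b' * c') + a' * e' * g)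
      = g * (c + e * (1 + c * d) + a * (1 + b * c) + a * e * g)"
    using a e assms(2,3) by algebra
  then have 2: "c' + e' * (1 + c' * d') + a' * (1 + b' * c') + a' * e' * g
      = c + e * (1 + c * d) + a * (1 + b * c) + a * e * g"
    using assms(4) by simp
  have 3: "eval [(X, a), (Y, b), (X, c), (Y, d), (X, e)] = (if X = LP then
      mk (1 + c * d + a * g) (c + e * (1 + c * d) + a * (1 + b * c) + a * e * g) g (1 + b * c + e * g)
      else mk (1 + b * c + e * g) g (c + e * (1 + c * d) + a * (1 + b * c) + a * e * g) (1 + c * d + a * g))"
    if "g = b + d + b * c * d" for a b c d e
    using assms(1) unfolding shear_pair_def by (auto simp: that mk_mult mat_1_mk algebra_simps)
  show ?thesis
    unfolding 3[OF assms(2)] 3[OF assms(3)] using 1 2 by simp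
qed

lemma zigzag_equal:
  assumes XY: "shear_pair X Y" and pos: "0 < a" "0 < b" "0 < c" "0 < d"
    and cheap: "cheap [(X, a), (Y, - b), (X, c), (Y, - d)]"
  shows "b = c"
proof -
  have "c * (1 - (1 - b * c)) - b * (- (1 - b * c) + 1) = 0"
    using window_stationary[OF XY cheap] pos by simp
  then have "b * c * (c - b) = 0" by algebra
  then show ?thesis using pos by simp
qed

lemma square_arc_equal:
  assumes XY: "shear_pair X Y" and pos: "0 < a" "0 < b" "0 < c" "0 < d"
    and cheap: "cheap [(X, a), (Y, - b), (X, - c), (Y, d)]"
  shows "b = c"
proof -
  have "- c * (1 + (1 + b * c)) - b * (- (1 + b * c) - 1) = 0"
    using window_stationary[OF XY cheap] pos by simp
  then have "(b - c) * (2 + b * c) = 0" by algebra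
  moreover have "2 + b * c \<noteq> 0" using mult_pos_pos[OF pos(2,3)] by simp
  ultimately show ?thesis by simp
qed

text \<open>Keep the corner entry $g = t^3$ and make the times next to the middle unequal, $t - h$ and $t + h$.
The change of cost is a positive multiple of $h^2(t^4 - 4)$.\<close>

lemma hook_not_cheap_equal:
  assumes XY: "shear_pair X Y" and pos: "0 < a" "0 < t" "0 < e" and t: "t\<^sup>2 < 2"
  shows "\<not> cheap [(X, a), (Y, t), (X, - t), (Y, - t), (X, e)]"
proof
  assume cheap: "cheap [(X, a), (Y, t), (X, - t), (Y, - t), (X, e)]"
  define c where "c h = (t ^ 3 + 2 * h) / (t\<^sup>2 - h\<^sup>2)" for h
  define a' where "a' h = a + ((- t) * (- t) - (- c h) * (- (t + h))) / t ^ 3" for h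
  define e' where "e' h = e + (t * (- t) - (t - h) * (- c h)) / t ^ 3" for h
  have t3: "t ^ 3 / t\<^sup>2 = t" using pos by (simp add: power2_eq_square power3_eq_cube)
  have c: "(c \<longlongrightarrow> t) (at_right 0)"
    unfolding c_def using pos by (auto intro!: tendsto_eq_intros simp: t3)
  have a': "(a' \<longlongrightarrow> a) (at_right 0)" and e': "(e' \<longlongrightarrow> e) (at_right 0)"
    unfolding a'_def e'_def using pos by (auto intro!: tendsto_eq_intros c simp: power2_eq_square)
  have "eventually (\<lambda>h. 0 < c h \<and> 0 < a' h \<and> 0 < e' h \<and> h < t) (at_right 0)"
    using pos by (intro eventually_conj order_tendstoD(1)[OF c] order_tendstoD(1)[OF a']
        order_tendstoD(1)[OF e'] order_tendstoD(2)[OF tendsto_ident_at])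
  then obtain h where h: "0 < h" "0 < c h" "0 < a' h" "0 < e' h" "h < t"
    using ex_small by blast
  have sq: "0 < t\<^sup>2 - h\<^sup>2" using h by (simp add: power_strict_mono)
  have ch: "c h * (t\<^sup>2 - h\<^sup>2) = t ^ 3 + 2 * h" using sq by (simp add: c_def)
  let ?v = "[(X, a' h), (Y, t - h), (X, - c h), (Y, - (t + h)), (X, e' h)]"
  have e: "eval ?v = eval [(X, a), (Y, t), (X, - t), (Y, - t), (X, e)]"
  proof (rule five_eval[OF XY, where g = "t ^ 3"])
    show "t ^ 3 = t + - t + t * - t * - t" by (simp add: power3_eq_cube)
    show "t ^ 3 = t - h + - (t + h) + (t - h) * - c h * - (t + h)"
      using ch by (simp add: algebra_simps power2_eq_square)
  qed (use pos in \<open>simp_all add: a'_def e'_def\<close>)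
  have "cost [(X, a), (Y, t), (X, - t), (Y, - t), (X, e)] \<le> cost ?v"
    using pos h by (intro cheapD[OF cheap] e prec_same_sgn) (simp_all add: sgn_if)
  then have "0 \<le> c h - t + (a' h - a) + (e' h - e)"
    using pos h shear_pair_speed[OF XY] by simp
  moreover have "(a' h - a) + (e' h - e) = - 2 * h * c h / t ^ 3"
    using pos by (simp add: a'_def e'_def divide_simps) (simp add: algebra_simps)
  ultimately have "0 \<le> c h - t - 2 * h * c h / t ^ 3" by linarith
  then have "0 \<le> (c h - t - 2 * h * c h / t ^ 3) * t ^ 3" using pos by simp
  also have "\<dots> = c h * t ^ 3 - t ^ 4 - 2 * h * c h"
    using pos by (simp add: algebra_simps power_numeral_reduce)
  finally have "0 \<le> (c h * t ^ 3 - t ^ 4 - 2 * h * c h) * (t\<^sup>2 - h\<^sup>2)" using sq by simp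
  also have "\<dots> = h\<^sup>2 * ((t\<^sup>2)\<^sup>2 - 4)" using ch by algebra
  finally have "4 \<le> (t\<^sup>2)\<^sup>2" using h by (simp add: zero_le_mult_iff)
  moreover have "(t\<^sup>2)\<^sup>2 < 2\<^sup>2" using t by (intro power_strict_mono) auto
  ultimately show False by simp
qed

text \<open>Stationarity of both windows gives $c = d$ and either $b = c$, which is the previous case by \<open>turn_product_le_2\<close>, or
$bc = 2$. In the latter case sliding the first window costs nothing but destroys the equation
$c = d$ for the second one.\<close>

lemma hook_not_cheap:
  assumes XY: "shear_pair X Y" and pos: "0 < a" "0 < b" "0 < c" "0 < d" "0 < e"
  shows "\<not> cheap [(X, a), (Y, b), (X, - c), (Y, - d), (X, e)]"
proof
  assume cheap: "cheap [(X, a), (Y, b), (X, - c), (Y, - d), (X, e)]"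
  have dc: "d = c"
    using square_arc_equal[OF shear_pair_sym[OF XY] pos(2-5)] cheap_tl[OF cheap] by simp
  have init: "cheap [(X, a), (Y, b), (X, - c), (Y, - d)]"
    using cheap cheap_init[of "[(X, a), (Y, b), (X, - c), (Y, - d)]"] by simp
  have bc2: "b * c \<le> 2"
    using turn_product_le_2[OF shear_pair_sym[OF XY] pos(2-4)] cheap_tl[OF init] by simp
  have "- c * (1 + (1 - b * c)) + b * ((1 - b * c) + 1) = 0"
    using window_stationary[OF XY init] pos by simp
  then have "(b - c) * (2 - b * c) = 0" by algebra
  then consider "b = c" "b * c < 2" | "b * c = 2" using bc2 by force
  then show False
  proof cases
    case 1
    then show False
      using hook_not_cheap_equal[OF XY pos(1,2) pos(5)] cheap dc by (simp add: power2_eq_square)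
  next
    case 2
    have "((\<lambda>y. b * y / (c - y)) \<longlongrightarrow> 0) (at_right 0)"
      using pos by (auto intro!: tendsto_eq_intros)
    then have "eventually (\<lambda>y. b * y / (c - y) < d \<and> y < c) (at_right 0)"
      using pos by (intro eventually_conj order_tendstoD(2) order_tendstoD(2)[OF tendsto_ident_at]) auto
    \<comment> \<open>only for $y = c - b$ would the new times satisfy the second equation again\<close>
    moreover have "eventually (\<lambda>y. y \<noteq> c - b) (at_right (0::real))"
    proof (cases "0 < c - b")
      case True
      show ?thesis
        by (rule eventually_mono[OF order_tendstoD(2)[OF tendsto_ident_at True]]) simp
    next
      case False
      then show ?thesis by (auto simp: eventually_at_filter)
    qed
    ultimately have "eventually (\<lambda>y. (b * y / (c - y) < d \<and> y < c) \<and> y \<noteq> c - b) (at_right 0)"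
      by (rule eventually_conj)
    then obtain y where y: "0 < y" "b * y / (c - y) < d" "y < c" "y \<noteq> c - b"
      using ex_small by blast
    let ?v = "[(X, a + y), (Y, b * (- c) / (y - c)), (X, y - c), (Y, - d - b * y / (y - c))]"
    have q: "b * (- c) / (y - c) = 2 / (c - y)" "- d - b * y / (y - c) = - (d - b * y / (c - y))"
    proof -
      have yc: "y - c = - (c - y)" by simp
      show "b * (- c) / (y - c) = 2 / (c - y)"
        unfolding yc by (simp only: mult_minus_right minus_divide_divide 2)
      show "- d - b * y / (y - c) = - (d - b * y / (c - y))"
        unfolding yc by (simp only: divide_minus_right diff_minus_eq_add minus_diff_eq)
          (simp add: minus_divide_right)
    qed
    have e: "eval (?v @ [(X, e)]) = eval ([(X, a), (Y, b), (X, - c), (Y, - d)] @ [(X, e)])"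
      unfolding eval_append using y 2 by (subst slide_eval[OF XY]) auto
    have "2 / (c - y) - b * y / (c - y) = b"
    proof -
      have "2 - b * y = b * (c - y)" using 2 by (simp add: algebra_simps)
      then show ?thesis using y by (simp add: diff_divide_distrib[symmetric])
    qed
    then have "cost (?v @ [(X, e)]) = cost [(X, a), (Y, b), (X, - c), (Y, - d), (X, e)]"
      unfolding q using pos y shear_pair_speed[OF XY] by simp
    moreover have "?v @ [(X, e)] \<preceq> [(X, a), (Y, b), (X, - c), (Y, - d), (X, e)]"
      unfolding q using pos y by (auto intro!: prec_same_sgn simp: sgn_if)
    ultimately have "cheap (?v @ [(X, e)])"
      using cheap_replace[OF cheap] e by simp
    then have "cheap [(Y, 2 / (c - y)), (X, - (c - y)), (Y, - (d - b * y / (c - y))), (X, e)]"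
      unfolding q using cheap_tl by fastforce
    then have "c - y = d - b * y / (c - y)"
      using square_arc_equal[OF shear_pair_sym[OF XY], of "2 / (c - y)" "c - y" "d - b * y / (c - y)" e] y pos by simp
    then have "y = b * y / (c - y)" using dc by simp
    then have "(c - y) * y = b * y" using y by (simp add: field_simps)
    then have "c - y = b" using y(1) by (simp del: left_diff_distrib)
    then show False using y(4) by simp
  qed
qed

text \<open>As for the hook, the corner entry $g = t^3 - 2t$ is kept and the times around the middle become
$t \mp h$. The cost changes by $(c_h - t)\,t^3/g$, where $c_h > t$ is the new middle time and
$g < 0$.\<close>

lemma short_zigzag_not_cheap:
  assumes XY: "shear_pair X Y" and pos: "0 < a" "0 < t" "0 < e" and t: "t\<^sup>2 < 2"
  shows "\<not> cheap [(X, a), (Y, - t), (X, t), (Y, - t), (X, e)]"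
proof
  assume cheap: "cheap [(X, a), (Y, - t), (X, t), (Y, - t), (X, e)]"
  define g where "g = t ^ 3 - 2 * t"
  have g: "g < 0" using t pos mult_strict_left_mono[OF t, of t] by (simp add: g_def power2_eq_square power3_eq_cube)
  define c where "c h = t ^ 3 / (t\<^sup>2 - h\<^sup>2)" for h
  define a' where "a' h = a + (t * (- t) - c h * (- (t + h))) / g" for h
  define e' where "e' h = e + ((- t) * t - (- (t - h)) * c h) / g" for h
  have t3: "t ^ 3 / t\<^sup>2 = t" using pos by (simp add: power2_eq_square power3_eq_cube)
  have c: "(c \<longlongrightarrow> t) (at_right 0)"
    unfolding c_def using pos by (auto intro!: tendsto_eq_intros simp: t3)
  have a': "(a' \<longlongrightarrow> a) (at_right 0)" and e': "(e' \<longlongrightarrow> e) (at_right 0)"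
    unfolding a'_def e'_def using pos g by (auto intro!: tendsto_eq_intros c simp: power2_eq_square)
  have "eventually (\<lambda>h. 0 < a' h \<and> 0 < e' h \<and> h < t) (at_right 0)"
    using pos by (intro eventually_conj order_tendstoD(1)[OF a']
        order_tendstoD(1)[OF e'] order_tendstoD(2)[OF tendsto_ident_at])
  then obtain h where h: "0 < h" "0 < a' h" "0 < e' h" "h < t"
    using ex_small by blast
  have sq: "0 < t\<^sup>2 - h\<^sup>2" using h by (simp add: power_strict_mono)
  have ch: "c h * (t\<^sup>2 - h\<^sup>2) = t ^ 3" using sq by (simp add: c_def)
  have "t * (t\<^sup>2 - h\<^sup>2) < t ^ 3" using h pos by (simp add: algebra_simps power2_eq_square power3_eq_cube)
  then have ct: "t < c h" using ch sq by (metis mult_less_cancel_right_pos)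
  let ?v = "[(X, a' h), (Y, - (t - h)), (X, c h), (Y, - (t + h)), (X, e' h)]"
  have e: "eval ?v = eval [(X, a), (Y, - t), (X, t), (Y, - t), (X, e)]"
  proof (rule five_eval[OF XY, where g = g])
    show "g = - t + - t + - t * t * - t" by (simp add: g_def power3_eq_cube)
    show "g = - (t - h) + - (t + h) + - (t - h) * c h * - (t + h)"
      using ch by (simp add: g_def algebra_simps power2_eq_square)
  qed (use g in \<open>simp_all add: a'_def e'_def\<close>)
  have "cost [(X, a), (Y, - t), (X, t), (Y, - t), (X, e)] \<le> cost ?v"
    using pos h ct by (intro cheapD[OF cheap] e prec_same_sgn) (simp_all add: sgn_if)
  then have "0 \<le> c h - t + (a' h - a) + (e' h - e)"
    using pos h ct shear_pair_speed[OF XY] by simp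
  also have "\<dots> = (c h - t) * (t ^ 3 / g)"
    using g by (simp add: a'_def e'_def divide_simps) (simp add: g_def algebra_simps)
  also have "\<dots> < 0" using ct g pos by (intro mult_pos_neg divide_pos_neg) auto
  finally show False by simp
qed

text \<open>For $t^2 \ge 2$ the middle part turns so far that the same matrix is reached by turning the other
way: $Y^{-t}X^tY^{-t} = X^{-2/t}\,Y^t\,X^{t-4/t}\,Y^t\,X^{-2/t}$. The outer letters absorb the two
negative ends.\<close>

lemma long_zigzag_not_cheap:
  assumes XY: "shear_pair X Y" and pos: "0 < t" and t: "2 \<le> t\<^sup>2"
  shows "\<not> cheap [(X, t), (Y, - t), (X, t), (Y, - t), (X, t)]"
proof
  assume cheap: "cheap [(X, t), (Y, - t), (X, t), (Y, - t), (X, t)]"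
  let ?v = "[(X, t - 2 / t), (Y, t), (X, t - 4 / t), (Y, t), (X, t - 2 / t)]"
  have e: "eval ?v = eval [(X, t), (Y, - t), (X, t), (Y, - t), (X, t)]"
    using XY pos unfolding shear_pair_def by (auto simp: mk_mult mat_1_mk field_simps)
  have t2: "0 \<le> t - 2 / t" "2 / t \<le> t" using pos t by (simp_all add: field_simps power2_eq_square)
  have "?v \<preceq> [(X, t), (Y, - t), (X, t), (Y, - t), (X, t)]"
    using pos t2 unfolding prec_def by auto
  then have "cost [(X, t), (Y, - t), (X, t), (Y, - t), (X, t)] \<le> cost ?v"
    by (intro cheapD[OF cheap] e)
  moreover have "\<bar>t - 4 / t\<bar> < t + 4 / t" using pos by (auto simp: abs_if)
  ultimately show False using t2 pos shear_pair_speed[OF XY] by simp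
qed

section \<open>Words that begin with a diagonal letter\<close>

lemma eventually_below: "0 < k \<Longrightarrow> eventually (\<lambda>u::real. u < k) (at_right 0)"
  by (rule order_tendstoD(2)[OF tendsto_ident_at])

lemma tip_loss:
  fixes u :: real assumes "0 < u" "u \<le> 1 / 2"
  shows "2 * u + 2 * u / (1 - u\<^sup>2) \<le> 4 * artanh u + 4 * u ^ 3"
proof -
  have sq: "u\<^sup>2 \<le> (1 / 2)\<^sup>2" using assms by (intro power_mono) auto
  have "0 \<le> 2 * u ^ 3 * (1 - 2 * u\<^sup>2)" using sq assms by (simp add: power2_eq_square)
  also have "\<dots> = (2 * u + 4 * u ^ 3) * (1 - u\<^sup>2) - 2 * u" by algebra
  finally have "2 * u / (1 - u\<^sup>2) \<le> 2 * u + 4 * u ^ 3"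
    using sq by (simp add: divide_simps power2_eq_square)
  then show ?thesis using artanh_bounds(1)[of u] assms by simp
qed

text \<open>Replacing a small end of a diagonal letter by three shears costs at most $4u^3$. So, up to an
error of third order, the letters after a diagonal letter may be treated as if they were preceded by
three small shears; every first or second order gain from sliding these shears is a contradiction.\<close>

lemma tip_cheap:
  assumes XY: "shear_pair X Y" and cheap: "cheap ((LS, s) # y)" and s: "0 < s"
  shows "eventually (\<lambda>u. \<forall>z. z \<preceq> (LS, 1) # y \<longrightarrow>
      eval z = eval ((X, u) # (Y, 2 * u / (1 - u\<^sup>2)) # (X, u) # y) \<longrightarrow>
      2 * u + 2 * u / (1 - u\<^sup>2) + cost y \<le> cost z + 4 * u ^ 3) (at_right 0)"
proof -
  have "((\<lambda>u::real. 2 * artanh u) \<longlongrightarrow> 0) (at_right 0)"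
    by (auto intro!: tendsto_eq_intros)
  then have "eventually (\<lambda>u. 2 * artanh u < s) (at_right 0)"
    using s by (simp add: order_tendstoD)
  moreover have "eventually (\<lambda>u::real. u < 1 / 2) (at_right 0)"
    by (rule eventually_below) simp
  moreover have "eventually (\<lambda>u::real. 0 < u) (at_right 0)"
    by (simp add: eventually_at_filter)
  ultimately show ?thesis
  proof eventually_elim
    case (elim u)
    define v where "v = 2 * u / (1 - u\<^sup>2)"
    have u1: "u < 1" using elim by simp
    have loss: "2 * u + v \<le> 4 * artanh u + 4 * u ^ 3"
      using tip_loss[of u] elim by (simp add: v_def)
    have ar: "0 < artanh u" using artanh_bounds(1)[OF _ u1] elim by simp
    show ?case unfolding v_def[symmetric]
    proof (intro allI impI)
      fix z assume z: "z \<preceq> (LS, 1) # y" and e: "eval z = eval ((X, u) # (Y, v) # (X, u) # y)"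
      have "eval ((X, u) # (Y, v) # (X, u) # y) = eval [(X, u), (Y, v), (X, u)] ** eval y"
        by (simp add: matrix_mul_assoc del: shear.simps)
      also have "\<dots> = shear LS (2 * artanh u) ** eval y"
        using tip_eval[OF XY _ u1] elim by (simp add: v_def del: shear.simps)
      finally have "eval ((LS, s - 2 * artanh u) # z) = eval ((LS, s) # y)"
        using e by (simp add: matrix_mul_assoc shear_add del: shear.simps)
      moreover have "(LS, s - 2 * artanh u) # z \<preceq> (LS, s) # y"
        using z s elim unfolding prec_def by (auto dest: spec[of _ True])
      ultimately have "cost ((LS, s) # y) \<le> cost ((LS, s - 2 * artanh u) # z)"
        by (intro cheapD[OF cheap])
      then show "2 * u + v + cost y \<le> cost z + 4 * u ^ 3"
        using s elim ar loss by simp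
    qed
  qed
qed

lemma eventually_tip_pos: "eventually (\<lambda>u::real. 0 < u \<and> u < 1 \<and> 2 * u \<le> 2 * u / (1 - u\<^sup>2)) (at_right 0)"
proof -
  have "eventually (\<lambda>u::real. u < 1) (at_right 0)"
    by (simp add: eventually_below)
  moreover have "eventually (\<lambda>u::real. 0 < u) (at_right 0)"
    by (simp add: eventually_at_filter)
  ultimately show ?thesis
  proof eventually_elim
    case (elim u)
    then have "0 < 1 - u\<^sup>2" by (simp add: abs_square_less_1)
    with elim show ?case by (simp add: divide_simps)
  qed
qed

text \<open>The last of the three small shears cancels against $X^{-t}$, a gain of $2u$.\<close>

lemma diagonal_bend_not_cheap:
  assumes XY: "shear_pair X Y" and pos: "0 < s" "0 < t"
  shows "\<not> cheap [(LS, s), (X, - t)]"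
proof
  assume "cheap [(LS, s), (X, - t)]"
  from tip_cheap[OF XY this pos(1)] eventually_tip_pos
  have "eventually (\<lambda>u. 2 * u \<le> 4 * u ^ 3 \<and> 0 < u \<and> u < 1 / 2 \<and> u < t) (at_right 0)"
    using eventually_below[OF pos(2)] eventually_below[of "1 / 2", simplified]
  proof (eventually_elim, goal_cases)
    case (1 u)
    define v where "v = 2 * u / (1 - u\<^sup>2)"
    let ?z = "[(X, u), (Y, v), (X, u - t)]"
    have "?z \<preceq> (LS, 1) # [(X, - t)]"
      using 1 by (auto simp: prec_def v_def)
    moreover have "eval ?z = eval ((X, u) # (Y, v) # (X, u) # [(X, - t)])"
      by (simp add: shear_add del: shear.simps)
    ultimately have "2 * u + v + cost [(X, - t)] \<le> cost ?z + 4 * u ^ 3"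
      using 1 unfolding v_def by blast
    moreover have "0 < v" using 1 unfolding v_def by linarith
    ultimately show ?case using 1 shear_pair_speed[OF XY] by simp
  qed
  then obtain u :: real where u: "0 < u" "2 * u \<le> 4 * u ^ 3" "u < 1 / 2" using ex_small by blast
  then have "u\<^sup>2 < (1 / 2)\<^sup>2" by (intro power_strict_mono) auto
  then have "u * u\<^sup>2 < u * (1 / 4)" using u(1) by (intro mult_strict_left_mono) (simp_all add: power2_eq_square)
  with u show False by (simp add: power2_eq_square power3_eq_cube)
qed

text \<open>Slide the window formed by the last two small shears and the letters $X^b Y^c$ by the fixed amount
$b/4$. The gain is of first order in $u$.\<close>

lemma diagonal_staircase_not_cheap:
  assumes XY: "shear_pair X Y" and pos: "0 < s" "0 < b" "0 < c"
  shows "\<not> cheap [(LS, s), (X, b), (Y, c)]"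
proof
  assume "cheap [(LS, s), (X, b), (Y, c)]"
  note tip = tip_cheap[OF shear_pair_sym[OF XY] this pos(1)]
  \<comment> \<open>any fixed amount below $b$ keeps the letters positive for small $u$\<close>
  define x where "x = b / 4"
  define b' where "b' u = b - (1 + u * b) * x" for u
  have b': "(b' \<longlongrightarrow> b - x) (at_right 0)"
    unfolding b'_def by (auto intro!: tendsto_eq_intros)
  have b'_pos: "eventually (\<lambda>u. 0 < b' u) (at_right 0)"
    using pos by (intro order_tendstoD(1)[OF b']) (simp add: x_def)
  have d': "((\<lambda>u. c - u * x / b' u) \<longlongrightarrow> c) (at_right 0)"
    using pos by (auto intro!: tendsto_eq_intros b' simp: x_def)
  have "eventually (\<lambda>u. - 4 * u\<^sup>2 \<le> b * x * (u / b' u - 1)) (at_right 0)"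
    using tip eventually_tip_pos b'_pos order_tendstoD(1)[OF d' pos(3)]
  proof (eventually_elim, goal_cases)
    case (1 u)
    define v where "v = 2 * u / (1 - u\<^sup>2)"
    let ?z = "[(Y, u), (X, v + x), (Y, u * b / b' u), (X, b' u), (Y, c - u * x / b' u)]"
    have "0 < x" using pos by (simp add: x_def)
    then have "?z \<preceq> (LS, 1) # [(X, b), (Y, c)]"
      using 1 pos by (auto simp: prec_def v_def)
    moreover have "eval ?z = shear Y u ** eval [(X, v + x), (Y, u * b / b' u), (X, b' u), (Y, c - u * x / b' u)]"
      by (simp del: shear.simps)
    then have "eval ?z = shear Y u ** eval [(X, v), (Y, u), (X, b), (Y, c)]"
      using 1 by (subst (asm) slide_eval[OF XY]) (auto simp: b'_def)
    then have "eval ?z = eval ((Y, u) # (X, v) # (Y, u) # [(X, b), (Y, c)])"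
      by (simp del: shear.simps)
    ultimately have "2 * u + v + cost [(X, b), (Y, c)] \<le> cost ?z + 4 * u ^ 3"
      using 1 unfolding v_def by blast
    then have "2 * u + v + b + c \<le> u + (v + x) + u * b / b' u + b' u + (c - u * x / b' u) + 4 * u ^ 3"
      using 1 pos \<open>0 < x\<close> shear_pair_speed[OF XY] by (simp add: v_def)
    moreover have "u * b / b' u = u + u * (1 + u * b) * x / b' u"
      using 1 by (simp add: b'_def field_simps)
    ultimately have "0 \<le> u * (b * x * (u / b' u - 1) + 4 * u\<^sup>2)"
      by (simp add: b'_def[of u] algebra_simps add_divide_distrib power2_eq_square power3_eq_cube)
    then show ?case using 1 by (simp add: zero_le_mult_iff)
  qed
  moreover have "((\<lambda>u. b * x * (u / b' u - 1)) \<longlongrightarrow> - (b * x)) (at_right 0)"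
    using pos by (auto intro!: tendsto_eq_intros b' simp: x_def)
  moreover have "((\<lambda>u::real. - 4 * u\<^sup>2) \<longlongrightarrow> 0) (at_right 0)"
    by (auto intro!: tendsto_eq_intros)
  ultimately have "0 \<le> - (b * x)"
    by (intro tendsto_le[of "at_right 0"]) auto
  moreover have "0 < b * x" using pos by (simp add: x_def)
  ultimately show False by simp
qed


text \<open>Slide the last two small shears together with the two shears by $x = \pm u$. The cost changes by
$\pm u^2(2/b - b)$ up to third order terms, hence $2/b = b$.\<close>

lemma diagonal_corner_length:
  assumes XY: "shear_pair X Y" and pos: "0 < s" "0 < b" "0 < c"
    and cheap: "cheap [(LS, s), (X, b), (Y, - c)]"
  shows "b\<^sup>2 = 2"
proof -
  note tip = tip_cheap[OF shear_pair_sym[OF XY] cheap pos(1)]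
  have *: "0 \<le> \<sigma> * (2 / b - b)" if \<sigma>: "\<sigma> \<in> {1, -1}" for \<sigma>
  proof -
    define b' where "b' u = b - (1 + u * b) * (\<sigma> * u)" for u
    have b': "(b' \<longlongrightarrow> b) (at_right 0)"
      unfolding b'_def by (auto intro!: tendsto_eq_intros)
    have b'_pos: "eventually (\<lambda>u. 0 < b' u) (at_right 0)"
      using pos by (intro order_tendstoD(1)[OF b'])
    have "((\<lambda>u. c + u * (\<sigma> * u) / b' u) \<longlongrightarrow> c) (at_right 0)"
      using pos by (auto intro!: tendsto_eq_intros b')
    note d'_pos = order_tendstoD(1)[OF this pos(3)]
    have "eventually (\<lambda>u. - 4 * u \<le> \<sigma> * ((2 + u * b) / b' u - b)) (at_right 0)"
      using tip eventually_tip_pos b'_pos d'_pos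
    proof (eventually_elim, goal_cases)
      case (1 u)
      define v where "v = 2 * u / (1 - u\<^sup>2)"
      let ?x = "\<sigma> * u"
      let ?z = "[(Y, u), (X, v + ?x), (Y, u * b / b' u), (X, b' u), (Y, - c - u * ?x / b' u)]"
      have v: "0 < v + ?x" using \<sigma> 1 by (auto simp: v_def)
      have d: "- c - u * ?x / b' u < 0" using 1 by simp
      have "?z \<preceq> (LS, 1) # [(X, b), (Y, - c)]"
        using 1 pos v d by (auto simp: prec_def)
      moreover have "eval ?z = shear Y u ** eval [(X, v + ?x), (Y, u * b / b' u), (X, b' u), (Y, - c - u * ?x / b' u)]"
        by (simp del: shear.simps)
      then have "eval ?z = shear Y u ** eval [(X, v), (Y, u), (X, b), (Y, - c)]"
        using 1 by (subst (asm) slide_eval[OF XY]) (auto simp: b'_def)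
      then have "eval ?z = eval ((Y, u) # (X, v) # (Y, u) # [(X, b), (Y, - c)])"
        by (simp del: shear.simps)
      ultimately have "2 * u + v + cost [(X, b), (Y, - c)] \<le> cost ?z + 4 * u ^ 3"
        using 1 unfolding v_def by blast
      moreover have "cost ?z = u + (v + ?x) + u * b / b' u + b' u + (c + u * ?x / b' u)"
        using 1 pos v d shear_pair_speed[OF XY] by simp
      ultimately have "2 * u + v + b + c \<le> u + (v + ?x) + u * b / b' u + b' u + (c + u * ?x / b' u) + 4 * u ^ 3"
        using pos shear_pair_speed[OF XY] by simp
      moreover have "u * b / b' u = u + u * (1 + u * b) * ?x / b' u"
        using 1 by (simp add: b'_def field_simps)
      then have "u * b / b' u = u + u * ?x / b' u + u * u * b * ?x / b' u"
        by (simp add: algebra_simps add_divide_distrib)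
      moreover have "b' u - b = - ?x - u * b * ?x" by (simp add: b'_def algebra_simps)
      ultimately have "0 \<le> 2 * (u * ?x / b' u) + u * u * b * ?x / b' u - u * b * ?x + 4 * u ^ 3"
        by argo
      also have "\<dots> = u\<^sup>2 * (\<sigma> * ((2 + u * b) / b' u - b) + 4 * u)"
        by (simp add: algebra_simps add_divide_distrib power2_eq_square power3_eq_cube)
      finally have "0 \<le> u\<^sup>2 * (\<sigma> * ((2 + u * b) / b' u - b) + 4 * u)" .
      then show ?case using 1 by (simp add: zero_le_mult_iff)
    qed
    moreover have "((\<lambda>u. \<sigma> * ((2 + u * b) / b' u - b)) \<longlongrightarrow> \<sigma> * (2 / b - b)) (at_right 0)"
      using pos by (auto intro!: tendsto_eq_intros b')
    moreover have "((\<lambda>u::real. - 4 * u) \<longlongrightarrow> 0) (at_right 0)"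
      by (auto intro!: tendsto_eq_intros)
    ultimately show ?thesis
      by (intro tendsto_le[of "at_right 0"]) auto
  qed
  have "2 / b = b" using *[of 1] *[of "-1"] by simp
  then show ?thesis using pos by (simp add: field_simps power2_eq_square)
qed

text \<open>This is \<open>window_stationary\<close> with the last small shear in the role of the first letter. Its time $u$
tends to $0$, but it can be changed by $\pm u/2$, a change of cost of first order in $u$.\<close>

lemma diagonal_window_stationary:
  assumes XY: "shear_pair X Y" and pos: "0 < s" "0 < b" and nz: "c \<noteq> 0" "d \<noteq> 0"
    and cheap: "cheap [(LS, s), (Y, b), (X, c), (Y, d)]"
  shows "c * (1 - sgn c * (1 + b * c)) + b * ((1 + b * c) - sgn d) = 0"
proof -
  note tip = tip_cheap[OF XY cheap pos(1)]
  define h where "h c' = 1 - sgn c * (1 + b * c) + b / c' * ((1 + b * c) - sgn d)" for c'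
  have *: "0 \<le> \<sigma> * h c" if \<sigma>: "\<sigma> \<in> {1 / 2, - 1 / 2}" for \<sigma>
  proof -
    define c' where "c' u = c - (1 + b * c) * (\<sigma> * u)" for u
    have c': "(c' \<longlongrightarrow> c) (at_right 0)"
      unfolding c'_def by (auto intro!: tendsto_eq_intros)
    have "((\<lambda>u. d - b * (\<sigma> * u) / c' u) \<longlongrightarrow> d) (at_right 0)"
      using nz by (auto intro!: tendsto_eq_intros c')
    note d' = eventually_sgn_eq[OF this nz(2)]
    have "eventually (\<lambda>u. - 4 * u\<^sup>2 \<le> \<sigma> * h (c' u)) (at_right 0)"
      using tip eventually_tip_pos eventually_sgn_eq[OF c' nz(1)] d'
    proof (eventually_elim, goal_cases)
      case (1 u)
      define v where "v = 2 * u / (1 - u\<^sup>2)"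
      let ?x = "\<sigma> * u"
      let ?z = "[(X, u), (Y, v), (X, u + ?x), (Y, b * c / c' u), (X, c' u), (Y, d - b * ?x / c' u)]"
      have u: "0 < u + ?x" "0 < v"
      proof -
        have "- 1 < \<sigma>" using \<sigma> by auto
        then have "0 < (1 + \<sigma>) * u" using 1 by simp
        then show "0 < u + ?x" by (simp add: algebra_simps)
        show "0 < v" using 1 unfolding v_def by linarith
      qed
      have c'0: "c' u \<noteq> 0" using 1 nz by (metis sgn_zero_iff)
      have "sgn (b * c / c' u) = sgn b"
        using 1 nz by (simp add: sgn_mult sgn_divide)
      note sgnb = this
      then have b'0: "0 < b * c / c' u" using pos by (metis sgn_1_pos sgn_pos)
      have z: "[(Y, b * c / c' u), (X, c' u), (Y, d - b * ?x / c' u)] \<preceq> [(Y, b), (X, c), (Y, d)]"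
        using 1 sgnb by (intro prec_same_sgn) simp
      have "?z \<preceq> (LS, 1) # [(Y, b), (X, c), (Y, d)]"
        using z u 1 unfolding prec_def by (auto dest: spec[of _ True])
      moreover have "eval ?z = shear X u ** (shear Y v ** eval [(X, u + ?x), (Y, b * c / c' u), (X, c' u), (Y, d - b * ?x / c' u)])"
        by (simp del: shear.simps)
      then have "eval ?z = shear X u ** (shear Y v ** eval [(X, u), (Y, b), (X, c), (Y, d)])"
        using c'0 by (subst (asm) slide_eval[OF XY]) (auto simp: c'_def)
      then have "eval ?z = eval ((X, u) # (Y, v) # (X, u) # [(Y, b), (X, c), (Y, d)])"
        by (simp del: shear.simps)
      ultimately have "2 * u + v + cost [(Y, b), (X, c), (Y, d)] \<le> cost ?z + 4 * u ^ 3"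
        using 1 unfolding v_def by blast
      moreover have "\<bar>c' u\<bar> = sgn c * c' u" "\<bar>d - b * ?x / c' u\<bar> = sgn d * (d - b * ?x / c' u)"
        using 1 by (metis abs_sgn_mult)+
      then have "cost ?z = u + v + (u + ?x) + b * c / c' u + sgn c * c' u + sgn d * (d - b * ?x / c' u)"
        using 1 u b'0 shear_pair_speed[OF XY] by (simp del: abs_divide abs_mult)
      ultimately have "0 \<le> ?x + (b * c / c' u - b) + sgn c * (c' u - c) - sgn d * (b * ?x / c' u) + 4 * u ^ 3"
        using 1 pos shear_pair_speed[OF XY] by (simp add: abs_sgn_mult[of c] abs_sgn_mult[of d] right_diff_distrib)
      moreover have "b * c / c' u - b = b * (1 + b * c) * ?x / c' u"
        using c'0 by (simp add: c'_def field_simps)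
      moreover have "c' u - c = - ((1 + b * c) * ?x)" by (simp add: c'_def)
      ultimately have "0 \<le> ?x + b * (1 + b * c) * ?x / c' u + sgn c * (- ((1 + b * c) * ?x))
          - sgn d * (b * ?x / c' u) + 4 * u ^ 3"
        by (simp only:)
      also have "\<dots> = u * (\<sigma> * h (c' u) + 4 * u\<^sup>2)"
        by (simp add: h_def algebra_simps add_divide_distrib diff_divide_distrib power2_eq_square power3_eq_cube)
      finally have "0 \<le> u * (\<sigma> * h (c' u) + 4 * u\<^sup>2)" .
      then show ?case using 1 by (simp add: zero_le_mult_iff)
    qed
    moreover have "((\<lambda>u. \<sigma> * h (c' u)) \<longlongrightarrow> \<sigma> * h c) (at_right 0)"
      unfolding h_def using nz by (intro tendsto_intros c')
    moreover have "((\<lambda>u::real. - 4 * u\<^sup>2) \<longlongrightarrow> 0) (at_right 0)"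
      by (auto intro!: tendsto_eq_intros)
    ultimately show ?thesis
      by (intro tendsto_le[of "at_right 0"]) auto
  qed
  have "h c = 0" using *[of "1 / 2"] *[of "- 1 / 2"] by simp
  then show ?thesis using nz by (simp add: h_def field_simps)
qed

text \<open>The equations for $b$ and $c$ give $bc = 2$. Then a positive $Y^y$ can be inserted behind the
diagonal letter at no cost, and a diagonal letter followed by a staircase can be improved.\<close>

lemma diagonal_turn_not_cheap:
  assumes XY: "shear_pair X Y" and pos: "0 < s" "0 < b" "0 < c" "0 < d"
  shows "\<not> cheap [(LS, s), (X, b), (Y, - c), (X, - d)]"
proof
  assume cheap: "cheap [(LS, s), (X, b), (Y, - c), (X, - d)]"
  have b2: "b\<^sup>2 = 2"
    using diagonal_corner_length[OF XY pos(1-3)] cheap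
      cheap_init[of "[(LS, s), (X, b), (Y, - c)]" "[(X, - d)]"] by simp
  have "- c * (1 + (1 - b * c)) + b * ((1 - b * c) + 1) = 0"
    using diagonal_window_stationary[OF shear_pair_sym[OF XY] pos(1,2) _ _ cheap] pos by simp
  then have "(b - c) * (2 - b * c) = 0" by algebra
  then have bc: "b * c = 2" using b2 by (auto simp: power2_eq_square)
  have "((\<lambda>y. b * y / (c - y)) \<longlongrightarrow> 0) (at_right 0)"
    using pos by (auto intro!: tendsto_eq_intros)
  then have "eventually (\<lambda>y. b * y / (c - y) < d \<and> y < c) (at_right 0)"
    using pos by (intro eventually_conj order_tendstoD(2) eventually_below) auto
  then obtain y where y: "0 < y" "b * y / (c - y) < d" "y < c"
    using ex_small by blast
  let ?v = "[(Y, 0 + y), (X, b * (- c) / (y - c)), (Y, y - c), (X, - d - b * y / (y - c))]"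
  have q: "b * (- c) / (y - c) = 2 / (c - y)" "- d - b * y / (y - c) = - (d - b * y / (c - y))"
  proof -
    have yc: "y - c = - (c - y)" by simp
    show "b * (- c) / (y - c) = 2 / (c - y)"
      unfolding yc by (simp only: mult_minus_right minus_divide_divide bc)
    show "- d - b * y / (y - c) = - (d - b * y / (c - y))"
      unfolding yc by (simp only: divide_minus_right diff_minus_eq_add minus_diff_eq)
        (simp add: minus_divide_right)
  qed
  have "eval ((LS, s) # ?v) = shear LS s ** eval [(Y, 0), (X, b), (Y, - c), (X, - d)]"
    using y bc by (subst slide_eval[OF shear_pair_sym[OF XY], symmetric, of "y - c" _ _ y]) (auto simp del: shear.simps)
  then have e: "eval ((LS, s) # ?v) = eval [(LS, s), (X, b), (Y, - c), (X, - d)]"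
    by (simp del: shear.simps(3))
  have "2 / (c - y) - b * y / (c - y) = b"
  proof -
    have "2 - b * y = b * (c - y)" using bc by (simp add: algebra_simps)
    then show ?thesis using y by (simp add: diff_divide_distrib[symmetric])
  qed
  then have "cost ((LS, s) # ?v) = cost [(LS, s), (X, b), (Y, - c), (X, - d)]"
    unfolding q using pos y shear_pair_speed[OF XY] by simp
  moreover have "(LS, s) # ?v \<preceq> [(LS, s), (X, b), (Y, - c), (X, - d)]"
    unfolding q using pos y by (auto simp: prec_def)
  ultimately have "cheap ((LS, s) # ?v)"
    using cheap_replace[OF cheap _ e] by simp
  then have "cheap [(LS, s), (Y, y), (X, 2 / (c - y))]"
    unfolding q using cheap_init[of "[(LS, s), (Y, y), (X, 2 / (c - y))]"] by simp
  then show False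
    using diagonal_staircase_not_cheap[OF shear_pair_sym[OF XY] pos(1) y(1), of "2 / (c - y)"] y by simp
qed

lemma diagonal_zigzag_lengths:
  assumes XY: "shear_pair X Y" and pos: "0 < s" "0 < b" "0 < c" "0 < d"
    and cheap: "cheap [(LS, s), (X, b), (Y, - c), (X, d)]"
  shows "b = sqrt 2" "c = 2 * sqrt 2"
proof -
  have b2: "b\<^sup>2 = 2"
    using diagonal_corner_length[OF XY pos(1-3)] cheap
      cheap_init[of "[(LS, s), (X, b), (Y, - c)]" "[(X, d)]"] by simp
  then show b: "b = sqrt 2" using pos by (simp add: real_sqrt_unique)
  have "- c * (1 + (1 - b * c)) + b * ((1 - b * c) - 1) = 0"
    using diagonal_window_stationary[OF shear_pair_sym[OF XY] pos(1,2) _ _ cheap] pos by simp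
  then have "c * (b * c - (b\<^sup>2 + 2)) = 0" by algebra
  then have "b * c = 4" using b2 pos by simp
  also have "\<dots> = b * (2 * b)" using b2 by (simp add: power2_eq_square)
  finally have "c = 2 * b" using pos by simp
  then show "c = 2 * sqrt 2" using b by simp
qed

section \<open>Moving diagonal letters\<close>

text \<open>The product $X^r Y^{-r}$ with $r^2 = 2$ exchanges the two eigenlines of $P + Q$.\<close>

lemma corner_swaps_diagonal:
  assumes XY: "shear_pair X Y" and r: "r * r = 2"
  shows "eval [(LS, s), (X, r), (Y, - r)] = eval [(X, r), (Y, - r), (LS, - s)]"
proof -
  have "r * (r * x) = 2 * x" for x using r by (simp add: mult.assoc[symmetric])
  then show ?thesis
    using XY r unfolding shear_pair_def by (auto simp: mk_mult mat_1_mk algebra_simps)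
qed

text \<open>Both products are equal to the symmetric matrix with diagonal $-3$ and off-diagonal entries $-2r$.\<close>

lemma double_corner_swap:
  assumes XY: "shear_pair X Y" and r: "r * r = 2"
  shows "eval [(X, r), (Y, - (2 * r)), (X, r)] = eval [(Y, r), (X, - (2 * r)), (Y, r)]"
proof -
  have "r * (r * x) = 2 * x" for x using r by (simp add: mult.assoc[symmetric])
  then show ?thesis
    using XY r unfolding shear_pair_def by (auto simp: mk_mult mat_1_mk algebra_simps)
qed

lemma sqrt2_sq: "sqrt 2 * sqrt 2 = (2::real)" "0 < sqrt (2::real)"
  by simp_all

lemma move_diagonal:
  assumes XY: "shear_pair X Y"
  shows "eval ([(LS, s), (X, sqrt 2), (Y, - (2 * sqrt 2))] @ w) =
    eval ([(X, sqrt 2), (Y, - sqrt 2), (LS, - s), (Y, - sqrt 2)] @ w)"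
proof -
  have "eval [(LS, s), (X, sqrt 2), (Y, - (2 * sqrt 2))] =
      eval [(LS, s), (X, sqrt 2), (Y, - sqrt 2)] ** shear Y (- sqrt 2)"
    by (simp add: matrix_mul_assoc[symmetric] shear_add del: shear.simps)
  also have "\<dots> = eval [(X, sqrt 2), (Y, - sqrt 2), (LS, - s), (Y, - sqrt 2)]"
    unfolding corner_swaps_diagonal[OF XY sqrt2_sq(1)]
    by (simp add: matrix_mul_assoc[symmetric] del: shear.simps)
  finally show ?thesis by (simp only: eval_append)
qed

text \<open>Moving the diagonal letter to the other side of the corner turns the tail into a case of
\<open>diagonal_turn_not_cheap\<close>.\<close>

lemma diagonal_tail_not_cheap_pos:
  assumes XY: "shear_pair X Y" and pos: "0 < s" "0 < b" "0 < c" "0 < d" "0 < e"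
  shows "\<not> cheap [(LS, s), (X, b), (Y, - c), (X, d), (Y, e)]"
proof
  assume cheap: "cheap [(LS, s), (X, b), (Y, - c), (X, d), (Y, e)]"
  have bc: "b = sqrt 2" "c = 2 * sqrt 2"
    using diagonal_zigzag_lengths[OF XY pos(1-4)] cheap
      cheap_init[of "[(LS, s), (X, b), (Y, - c), (X, d)]" "[(Y, e)]"] by simp_all
  let ?r = "sqrt 2"
  let ?v = "[(X, ?r), (Y, - ?r), (LS, - s), (Y, - ?r), (X, d), (Y, e)]"
  have "cheap ?v"
  proof (rule cheap_replace[OF cheap])
    show "?v \<preceq> [(LS, s), (X, b), (Y, - c), (X, d), (Y, e)]"
      using pos bc by (auto simp: prec_def)
    show "eval ?v = eval [(LS, s), (X, b), (Y, - c), (X, d), (Y, e)]"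
      using move_diagonal[OF XY, of s "[(X, d), (Y, e)]"] bc by simp
    show "cost ?v \<le> cost [(LS, s), (X, b), (Y, - c), (X, d), (Y, e)]"
      using pos bc shear_pair_speed[OF XY] by simp
  qed
  then have "cheap (neg [(LS, s), (Y, ?r), (X, - d), (Y, - e)])"
    by (auto dest!: cheap_tl)
  then show False
    using diagonal_turn_not_cheap[OF shear_pair_sym[OF XY] pos(1) sqrt2_sq(2) pos(4,5)] by (simp only: cheap_neg)
qed

text \<open>For $e < 0$ the moved diagonal letter forces $d = 2\sqrt 2$. Half of $X^d$ completes the factor
$X^r Y^{-2r} X^r$; exchanging the roles of $X$ and $Y$ in this factor makes the remaining half a
positive letter following $Y^r$, which is the case $e > 0$.\<close>

lemma diagonal_tail_not_cheap:
  assumes XY: "shear_pair X Y" and pos: "0 < s" "0 < b" "0 < c" "0 < d" and e: "e \<noteq> 0"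
  shows "\<not> cheap [(LS, s), (X, b), (Y, - c), (X, d), (Y, e)]"
proof
  assume cheap: "cheap [(LS, s), (X, b), (Y, - c), (X, d), (Y, e)]"
  have e: "0 < - e" using diagonal_tail_not_cheap_pos[OF XY pos] cheap e by (cases "0 < e") auto
  have bc: "b = sqrt 2" "c = 2 * sqrt 2"
    using diagonal_zigzag_lengths[OF XY pos(1-4)] cheap
      cheap_init[of "[(LS, s), (X, b), (Y, - c), (X, d)]" "[(Y, e)]"] by simp_all
  let ?r = "sqrt 2"
  let ?v = "[(X, ?r), (Y, - ?r), (LS, - s), (Y, - ?r), (X, d), (Y, e)]"
  have "cheap ?v"
  proof (rule cheap_replace[OF cheap])
    show "?v \<preceq> [(LS, s), (X, b), (Y, - c), (X, d), (Y, e)]"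
      using pos e bc by (auto simp: prec_def)
    show "eval ?v = eval [(LS, s), (X, b), (Y, - c), (X, d), (Y, e)]"
      using move_diagonal[OF XY, of s "[(X, d), (Y, e)]"] bc by simp
    show "cost ?v \<le> cost [(LS, s), (X, b), (Y, - c), (X, d), (Y, e)]"
      using pos bc shear_pair_speed[OF XY] by simp
  qed
  then have "cheap (neg [(LS, s), (Y, ?r), (X, - d), (Y, - e)])"
    by (auto dest!: cheap_tl)
  then have d: "d = 2 * ?r"
    using diagonal_zigzag_lengths(2)[OF shear_pair_sym[OF XY] pos(1) sqrt2_sq(2) pos(4) e] by (simp only: cheap_neg)
  \<comment> \<open>cut $X^d$ in two halves and exchange $X$ and $Y$ in the double corner\<close>
  let ?w = "[(LS, s), (Y, ?r), (X, - (2 * ?r)), (Y, ?r), (X, ?r), (Y, e)]"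
  have "cheap ?w"
  proof (rule cheap_replace[OF cheap])
    show "?w \<preceq> [(LS, s), (X, b), (Y, - c), (X, d), (Y, e)]"
      using pos e bc by (auto simp: prec_def)
    have "eval [(LS, s), (X, b), (Y, - c), (X, d), (Y, e)] =
        shear LS s ** (eval [(X, ?r), (Y, - (2 * ?r)), (X, ?r)] ** eval [(X, ?r), (Y, e)])"
      by (simp add: bc d matrix_mul_assoc[symmetric] del: shear.simps)
        (simp add: matrix_mul_assoc shear_add del: shear.simps)
    also have "\<dots> = eval ?w"
      unfolding double_corner_swap[OF XY sqrt2_sq(1)]
      by (simp add: matrix_mul_assoc[symmetric] del: shear.simps)
    finally show "eval ?w = eval [(LS, s), (X, b), (Y, - c), (X, d), (Y, e)]" ..
    show "cost ?w \<le> cost [(LS, s), (X, b), (Y, - c), (X, d), (Y, e)]"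
      using pos bc d shear_pair_speed[OF XY] by simp
  qed
  then have "cheap [(LS, s), (Y, ?r), (X, - (2 * ?r)), (Y, ?r), (X, ?r)]"
    using cheap_init[of "[(LS, s), (Y, ?r), (X, - (2 * ?r)), (Y, ?r), (X, ?r)]" "[(Y, e)]"] by simp
  then show False
    using diagonal_tail_not_cheap_pos[OF shear_pair_sym[OF XY] pos(1), of ?r "2 * ?r" ?r ?r] by simp
qed

text \<open>Move the diagonal letter to the right across one corner. If $Z = X$, the letters to its left,
read backwards, are then a tail that is too long; if $Z = Y$, they contain a forbidden turn.\<close>

lemma seven_letters_not_cheap:
  assumes XY: "shear_pair X Y" and ZW: "shear_pair Z W" and pos: "0 < s" "0 < u" "0 < v"
  shows "\<not> cheap [(Z, u), (W, - (2 * sqrt 2)), (Z, sqrt 2), (LS, s), (X, sqrt 2), (Y, - (2 * sqrt 2)), (X, v)]"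
    (is "\<not> cheap ?w")
proof
  assume cheap: "cheap ?w"
  let ?r = "sqrt 2"
  show False
  proof (cases "Z = X")
    case True
    then have W: "W = Y" using XY ZW by (auto simp: shear_pair_def)
    let ?v = "[(X, u), (Y, - (2 * ?r)), (X, 2 * ?r), (Y, - ?r), (LS, - s), (Y, - ?r), (X, v)]"
    have "cheap ?v"
    proof (rule cheap_replace[OF cheap])
      show "?v \<preceq> ?w" using pos by (auto simp: prec_def)
      have "eval ?w = eval [(X, u), (Y, - (2 * ?r)), (X, ?r)] ** eval ([(LS, s), (X, ?r), (Y, - (2 * ?r))] @ [(X, v)])"
        by (simp add: True W matrix_mul_assoc[symmetric] del: shear.simps)
      also have "\<dots> = eval ?v" unfolding move_diagonal[OF XY]
        by (simp add: matrix_mul_assoc[symmetric] del: shear.simps)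
          (simp add: matrix_mul_assoc shear_add del: shear.simps)
      finally show "eval ?v = eval ?w" ..
      show "cost ?v \<le> cost ?w" using pos shear_pair_speed[OF XY] by (simp add: True W)
    qed
    then have "cheap [(X, u), (Y, - (2 * ?r)), (X, 2 * ?r), (Y, - ?r), (LS, - s)]"
      using cheap_init[of "[(X, u), (Y, - (2 * ?r)), (X, 2 * ?r), (Y, - ?r), (LS, - s)]" "[(Y, - ?r), (X, v)]"] by simp
    then have "cheap (neg [(LS, s), (Y, ?r), (X, - (2 * ?r)), (Y, 2 * ?r), (X, - u)])"
      using cheap_rev[of "[(X, u), (Y, - (2 * ?r)), (X, 2 * ?r), (Y, - ?r), (LS, - s)]"] by simp
    then show False
      using diagonal_tail_not_cheap[OF shear_pair_sym[OF XY] pos(1), of ?r "2 * ?r" "2 * ?r" "- u"] pos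
      by (simp only: cheap_neg) simp
  next
    case False
    then have ZW: "Z = Y" "W = X" using XY ZW by (auto simp: shear_pair_def)
    let ?v = "[(Y, u), (X, - (2 * ?r))] @ [(Y, ?r), (X, ?r), (Y, - ?r), (LS, - s)] @ [(Y, - ?r), (X, v)]"
    have "cheap ?v"
    proof (rule cheap_replace[OF cheap])
      show "?v \<preceq> ?w" using pos by (auto simp: prec_def)
      have "eval ?w = eval [(Y, u), (X, - (2 * ?r)), (Y, ?r)] ** eval ([(LS, s), (X, ?r), (Y, - (2 * ?r))] @ [(X, v)])"
        by (simp add: ZW matrix_mul_assoc[symmetric] del: shear.simps)
      also have "\<dots> = eval ?v" unfolding move_diagonal[OF XY]
        by (simp add: matrix_mul_assoc[symmetric] del: shear.simps)
      finally show "eval ?v = eval ?w" ..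
      show "cost ?v \<le> cost ?w" using pos shear_pair_speed[OF XY] by (simp add: ZW)
    qed
    then have "cheap [(Y, ?r), (X, ?r), (Y, - ?r), (LS, - s)]"
      by (rule cheap_factor)
    then have "cheap (neg [(LS, s), (Y, ?r), (X, - ?r), (Y, - ?r)])"
      using cheap_rev[of "[(Y, ?r), (X, ?r), (Y, - ?r), (LS, - s)]"] by simp
    then show False
      using diagonal_turn_not_cheap[OF shear_pair_sym[OF XY] pos(1), of ?r ?r ?r] by (simp only: cheap_neg) simp
  qed
qed

section \<open>Words of constant sign\<close>

lemma tendsto_mmult:
  fixes f g :: "'a \<Rightarrow> real^2^2"
  assumes "(f \<longlongrightarrow> a) F" "(g \<longlongrightarrow> b) F"
  shows "((\<lambda>x. f x ** g x) \<longlongrightarrow> a ** b) F"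
  unfolding matrix_matrix_mult_def
  by (intro tendsto_vec_lambda tendsto_sum tendsto_mult tendsto_vec_nth assms)

lemma tendsto_mk:
  assumes "(a \<longlongrightarrow> a') F" "(b \<longlongrightarrow> b') F" "(c \<longlongrightarrow> c') F" "(d \<longlongrightarrow> d') F"
  shows "((\<lambda>x. mk (a x) (b x) (c x) (d x)) \<longlongrightarrow> mk a' b' c' d') F"
proof (intro vec_tendstoI)
  fix i j :: 2
  show "((\<lambda>x. mk (a x) (b x) (c x) (d x) $ i $ j) \<longlongrightarrow> mk a' b' c' d' $ i $ j) F"
    using assms exhaust_2[of i] exhaust_2[of j] by auto
qed

lemma tendsto_shear:
  assumes "(f \<longlongrightarrow> t) F"
  shows "((\<lambda>x. shear l (f x)) \<longlongrightarrow> shear l t) F"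
  by (cases l) (auto intro!: tendsto_mk tendsto_intros assms)

definition prepend :: "real \<Rightarrow> letter \<Rightarrow> ((real^2^2) \<times> real) set \<Rightarrow> ((real^2^2) \<times> real) set" where
  "prepend \<sigma> l R = {(shear l t ** g, speed l * \<bar>t\<bar> + c) | t g c. 0 \<le> \<sigma> * t \<and> (g, c) \<in> R}"

lemma prependI: "0 \<le> \<sigma> * t \<Longrightarrow> (g, c) \<in> R \<Longrightarrow> (shear l t ** g, speed l * \<bar>t\<bar> + c) \<in> prepend \<sigma> l R"
  by (auto simp: prepend_def)

lemma prependE:
  assumes "(g, c) \<in> prepend \<sigma> l R"
  obtains t g' c' where "g = shear l t ** g'" "c = speed l * \<bar>t\<bar> + c'" "0 \<le> \<sigma> * t" "(g', c') \<in> R"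
  using assms by (auto simp: prepend_def)

lemma shear_cancel: "shear l (- t) ** (shear l t ** g) = g"
  by (simp add: matrix_mul_assoc shear_add del: shear.simps)

text \<open>Costs are nonnegative, so along a convergent sequence the times of the added letter are bounded by
the total costs. A convergent subsequence of the times also determines the limit of the remaining
matrices, because letters are invertible.\<close>

lemma closed_prepend:
  assumes "closed R" and nonneg: "R \<subseteq> UNIV \<times> {0..}"
  shows "closed (prepend \<sigma> l R)"
  unfolding closed_sequential_limits
proof (intro allI impI, elim conjE)
  fix x :: "nat \<Rightarrow> (real^2^2) \<times> real" and y
  assume x: "\<forall>n. x n \<in> prepend \<sigma> l R" and lim: "x \<longlonglongrightarrow> y"
  have "\<exists>t. fst (x n) = shear l t ** (shear l (- t) ** fst (x n)) \<and> 0 \<le> \<sigma> * t \<and>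
     speed l * \<bar>t\<bar> \<le> snd (x n) \<and> (shear l (- t) ** fst (x n), snd (x n) - speed l * \<bar>t\<bar>) \<in> R" for n
  proof -
    have "(fst (x n), snd (x n)) \<in> prepend \<sigma> l R" using x by simp
    then obtain t g' c' where "fst (x n) = shear l t ** g'" "snd (x n) = speed l * \<bar>t\<bar> + c'"
        "0 \<le> \<sigma> * t" "(g', c') \<in> R"
      by (rule prependE)
    moreover have "0 \<le> c'" using \<open>(g', c') \<in> R\<close> nonneg by auto
    ultimately show ?thesis by (intro exI[of _ t]) (simp add: shear_cancel)
  qed
  then obtain t where t: "\<And>n. 0 \<le> \<sigma> * t n" "\<And>n. speed l * \<bar>t n\<bar> \<le> snd (x n)"
      "\<And>n. (shear l (- t n) ** fst (x n), snd (x n) - speed l * \<bar>t n\<bar>) \<in> R"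
    by metis
  have "bounded (range (\<lambda>n. snd (x n)))"
    using lim by (intro convergent_imp_bounded) (rule tendsto_snd)
  then obtain K where K: "\<And>n. norm (snd (x n)) \<le> K" unfolding bounded_iff by blast
  have "1 \<le> speed l" by (cases l) auto
  have "\<bar>t n\<bar> \<le> K" for n
  proof -
    have "\<bar>t n\<bar> \<le> speed l * \<bar>t n\<bar>" using \<open>1 \<le> speed l\<close> by (simp add: mult_le_cancel_right1)
    also have "\<dots> \<le> K" using t(2)[of n] K[of n] by simp
    finally show ?thesis .
  qed
  then have "bounded (range t)" unfolding bounded_iff by (intro exI[of _ K]) auto
  then obtain q r where r: "strict_mono (r :: nat \<Rightarrow> nat)" "(t \<circ> r) \<longlonglongrightarrow> q"
    using bounded_imp_convergent_subsequence by blast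
  have tr: "(\<lambda>n. t (r n)) \<longlonglongrightarrow> q" using r(2) by (simp add: o_def)
  have xr: "(\<lambda>n. x (r n)) \<longlonglongrightarrow> y" using LIMSEQ_subseq_LIMSEQ[OF lim r(1)] by (simp add: o_def)
  have "(\<lambda>n. (shear l (- t (r n)) ** fst (x (r n)), snd (x (r n)) - speed l * \<bar>t (r n)\<bar>)) \<longlonglongrightarrow>
      (shear l (- q) ** fst y, snd y - speed l * \<bar>q\<bar>)"
    by (intro tendsto_Pair tendsto_mmult tendsto_shear tendsto_intros tr xr)
  then have R: "(shear l (- q) ** fst y, snd y - speed l * \<bar>q\<bar>) \<in> R"
    by (rule closed_sequentially[OF \<open>closed R\<close>, rotated]) (rule t(3))
  have "0 \<le> \<sigma> * q"
    by (rule LIMSEQ_le_const[OF tendsto_mult_left[OF tr, of \<sigma>]]) (use t(1) in auto)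
  from prependI[OF this R, of l] show "y \<in> prepend \<sigma> l R"
    using shear_cancel[of l "- q" "fst y"] by simp
qed

lemma prepend_nonneg: "R \<subseteq> UNIV \<times> {0..} \<Longrightarrow> prepend \<sigma> l R \<subseteq> UNIV \<times> {0..}"
  by (force simp: prepend_def)

definition block :: "real \<Rightarrow> ((real^2^2) \<times> real) set \<Rightarrow> ((real^2^2) \<times> real) set" where
  "block \<sigma> R = (\<Union>X\<in>{LP, LQ}. \<Union>Y\<in>{LP, LQ}. prepend \<sigma> X (prepend \<sigma> LS (prepend \<sigma> Y R)))"

lemma closed_block: "closed R \<Longrightarrow> R \<subseteq> UNIV \<times> {0..} \<Longrightarrow> closed (block \<sigma> R)"
  unfolding block_def by (intro closed_UN finite.intros ballI closed_prepend prepend_nonneg)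

lemma block_nonneg: "R \<subseteq> UNIV \<times> {0..} \<Longrightarrow> block \<sigma> R \<subseteq> UNIV \<times> {0..}"
  unfolding block_def by (intro UN_least prepend_nonneg)

definition pos_block :: "real^2^2 \<Rightarrow> real \<Rightarrow> bool" where
  "pos_block m c \<longleftrightarrow> (\<exists>X Y a s b. X \<noteq> LS \<and> Y \<noteq> LS \<and> 0 \<le> a \<and> 0 \<le> s \<and> 0 \<le> b \<and>
     m = eval [(X, a), (LS, s), (Y, b)] \<and> a + 2 * s + b \<le> c)"

lemma pos_blockI: "X \<noteq> LS \<Longrightarrow> Y \<noteq> LS \<Longrightarrow> 0 \<le> a \<Longrightarrow> 0 \<le> s \<Longrightarrow> 0 \<le> b \<Longrightarrow>
    m = eval [(X, a), (LS, s), (Y, b)] \<Longrightarrow> a + 2 * s + b \<le> c \<Longrightarrow> pos_block m c"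
  unfolding pos_block_def by blast

lemma pos_block_mono: "pos_block m c \<Longrightarrow> c \<le> c' \<Longrightarrow> pos_block m c'"
  unfolding pos_block_def by (elim exE conjE, intro exI conjI) (assumption+, linarith)

lemma speed_shear: "X \<noteq> LS \<Longrightarrow> speed X = 1" by (cases X) auto

lemma pos_block_iff_block: "pos_block m c \<longleftrightarrow> (m, c) \<in> block 1 {(mat 1, c) | c. 0 \<le> c}"
proof
  assume "pos_block m c"
  then obtain X Y a s b where b: "X \<noteq> LS" "Y \<noteq> LS" "0 \<le> a" "0 \<le> s" "0 \<le> b"
     "m = eval [(X, a), (LS, s), (Y, b)]" "a + 2 * s + b \<le> c" unfolding pos_block_def by blast
  have "(mat 1, c - (a + 2 * s + b)) \<in> {(mat 1 :: real^2^2, c) | c. 0 \<le> c}" using b by simp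
  then have "(shear X a ** (shear LS s ** (shear Y b ** mat 1)), speed X * \<bar>a\<bar> + (speed LS * \<bar>s\<bar> + (speed Y * \<bar>b\<bar> + (c - (a + 2 * s + b)))))
      \<in> prepend 1 X (prepend 1 LS (prepend 1 Y {(mat 1, c) | c. 0 \<le> c}))"
    using b by (intro prependI) auto
  moreover have "speed X * \<bar>a\<bar> + (speed LS * \<bar>s\<bar> + (speed Y * \<bar>b\<bar> + (c - (a + 2 * s + b)))) = c"
    using b by (simp add: speed_shear)
  moreover have "X \<in> {LP, LQ}" "Y \<in> {LP, LQ}" using b(1,2) by (cases X; cases Y; auto)+
  ultimately show "(m, c) \<in> block 1 {(mat 1, c) | c. 0 \<le> c}"
    unfolding block_def b(6) by auto
next
  assume "(m, c) \<in> block 1 {(mat 1, c) | c. 0 \<le> c}"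
  then obtain X Y where XY: "X \<in> {LP, LQ}" "Y \<in> {LP, LQ}"
    and "(m, c) \<in> prepend 1 X (prepend 1 LS (prepend 1 Y {(mat 1, c) | c. 0 \<le> c}))"
    unfolding block_def by blast
  then obtain a s b c' where *: "m = shear X a ** (shear LS s ** (shear Y b ** mat 1))"
      "c = speed X * \<bar>a\<bar> + (speed LS * \<bar>s\<bar> + (speed Y * \<bar>b\<bar> + c'))" "0 \<le> a" "0 \<le> s" "0 \<le> b" "0 \<le> c'"
    by (elim prependE) auto
  show "pos_block m c"
    by (rule pos_blockI[of X Y a s b]) (use XY * in \<open>auto simp del: shear.simps\<close>)
qed

lemma closed_pos_block: "closed {(m, c). pos_block m c}"
proof -
  have "closed ({mat 1} \<times> {0..} :: ((real^2^2) \<times> real) set)"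
    by (intro closed_Times) auto
  moreover have "{mat 1} \<times> {0..} = {(mat 1 :: real^2^2, c :: real) | c. 0 \<le> c}" by auto
  ultimately have "closed (block 1 {(mat 1, c) | c. 0 \<le> c})"
    by (intro closed_block) auto
  moreover have "{(m, c). pos_block m c} = block 1 {(mat 1, c) | c. 0 \<le> c}"
    by (auto simp: pos_block_iff_block)
  ultimately show ?thesis by simp
qed

lemma continuity_induction:
  fixes P :: "real \<Rightarrow> bool"
  assumes "closed {t. 0 \<le> t \<and> P t}" "P 0"
    and local: "\<And>t. 0 \<le> t \<Longrightarrow> P t \<Longrightarrow> \<exists>e>0. \<forall>u. 0 \<le> u \<and> u \<le> e \<longrightarrow> P (t + u)"
    and "0 \<le> t"
  shows "P t"
proof (rule ccontr)
  assume nP: "\<not> P t"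
  define S where "S = {x. 0 \<le> x \<and> x \<le> t \<and> P x}"
  define m where "m = Sup S"
  have S: "0 \<in> S" using assms by (simp add: S_def)
  have bdd: "bdd_above S" unfolding S_def by (intro bdd_aboveI[of _ t]) auto
  have "closed S"
  proof -
    have "S = {t. 0 \<le> t \<and> P t} \<inter> {..t}" by (auto simp: S_def)
    then show ?thesis using assms(1) by auto
  qed
  then have m: "m \<in> S" unfolding m_def using S bdd by (intro closed_contains_Sup) auto
  obtain e where e: "0 < e" "\<And>u. 0 \<le> u \<Longrightarrow> u \<le> e \<Longrightarrow> P (m + u)"
    using local[of m] m by (auto simp: S_def)
  have "m < t" using m nP by (cases "m = t") (auto simp: S_def)
  then have "m + min e (t - m) \<in> S" using e m by (auto simp: S_def)
  then have "m + min e (t - m) \<le> m" unfolding m_def[symmetric] by (metis cSup_upper bdd m_def)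
  then show False using e \<open>m < t\<close> by simp
qed

text \<open>Multiplication of $X^a S^s Z^b$ by $Z^t$ keeps the two entries $\alpha$ and $\beta$ of the matrix and
gives the diagonal entry $D = \cosh s + t\beta$. As long as the new times stay nonnegative the product
is again of the form $X^{a'} S^{s'} Z^{b'}$, with $\cosh s' = D$. As a function of $s'$, the new cost
minus $t$ has the derivative $-\sinh s'\,(\beta - \sinh s')^2/(\beta \cosh^2 s') \le 0$.\<close>

lemma grow_opposite:
  assumes ZX: "shear_pair Z X" and pos: "0 < a" "0 \<le> s" "0 < b"
  shows "\<exists>e>0. \<forall>t. 0 \<le> t \<and> t \<le> e \<longrightarrow> pos_block (shear Z t ** eval [(X, a), (LS, s), (Z, b)]) (a + 2 * s + b + t)"
proof -
  define \<alpha> \<beta> \<gamma> where "\<alpha> = cosh s + a * sinh s + b * (sinh s + a * cosh s)"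
    and "\<beta> = sinh s + a * cosh s" and "\<gamma> = sinh s + b * cosh s"
  have sc: "0 \<le> sinh s" "0 < cosh s" "1 \<le> cosh s" using pos by (simp_all add: cosh_real_ge_1)
  have \<beta>: "0 < \<beta>" "sinh s < \<beta>" and \<gamma>: "sinh s < \<gamma>" and \<alpha>: "0 < \<alpha>"
  proof -
    have p: "0 < a * cosh s" "0 < b * cosh s" "0 \<le> a * sinh s" using pos sc by simp_all
    then show 1: "0 < \<beta>" "sinh s < \<beta>" "sinh s < \<gamma>" using sc unfolding \<beta>_def \<gamma>_def by linarith+
    have "0 < b * \<beta>" using 1(1) pos by simp
    then show "0 < \<alpha>" using p sc unfolding \<alpha>_def \<beta>_def[symmetric] by linarith
  qed
  have det: "\<alpha> * cosh s = 1 + \<beta> * \<gamma>"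
    using hyperbolic_pythagoras[of s] unfolding \<alpha>_def \<beta>_def \<gamma>_def by algebra
  define D where "D t = cosh s + t * \<beta>" for t
  define S where "S t = sqrt ((D t)\<^sup>2 - 1)" for t
  have S0: "S 0 = sinh s"
    using sc by (simp add: S_def D_def cosh_square_eq)
  have S_lim: "(S \<longlongrightarrow> S 0) (at_right 0)" unfolding S_def D_def by (auto intro!: tendsto_eq_intros)
  have "eventually (\<lambda>t. S t < \<beta> \<and> S t < \<gamma>) (at_right 0)"
    using \<beta> \<gamma> S0 by (intro eventually_conj order_tendstoD(2)[OF S_lim]) auto
  then obtain e where e: "0 < e" "\<And>t. 0 < t \<Longrightarrow> t < e \<Longrightarrow> S t < \<beta> \<and> S t < \<gamma>"
    unfolding eventually_at_right_field by blast
  have "pos_block (shear Z t ** eval [(X, a), (LS, s), (Z, b)]) (a + 2 * s + b + t)" if t: "0 \<le> t" "t < e" for t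
  proof -
    define s' where "s' = arcosh (D t)"
    have D: "1 \<le> D t" "cosh s \<le> D t" using sc t \<beta> by (simp_all add: D_def add_increasing2)
    have s': "cosh s' = D t" "sinh s' = S t" "0 \<le> s'"
      using D by (simp_all add: s'_def S_def sinh_arcosh_real)
    have ss': "s \<le> s'" using D(2) s' pos by (metis cosh_real_nonneg_le_iff)
    define \<gamma>' where "\<gamma>' = \<gamma> + t * \<alpha>"
    have le: "S t \<le> \<beta>" "S t \<le> \<gamma>'"
    proof -
      have "S t < \<beta> \<and> S t < \<gamma>" using e(2)[of t] t S0 \<beta> \<gamma> by (cases "t = 0") auto
      then show "S t \<le> \<beta>" "S t \<le> \<gamma>'" using t \<alpha> by (auto simp: \<gamma>'_def intro: add_increasing2)
    qed
    define a' b' where "a' = (\<beta> - S t) / D t" and "b' = (\<gamma>' - S t) / D t"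
    have ab': "0 \<le> a'" "0 \<le> b'" using le D by (simp_all add: a'_def b'_def)
    have a'D: "a' * D t = \<beta> - S t" and b'D: "b' * D t = \<gamma>' - S t" using D by (simp_all add: a'_def b'_def)
    have pyth: "(D t)\<^sup>2 = 1 + (S t)\<^sup>2" using hyperbolic_pythagoras[of s'] s' by simp
    have det': "\<alpha> * D t = 1 + \<beta> * \<gamma>'" using det by (simp add: D_def \<gamma>'_def algebra_simps)
    have "(D t + a' * S t + b' * \<beta>) * D t = \<alpha> * D t"
      using a'D b'D pyth det' by algebra
    then have al: "D t + a' * S t + b' * \<beta> = \<alpha>" using D by simp
    have "shear Z t ** eval [(X, a), (LS, s), (Z, b)] = eval [(X, a'), (LS, s'), (Z, b')]"
    proof -
      have G: "eval [(X, a), (LS, s), (Z, b)] =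
          (if Z = LQ then mk (cosh s + a * sinh s + b * (sinh s + a * cosh s)) (sinh s + a * cosh s) (sinh s + b * cosh s) (cosh s)
           else mk (cosh s) (sinh s + b * cosh s) (sinh s + a * cosh s) (cosh s + a * sinh s + b * (sinh s + a * cosh s)))" for a s b
        using ZX unfolding shear_pair_def by (auto simp: mk_mult mat_1_mk algebra_simps)
      have "S t + a' * D t = \<beta>" "S t + b' * D t = \<gamma>'" using a'D b'D by simp_all
      then have "eval [(X, a'), (LS, s'), (Z, b')] = (if Z = LQ then mk \<alpha> \<beta> \<gamma>' (D t) else mk (D t) \<gamma>' \<beta> \<alpha>)"
        unfolding G s' using al by simp
      moreover have "eval [(X, a), (LS, s), (Z, b)] = (if Z = LQ then mk \<alpha> \<beta> \<gamma> (cosh s) else mk (cosh s) \<gamma> \<beta> \<alpha>)"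
        unfolding G \<alpha>_def \<beta>_def \<gamma>_def by simp
      ultimately show ?thesis
        using ZX unfolding shear_pair_def \<gamma>'_def by (auto simp: mk_mult D_def simp del: eval_simps)
    qed
    moreover have "a' + 2 * s' + b' \<le> a + 2 * s + b + t"
    proof -
      define G where "G x = 2 * x + (\<beta> - 1 / \<beta>) / cosh x + \<alpha> / \<beta> - 2 * sinh x / cosh x - (cosh x - cosh s) / \<beta>" for x
      have "G s' \<le> G s"
      proof (rule DERIV_nonpos_imp_nonincreasing[OF ss'])
        fix x assume "s \<le> x" "x \<le> s'"
        then have x: "0 \<le> sinh x" "0 < cosh x" using pos by auto
        have "(G has_real_derivative 2 - (\<beta> - 1 / \<beta>) * sinh x / (cosh x)\<^sup>2
            - 2 * ((cosh x)\<^sup>2 - (sinh x)\<^sup>2) / (cosh x)\<^sup>2 - sinh x / \<beta>) (at x)"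
          unfolding G_def using x \<beta> by (auto intro!: derivative_eq_intros simp: power2_eq_square field_simps)
        also have "2 - (\<beta> - 1 / \<beta>) * sinh x / (cosh x)\<^sup>2 - 2 * ((cosh x)\<^sup>2 - (sinh x)\<^sup>2) / (cosh x)\<^sup>2 - sinh x / \<beta>
            = - (sinh x * (\<beta> - sinh x)\<^sup>2 / (\<beta> * (cosh x)\<^sup>2))"
        proof -
          have "(2 - (\<beta> - 1 / \<beta>) * sinh x / (cosh x)\<^sup>2 - 2 * ((cosh x)\<^sup>2 - (sinh x)\<^sup>2) / (cosh x)\<^sup>2 - sinh x / \<beta>) * (\<beta> * (cosh x)\<^sup>2)
            = 2 * \<beta> * (cosh x)\<^sup>2 - (\<beta>\<^sup>2 - 1) * sinh x - 2 * \<beta> * ((cosh x)\<^sup>2 - (sinh x)\<^sup>2) - sinh x * (cosh x)\<^sup>2"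
            using x \<beta> by (simp add: field_simps power2_eq_square)
          also have "\<dots> = - (sinh x * (\<beta> - sinh x)\<^sup>2)"
            using hyperbolic_pythagoras[of x] by algebra
          finally show ?thesis using x \<beta> by (simp add: field_simps)
        qed
        finally have "(G has_real_derivative - (sinh x * (\<beta> - sinh x)\<^sup>2 / (\<beta> * (cosh x)\<^sup>2))) (at x)" .
        moreover have "- (sinh x * (\<beta> - sinh x)\<^sup>2 / (\<beta> * (cosh x)\<^sup>2)) \<le> 0" using x \<beta> by simp
        ultimately show "\<exists>y. (G has_real_derivative y) (at x) \<and> y \<le> 0" by blast
      qed
      moreover have "G s' = a' + 2 * s' + b' - t"
      proof -
        have "\<gamma>' / D t = \<alpha> / \<beta> - 1 / \<beta> / D t" using det' \<beta> D by (simp add: divide_simps)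
        moreover have "(D t - cosh s) / \<beta> = t" using \<beta> by (simp add: D_def)
        ultimately show ?thesis
          unfolding G_def a'_def b'_def s'(1,2) by (simp add: diff_divide_distrib)
      qed
      moreover have "G s = a + 2 * s + b"
      proof -
        have "\<gamma> / cosh s = \<alpha> / \<beta> - 1 / \<beta> / cosh s" using det \<beta>(1) sc(2) by (simp add: field_simps)
        moreover have "a = (\<beta> - sinh s) / cosh s" "b = (\<gamma> - sinh s) / cosh s"
          using sc by (simp_all add: \<beta>_def \<gamma>_def)
        ultimately show ?thesis
          unfolding G_def by (simp add: diff_divide_distrib)
      qed
      ultimately show ?thesis by simp
    qed
    moreover have "X \<noteq> LS" "Z \<noteq> LS" using ZX by (auto simp: shear_pair_def)
    ultimately show ?thesis using ab' s'(3) by (intro pos_blockI[of X Z a' s' b']) auto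
  qed
  then show ?thesis using e(1) by (intro exI[of _ "e / 2"]) auto
qed

text \<open>The same argument for $X^a S^s X^b$, where $s'$ is determined by the off-diagonal entry,
$\sinh s' = \sinh s + t\alpha$, and the derivative is
$-\cosh s'\,(\alpha - \cosh s')^2/(\alpha \sinh^2 s') \le 0$.\<close>

lemma grow_same:
  assumes ZX: "shear_pair Z X" and pos: "0 < a" "0 < s" "0 \<le> b"
  shows "\<exists>e>0. \<forall>t. 0 \<le> t \<and> t \<le> e \<longrightarrow> pos_block (shear Z t ** eval [(X, a), (LS, s), (X, b)]) (a + 2 * s + b + t)"
proof -
  define \<alpha> \<beta> \<delta> where "\<alpha> = cosh s + a * sinh s"
    and "\<beta> = sinh s + a * cosh s + b * \<alpha>" and "\<delta> = cosh s + b * sinh s"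
  have sc: "0 < sinh s" "0 < cosh s" "1 \<le> cosh s" using pos by (simp_all add: cosh_real_ge_1)
  have \<alpha>: "0 < \<alpha>" "cosh s < \<alpha>"
    using pos sc by (auto simp: \<alpha>_def intro!: add_pos_pos)
  have det: "\<alpha> * \<delta> = 1 + \<beta> * sinh s"
    using hyperbolic_pythagoras[of s] unfolding \<alpha>_def \<beta>_def \<delta>_def by algebra
  define S where "S t = sinh s + t * \<alpha>" for t
  define s' where "s' t = arsinh (S t)" for t
  have s'0: "s' 0 = s" by (simp add: s'_def S_def arsinh_sinh_real)
  have lim: "(s' \<longlongrightarrow> s) (at_right 0)" using s'0 unfolding s'_def S_def by (auto intro!: tendsto_eq_intros)
  have lims: "((\<lambda>t. cosh (s' t)) \<longlongrightarrow> cosh s) (at_right 0)" "((\<lambda>t. sinh ((s' t - s) / 2)) \<longlongrightarrow> 0) (at_right 0)"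
    by (auto intro!: tendsto_eq_intros lim)
  have "eventually (\<lambda>t. cosh (s' t) < \<alpha> \<and> sinh ((s' t - s) / 2) < a) (at_right 0)"
    using \<alpha> pos by (intro eventually_conj order_tendstoD(2)[OF lims(1)] order_tendstoD(2)[OF lims(2)])
  then obtain e where e: "0 < e" "\<And>t. 0 < t \<Longrightarrow> t < e \<Longrightarrow> cosh (s' t) < \<alpha> \<and> sinh ((s' t - s) / 2) < a"
    unfolding eventually_at_right_field by blast
  have "pos_block (shear Z t ** eval [(X, a), (LS, s), (X, b)]) (a + 2 * s + b + t)" if t: "0 \<le> t" "t < e" for t
  proof -
    define C where "C = cosh (s' t)"
    have S: "sinh (s' t) = S t" "sinh s \<le> S t" "0 < S t" using t \<alpha> sc by (auto simp: s'_def S_def add_pos_nonneg)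
    have ss': "s \<le> s' t" using S by (metis sinh_real_le_iff)
    have le: "C \<le> \<alpha>" "sinh ((s' t - s) / 2) \<le> a"
      using e(2)[of t] t s'0 \<alpha> pos unfolding C_def by (cases "t = 0"; force)+
    define \<delta>' where "\<delta>' = \<delta> + t * \<beta>"
    have det': "\<alpha> * \<delta>' = 1 + \<beta> * S t" using det by (simp add: S_def \<delta>'_def algebra_simps)
    have "C \<le> \<delta>'"
    proof -
      define h where "h = (s' t - s) / 2"
      have h: "0 \<le> h" "sinh h \<le> a" using ss' le by (simp_all add: h_def)
      have "s' t = s + 2 * h" by (simp add: h_def field_simps)
      then have CS: "C = cosh s * cosh (2 * h) + sinh s * sinh (2 * h)" "S t = sinh s * cosh (2 * h) + cosh s * sinh (2 * h)"
        using S(1) by (simp_all add: C_def cosh_add sinh_add)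
      \<comment> \<open>with $b = 0$ in the formula for $\beta$, which is the least favourable case\<close>
      have "1 + (sinh s + a * cosh s) * S t - \<alpha> * C = 1 - cosh (2 * h) + a * sinh (2 * h)"
        unfolding CS \<alpha>_def using hyperbolic_pythagoras[of s] by algebra
      also have "\<dots> = 2 * sinh h * (a * cosh h - sinh h)"
        using hyperbolic_pythagoras[of h] unfolding cosh_double sinh_double by algebra
      also have "\<dots> \<ge> 0"
      proof -
        have "sinh h \<le> a * 1" using h by simp
        also have "\<dots> \<le> a * cosh h" using pos by (intro mult_left_mono cosh_real_ge_1) auto
        finally show ?thesis using h by simp
      qed
      finally have "\<alpha> * C \<le> 1 + (sinh s + a * cosh s) * S t" by simp
      also have "\<dots> \<le> \<alpha> * \<delta>'" unfolding det' \<beta>_def using pos \<alpha> S by (simp add: mult_right_mono)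
      finally show ?thesis using \<alpha> by simp
    qed
    define a' b' where "a' = (\<alpha> - C) / S t" and "b' = (\<delta>' - C) / S t"
    have ab': "0 \<le> a'" "0 \<le> b'" using le \<open>C \<le> \<delta>'\<close> S by (simp_all add: a'_def b'_def)
    have a'S: "a' * S t = \<alpha> - C" and b'S: "b' * S t = \<delta>' - C" using S by (simp_all add: a'_def b'_def)
    have pyth: "C\<^sup>2 = 1 + (S t)\<^sup>2" using hyperbolic_pythagoras[of "s' t"] S by (simp add: C_def)
    have "(S t + a' * C + b' * \<alpha>) * S t = \<beta> * S t"
      using a'S b'S pyth det' by algebra
    then have be: "S t + a' * C + b' * \<alpha> = \<beta>" using S by simp
    have "shear Z t ** eval [(X, a), (LS, s), (X, b)] = eval [(X, a'), (LS, s' t), (X, b')]"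
    proof -
      have G: "eval [(X, a), (LS, s), (X, b)] =
          (if Z = LQ then mk (cosh s + a * sinh s) (sinh s + a * cosh s + b * (cosh s + a * sinh s)) (sinh s) (cosh s + b * sinh s)
           else mk (cosh s + b * sinh s) (sinh s) (sinh s + a * cosh s + b * (cosh s + a * sinh s)) (cosh s + a * sinh s))" for a s b
        using ZX unfolding shear_pair_def by (auto simp: mk_mult mat_1_mk algebra_simps)
      have "C + a' * S t = \<alpha>" "C + b' * S t = \<delta>'" using a'S b'S by simp_all
      then have "eval [(X, a'), (LS, s' t), (X, b')] = (if Z = LQ then mk \<alpha> \<beta> (S t) \<delta>' else mk \<delta>' (S t) \<beta> \<alpha>)"
        unfolding G S(1) C_def[symmetric] using be by simp
      moreover have "eval [(X, a), (LS, s), (X, b)] = (if Z = LQ then mk \<alpha> \<beta> (sinh s) \<delta> else mk \<delta> (sinh s) \<beta> \<alpha>)"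
        unfolding G \<alpha>_def \<beta>_def \<delta>_def by simp
      ultimately show ?thesis
        using ZX unfolding shear_pair_def \<delta>'_def by (auto simp: mk_mult S_def simp del: eval_simps)
    qed
    moreover have "a' + 2 * s' t + b' \<le> a + 2 * s + b + t"
    proof -
      define G where "G x = 2 * x + (\<alpha> + 1 / \<alpha>) / sinh x + \<beta> / \<alpha> - 2 * cosh x / sinh x - (sinh x - sinh s) / \<alpha>" for x
      have "G (s' t) \<le> G s"
      proof (rule DERIV_nonpos_imp_nonincreasing[OF ss'])
        fix x assume "s \<le> x" "x \<le> s' t"
        then have x: "0 < sinh x" "0 < cosh x" using pos by auto
        have "(G has_real_derivative 2 - (\<alpha> + 1 / \<alpha>) * cosh x / (sinh x)\<^sup>2
            + 2 * ((cosh x)\<^sup>2 - (sinh x)\<^sup>2) / (sinh x)\<^sup>2 - cosh x / \<alpha>) (at x)"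
          unfolding G_def using x \<alpha> by (auto intro!: derivative_eq_intros simp: power2_eq_square field_simps)
        also have "2 - (\<alpha> + 1 / \<alpha>) * cosh x / (sinh x)\<^sup>2 + 2 * ((cosh x)\<^sup>2 - (sinh x)\<^sup>2) / (sinh x)\<^sup>2 - cosh x / \<alpha>
            = - (cosh x * (\<alpha> - cosh x)\<^sup>2 / (\<alpha> * (sinh x)\<^sup>2))"
        proof -
          have "(2 - (\<alpha> + 1 / \<alpha>) * cosh x / (sinh x)\<^sup>2 + 2 * ((cosh x)\<^sup>2 - (sinh x)\<^sup>2) / (sinh x)\<^sup>2 - cosh x / \<alpha>) * (\<alpha> * (sinh x)\<^sup>2)
            = 2 * \<alpha> * (sinh x)\<^sup>2 - (\<alpha>\<^sup>2 + 1) * cosh x + 2 * \<alpha> * ((cosh x)\<^sup>2 - (sinh x)\<^sup>2) - cosh x * (sinh x)\<^sup>2"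
            using x \<alpha> by (simp add: field_simps power2_eq_square)
          also have "\<dots> = - (cosh x * (\<alpha> - cosh x)\<^sup>2)"
            using hyperbolic_pythagoras[of x] by algebra
          finally show ?thesis using x \<alpha> by (simp add: field_simps)
        qed
        finally have "(G has_real_derivative - (cosh x * (\<alpha> - cosh x)\<^sup>2 / (\<alpha> * (sinh x)\<^sup>2))) (at x)" .
        moreover have "- (cosh x * (\<alpha> - cosh x)\<^sup>2 / (\<alpha> * (sinh x)\<^sup>2)) \<le> 0" using x \<alpha> by simp
        ultimately show "\<exists>y. (G has_real_derivative y) (at x) \<and> y \<le> 0" by blast
      qed
      moreover have "G (s' t) = a' + 2 * s' t + b' - t"
      proof -
        have "\<delta>' / S t = \<beta> / \<alpha> + 1 / \<alpha> / S t" using det' \<alpha> S by (simp add: divide_simps) (simp add: algebra_simps)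
        moreover have "(S t - sinh s) / \<alpha> = t" using \<alpha> by (simp add: S_def)
        ultimately show ?thesis
          unfolding G_def a'_def b'_def S(1) C_def[symmetric] by (simp add: diff_divide_distrib add_divide_distrib)
      qed
      moreover have "G s = a + 2 * s + b"
      proof -
        have "\<delta> / sinh s = \<beta> / \<alpha> + 1 / \<alpha> / sinh s" using det \<alpha>(1) sc(1) by (simp add: field_simps)
        moreover have "a = (\<alpha> - cosh s) / sinh s" "b = (\<delta> - cosh s) / sinh s"
          using sc by (simp_all add: \<alpha>_def \<delta>_def)
        ultimately show ?thesis
          unfolding G_def by (simp add: diff_divide_distrib add_divide_distrib)
      qed
      ultimately show ?thesis by simp
    qed
    moreover have "X \<noteq> LS" using ZX by (auto simp: shear_pair_def)
    ultimately show ?thesis using ab' ss' pos by (intro pos_blockI[of X X a' "s' t" b']) auto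
  qed
  then show ?thesis using e(1) by (intro exI[of _ "e / 2"]) auto
qed


lemma shear_pair_cases: "X \<noteq> LS \<Longrightarrow> Y \<noteq> LS \<Longrightarrow> X = Y \<or> shear_pair X Y"
  by (cases X; cases Y) (auto simp: shear_pair_def)

text \<open>A block can be written with first letter $Z$, or one of the two preceding lemmas applies: a block with
$s = 0$ and two equal shears is a single shear.\<close>

lemma pos_block_grow:
  assumes "pos_block m c" "Z \<noteq> LS"
  shows "\<exists>e>0. \<forall>t. 0 \<le> t \<and> t \<le> e \<longrightarrow> pos_block (shear Z t ** m) (c + t)"
proof -
  have trivial: ?thesis if "Y \<noteq> LS" "0 \<le> a" "0 \<le> s" "0 \<le> b" "m = eval [(Z, a), (LS, s), (Y, b)]" "a + 2 * s + b \<le> c" for a s b Y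
  proof (intro exI[of _ 1] conjI allI impI)
    fix t :: real assume "0 \<le> t \<and> t \<le> 1"
    then show "pos_block (shear Z t ** m) (c + t)"
      using that \<open>Z \<noteq> LS\<close>
      by (intro pos_blockI[of Z Y "t + a" s b]) (auto simp: matrix_mul_assoc shear_add simp del: shear.simps)
  qed simp
  obtain X Y a s b where b: "X \<noteq> LS" "Y \<noteq> LS" "0 \<le> a" "0 \<le> s" "0 \<le> b"
     "m = eval [(X, a), (LS, s), (Y, b)]" "a + 2 * s + b \<le> c" using assms unfolding pos_block_def by blast
  have grown: ?thesis if "\<exists>e>0. \<forall>t. 0 \<le> t \<and> t \<le> e \<longrightarrow> pos_block (shear Z t ** m) (a + 2 * s + b + t)"
  proof -
    have "pos_block m' (c + t)" if "pos_block m' (a + 2 * s + b + t)" for m' t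
      using that b(7) by (intro pos_block_mono[OF that]) simp
    with that show ?thesis by meson
  qed
  show ?thesis
  proof (cases "X = Z \<or> a = 0")
    case True
    then have "m = eval [(Z, a), (LS, s), (Y, b)]" using b(6) by (auto simp del: shear.simps)
    then show ?thesis using trivial b by blast
  next
    case False
    then have ZX: "shear_pair Z X" and a: "0 < a" using shear_pair_cases[of Z X] b assms by auto
    show ?thesis
    proof (cases "Y = X \<or> b = 0")
      case True
      then have m: "m = eval [(X, a), (LS, s), (X, b)]" using b(6) by (auto simp del: shear.simps)
      show ?thesis
      proof (cases "s = 0")
        case True
        have "m = eval [(Z, 0), (LS, 0), (X, a + b)]"
          using m True by (simp add: shear_add matrix_mul_assoc del: shear.simps)
        then show ?thesis using trivial[of X 0 0 "a + b"] b a True by simp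
      next
        case False
        then have "0 < s" using b by simp
        then show ?thesis using grow_same[OF ZX a _ b(5), of s] m by (intro grown) simp
      qed
    next
      case False
      then have Y: "Y = Z" "0 < b" using b ZX by (cases Y; auto simp: shear_pair_def)+
      then show ?thesis using grow_opposite[OF ZX a b(4), of b] b(6) by (intro grown) simp
    qed
  qed
qed

lemma pos_block_shear:
  assumes "pos_block m c" "Z \<noteq> LS" "0 \<le> t"
  shows "pos_block (shear Z t ** m) (c + t)"
proof (rule continuity_induction[where P = "\<lambda>t. pos_block (shear Z t ** m) (c + t)"])
  show "closed {t. 0 \<le> t \<and> pos_block (shear Z t ** m) (c + t)}"
    unfolding closed_sequential_limits
  proof (intro allI impI, elim conjE)
    fix x :: "nat \<Rightarrow> real" and y
    assume x: "\<forall>n. x n \<in> {t. 0 \<le> t \<and> pos_block (shear Z t ** m) (c + t)}" and lim: "x \<longlonglongrightarrow> y"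
    have "(\<lambda>n. (shear Z (x n) ** m, c + x n)) \<longlonglongrightarrow> (shear Z y ** m, c + y)"
      by (intro tendsto_Pair tendsto_mmult tendsto_shear tendsto_intros lim)
    then have "(shear Z y ** m, c + y) \<in> {(m, c). pos_block m c}"
      by (rule closed_sequentially[OF closed_pos_block, rotated]) (use x in auto)
    moreover have "0 \<le> y" using lim x by (intro LIMSEQ_le_const) auto
    ultimately show "y \<in> {t. 0 \<le> t \<and> pos_block (shear Z t ** m) (c + t)}" by simp
  qed
  show "pos_block (shear Z 0 ** m) (c + 0)" using assms by simp
next
  fix t assume "0 \<le> t" "pos_block (shear Z t ** m) (c + t)"
  from pos_block_grow[OF this(2) assms(2)]
  obtain e where "e > 0" "\<And>u. 0 \<le> u \<Longrightarrow> u \<le> e \<Longrightarrow> pos_block (shear Z u ** (shear Z t ** m)) (c + t + u)" by auto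
  then show "\<exists>e>0. \<forall>u. 0 \<le> u \<and> u \<le> e \<longrightarrow> pos_block (shear Z (t + u) ** m) (c + (t + u))"
    by (intro exI[of _ e]) (simp add: matrix_mul_assoc shear_add add.commute add.left_commute add.assoc del: shear.simps)
qed fact

text \<open>Cut $S^t$ into $n$ equal pieces and replace each by three shears. The excess is $n \cdot O(n^{-3})$.\<close>

lemma diagonal_by_shears:
  assumes "0 \<le> t" "0 < e"
  shows "\<exists>v. (\<forall>(l, x)\<in>set v. l \<noteq> LS \<and> 0 \<le> x) \<and> eval v = shear LS t \<and> cost v \<le> 2 * t + e"
proof (cases "t = 0")
  case True
  then show ?thesis using assms by (intro exI[of _ "[]"]) (simp add: mat_1_mk)
next
  case False
  then have t: "0 < t" using assms by simp
  \<comment> \<open>the first summand makes the pieces small enough for \<open>tip_loss\<close>, the second bounds the total excess\<close>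
  obtain n :: nat where n: "t + t ^ 3 / e < n" using reals_Archimedean2 by blast
  have n1: "0 < real n" "t < n" "t ^ 3 / e < n"
    using n t assms by (smt (verit) divide_pos_pos zero_less_power)+
  define x where "x = t / (2 * n)"
  define u where "u = tanh x"
  have x: "0 < x" "x < 1 / 2" "2 * x * n = t" using t n1 by (simp_all add: x_def field_simps)
  have u: "0 < u" "u < 1" "artanh u = x" using x by (simp_all add: u_def tanh_real_lt_1 artanh_tanh_real)
  have ux: "u \<le> x" using artanh_bounds(1)[OF u(1,2)] u by simp
  define w where "w = [(LP, u), (LQ, 2 * u / (1 - u\<^sup>2)), (LP, u)]"
  have sq: "u\<^sup>2 < 1" using u by (simp add: abs_square_less_1)
  have ew: "eval w = shear LS (2 * x)"
    unfolding w_def using tip_eval[of LP LQ u] u by (simp add: shear_pair_def del: eval_simps shear.simps)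
  have cw: "cost w \<le> 4 * x + 4 * x ^ 3"
  proof -
    have "cost w = 2 * u + 2 * u / (1 - u\<^sup>2)" using u sq by (simp add: w_def)
    also have "\<dots> \<le> 4 * x + 4 * u ^ 3" using tip_loss[of u] u ux x by simp
    also have "\<dots> \<le> 4 * x + 4 * x ^ 3" using ux u by (simp add: power_mono)
    finally show ?thesis .
  qed
  have rep: "eval (concat (replicate k w)) = shear LS (k * (2 * x)) \<and> cost (concat (replicate k w)) = k * cost w" for k
  proof (induction k)
    case 0
    show ?case by (simp del: shear.simps)
  next
    case (Suc k)
    then show ?case by (simp add: ew shear_add algebra_simps del: shear.simps)
  qed
  have "n * cost w \<le> n * (4 * x + 4 * x ^ 3)" using cw n1 by simp
  also have "\<dots> = 2 * t + t ^ 3 / (2 * n * n)" unfolding x_def using n1 by (simp add: field_simps power3_eq_cube)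
  also have "t ^ 3 / (2 * n * n) \<le> e"
  proof -
    have "t ^ 3 < n * e" using n1(3) assms by (simp add: field_simps)
    also have "\<dots> \<le> (2 * n * n) * e"
    proof -
      have "1 \<le> real n" using n1(1) by simp
      then have "real n * 1 \<le> real n * (2 * n)" by (intro mult_left_mono) auto
      then show ?thesis using assms by (intro mult_right_mono) auto
    qed
    finally show ?thesis using n1 by (simp add: field_simps)
  qed
  finally have "cost (concat (replicate n w)) \<le> 2 * t + e" using rep by simp
  moreover have "eval (concat (replicate n w)) = shear LS t" using rep[of n] x by (simp add: mult.commute)
  moreover have "\<forall>(l, x)\<in>set (concat (replicate n w)). l \<noteq> LS \<and> 0 \<le> x"
    using u sq by (auto simp: w_def)
  ultimately show ?thesis by blast
qed

lemma pos_block_word: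
  assumes "\<forall>(l, x)\<in>set v. l \<noteq> LS \<and> 0 \<le> x" "pos_block m c"
  shows "pos_block (eval v ** m) (c + cost v)"
  using assms(1)
proof (induction v)
  case Nil
  then show ?case using assms by simp
next
  case (Cons a v)
  obtain l x where a: "a = (l, x)" by fastforce
  then have "pos_block (shear l x ** (eval v ** m)) ((c + cost v) + x)"
    using Cons by (intro pos_block_shear) auto
  then show ?case using Cons.prems a by (simp add: matrix_mul_assoc speed_shear add.commute add.left_commute)
qed

text \<open>A diagonal letter is a product of shears of almost the same cost, so the claim for shears and
closedness of the set of blocks give it for diagonal letters as well.\<close>

lemma pos_block_letter:
  assumes "pos_block m c" "0 \<le> t"
  shows "pos_block (shear l t ** m) (c + speed l * t)"
proof (cases "l = LS")
  case False
  then show ?thesis using pos_block_shear[OF assms(1) False assms(2)] by (simp add: speed_shear)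
next
  case True
  have B: "pos_block (shear LS t ** m) (c + (2 * t + 1 / Suc n))" for n
  proof -
    obtain v where v: "\<forall>(l, x)\<in>set v. l \<noteq> LS \<and> 0 \<le> x" "eval v = shear LS t" "cost v \<le> 2 * t + 1 / Suc n"
      using diagonal_by_shears[OF assms(2), of "1 / Suc n"] by auto
    then have "pos_block (shear LS t ** m) (c + cost v)" using pos_block_word[OF v(1) assms(1)] by simp
    then show ?thesis by (rule pos_block_mono) (use v(3) in simp)
  qed
  have L: "(\<lambda>n. (shear LS t ** m, c + (2 * t + 1 / Suc n))) \<longlonglongrightarrow> (shear LS t ** m, c + (2 * t + 0))"
    by (intro tendsto_Pair tendsto_add tendsto_const LIMSEQ_Suc[OF lim_1_over_n])
  have "(shear LS t ** m, c + (2 * t + 0)) \<in> {(m, c). pos_block m c}"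
    by (rule closed_sequentially[OF closed_pos_block _ L]) (use B in blast)
  then show ?thesis using True by (simp del: shear.simps)
qed

lemma nonneg_word_to_block:
  assumes "\<forall>(l, x)\<in>set w. 0 \<le> x"
  shows "\<exists>X Y a s b. X \<noteq> LS \<and> Y \<noteq> LS \<and> 0 \<le> a \<and> 0 \<le> s \<and> 0 \<le> b \<and>
     eval [(X, a), (LS, s), (Y, b)] = eval w \<and> a + 2 * s + b \<le> cost w"
proof -
  have "pos_block (eval w) (cost w)" using assms
  proof (induction w)
    case Nil
    then show ?case by (intro pos_blockI[of LP LP 0 0 0]) (simp_all del: shear.simps)
  next
    case (Cons a w)
    then show ?case using pos_block_letter[of "eval w" "cost w"] by (cases a) (auto simp: add.commute)
  qed
  then obtain X Y a s b where "X \<noteq> LS" "Y \<noteq> LS" "0 \<le> a" "0 \<le> s" "0 \<le> b"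
     "eval w = eval [(X, a), (LS, s), (Y, b)]" "a + 2 * s + b \<le> cost w" unfolding pos_block_def by blast
  then show ?thesis
    by (intro exI[of _ X] exI[of _ Y] exI[of _ a] exI[of _ s] exI[of _ b]) simp
qed

section \<open>Tight words have at most six letters\<close>

text \<open>The weights 3 and 4 make progress of two kinds of rewriting at once: removing a letter, and
replacing one of two diagonal letters by a shear.\<close>

definition weight :: "word \<Rightarrow> nat" where
  "weight w = (\<Sum>(l, t) \<leftarrow> w. if l = LS then 4 else 3)"

lemma weight_simps [simp]: "weight [] = 0" "weight ((l, t) # w) = (if l = LS then 4 else 3) + weight w"
  "weight (u @ v) = weight u + weight v"
  by (simp_all add: weight_def)

lemma weight_rev [simp]: "weight (rev w) = weight w"
  by (induction w) auto

lemma weight_neg [simp]: "weight (neg w) = weight w"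
  by (induction w) auto

text \<open>Cheap words are not unique: some rewritings leave the cost unchanged. Tight words are the lightest
ones among them.\<close>

definition tight :: "word \<Rightarrow> bool" where
  "tight w \<longleftrightarrow> cheap w \<and> (\<forall>v. v \<preceq> w \<longrightarrow> eval v = eval w \<longrightarrow> cost v \<le> cost w \<longrightarrow> weight w \<le> weight v)"

lemma tight_cheap: "tight w \<Longrightarrow> cheap w"
  by (simp add: tight_def)

lemma tightD: "tight w \<Longrightarrow> v \<preceq> w \<Longrightarrow> eval v = eval w \<Longrightarrow> cost v \<le> cost w \<Longrightarrow> weight w \<le> weight v"
  by (simp add: tight_def)

lemma tight_factor:
  assumes "tight (x @ u @ y)"
  shows "tight u"
  unfolding tight_def
proof (intro conjI allI impI)
  show "cheap u" using assms cheap_factor tight_cheap by blast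
  fix v assume "v \<preceq> u" "eval v = eval u" "cost v \<le> cost u"
  then have "weight (x @ u @ y) \<le> weight (x @ v @ y)"
    by (intro tightD[OF assms]) (auto intro!: prec_append)
  then show "weight u \<le> weight v" by simp
qed

lemma tight_tl: "tight (a # w) \<Longrightarrow> tight w"
  using tight_factor[of "[a]" w "[]"] by simp

lemma tight_init: "tight (u @ v) \<Longrightarrow> tight u"
  using tight_factor[of "[]" u v] by simp

lemma tight_neg: "tight (neg w) \<longleftrightarrow> tight w"
proof -
  have "tight w \<Longrightarrow> tight (neg w)" for w
    unfolding tight_def by (metis cheap_neg cost_neg eval_neg_eq neg_simps(4) prec_neg weight_neg)
  then show ?thesis by (metis neg_simps(4))
qed

lemma tight_rev: "tight (rev w) \<longleftrightarrow> tight w"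
proof -
  have "tight w \<Longrightarrow> tight (rev w)" for w
    unfolding tight_def by (metis cheap_rev cost_rev eval_rev_eq rev_rev_ident prec_rev weight_rev)
  then show ?thesis by (metis rev_rev_ident)
qed

lemma tight_nonzero: "tight [(l, t)] \<Longrightarrow> t \<noteq> 0"
proof
  assume tight: "tight [(l, t)]" and t: "t = 0"
  have "weight [(l, t)] \<le> weight []"
    by (rule tightD[OF tight]) (use t in \<open>simp_all add: prec_def del: shear.simps\<close>)
  then show False by (simp split: if_splits)
qed

lemma tight_adjacent: 
  assumes "tight [(l, s), (m, t)]" shows "l \<noteq> m"
proof
  assume "l = m"
  have "weight [(l, s), (m, t)] \<le> weight [(l, s + t)]"
  proof (rule tightD[OF assms])
    show "[(l, s + t)] \<preceq> [(l, s), (m, t)]" by (auto simp: prec_def)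
    show "eval [(l, s + t)] = eval [(l, s), (m, t)]"
      using \<open>l = m\<close> by (simp add: shear_add matrix_mul_assoc del: shear.simps)
    show "cost [(l, s + t)] \<le> cost [(l, s), (m, t)]"
      using \<open>l = m\<close> by (simp add: distrib_left[symmetric])
  qed
  then show False using \<open>l = m\<close> by (simp split: if_splits)
qed

lemma tight_diagonal_neighbour:
  assumes "tight [(LS, s), (X, t)]" shows "0 < s * t"
proof -
  have nz: "s \<noteq> 0" "t \<noteq> 0"
    using tight_nonzero assms tight_tl[OF assms] tight_init[of "[(LS, s)]" "[(X, t)]"] by auto
  have "X \<noteq> LS" using tight_adjacent[OF assms] by blast
  then have XY: "shear_pair X (if X = LP then LQ else LP)" by (cases X) (auto simp: shear_pair_def)
  show ?thesis
  proof (rule ccontr)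
    assume "\<not> 0 < s * t"
    then consider "0 < s" "0 < - t" | "0 < - s" "0 < t"
      using nz by (auto simp: zero_less_mult_iff not_less le_less)
    then show False
    proof cases
      case 1
      then show False using diagonal_bend_not_cheap[OF XY 1] tight_cheap[OF assms] by simp
    next
      case 2
      then show False using diagonal_bend_not_cheap[OF XY 2] tight_cheap[OF assms]
          cheap_neg[of "[(LS, s), (X, t)]"] by simp
    qed
  qed
qed

text \<open>Two diagonal letters around a shear are excluded by weight, since a word of positive letters also has
the form $X^a S^s Y^b$; the remaining cases are staircases.\<close>

lemma tight_straight_pos:
  assumes tight: "tight [(k, a), (l, b), (m, c)]" and pos: "0 < a" "0 < b" "0 < c"
  shows "l = LS"
proof (rule ccontr)
  assume l: "l \<noteq> LS"
  have kl: "k \<noteq> l" using tight_init[of "[(k, a), (l, b)]" "[(m, c)]"] tight tight_adjacent by simp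
  have lm: "l \<noteq> m" using tight_tl[OF tight] tight_adjacent by simp
  have cheap: "cheap [(k, a), (l, b), (m, c)]" using tight tight_cheap by blast
  consider "k = LS" "m = LS" | "k = LS" "m \<noteq> LS" | "k \<noteq> LS" "m = LS" | "k \<noteq> LS" "m \<noteq> LS" by blast
  then show False
  proof cases
    case 1
    obtain X Y a' s' b' where v: "X \<noteq> LS" "Y \<noteq> LS" "0 \<le> a'" "0 \<le> s'" "0 \<le> b'"
        "eval [(X, a'), (LS, s'), (Y, b')] = eval [(k, a), (l, b), (m, c)]"
        "a' + 2 * s' + b' \<le> cost [(k, a), (l, b), (m, c)]"
      using nonneg_word_to_block[of "[(k, a), (l, b), (m, c)]"] pos by auto
    have "weight [(k, a), (l, b), (m, c)] \<le> weight [(X, a'), (LS, s'), (Y, b')]"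
      using v(1-5,7) pos by (intro tightD[OF tight _ v(6)]) (auto simp: prec_def speed_shear)
    then show False using 1 v(1,2) l by simp
  next
    case 2
    then have "shear_pair l m" using shear_pair_cases[of l m] l lm by blast
    then show False using diagonal_staircase_not_cheap[OF _ pos] cheap 2 by blast
  next
    case 3
    then have "shear_pair l k" using shear_pair_cases[of l k] l kl by blast
    then show False using diagonal_staircase_not_cheap[OF _ pos(3,2,1)] cheap 3
        cheap_rev[of "[(k, a), (l, b), (m, c)]"] by simp
  next
    case 4
    then have "shear_pair k l" "m = k" using shear_pair_cases[of k l] shear_pair_cases[of l m] l kl lm by (auto simp: shear_pair_def)
    then show False using staircase_not_cheap[OF _ pos] cheap by blast
  qed
qed

text \<open>The two letters after the diagonal one have opposite signs, because a third letter of the same sign would give a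
staircase. A second diagonal letter in the fourth place could be merged with the first one by moving
that across the corner.\<close>

lemma diagonal_right_three:
  assumes tight: "tight [(LS, s), (A, a), (B, b), (C, c)]" and s: "0 < s"
  shows "shear_pair A B \<and> C = A \<and> a = sqrt 2 \<and> b = - (2 * sqrt 2) \<and> 0 < c"
proof -
  have t2: "tight [(LS, s), (A, a)]" and t3: "tight [(LS, s), (A, a), (B, b)]"
    using tight tight_init[of "[(LS, s), (A, a)]"] tight_init[of "[(LS, s), (A, a), (B, b)]"] by simp_all
  have tAB: "tight [(A, a), (B, b)]" and tBC: "tight [(B, b), (C, c)]"
    and tABC: "tight [(A, a), (B, b), (C, c)]"
    using tight_tl[OF t3] tight_tl[OF tight] tight_tl[OF tight_tl[OF tight]] by simp_all
  have a: "0 < a" using tight_diagonal_neighbour[OF t2] s by (simp add: zero_less_mult_iff)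
  have A: "A \<noteq> LS" "B \<noteq> A" "C \<noteq> B"
    using tight_adjacent[OF t2] tight_adjacent[OF tAB] tight_adjacent[OF tBC] by auto
  have "b \<noteq> 0" "c \<noteq> 0" using tight_nonzero tight_tl[OF tBC] tight_init[of "[(B, b)]" "[(C, c)]"] tBC by auto
  moreover have "\<not> 0 < b" using tight_straight_pos[OF t3 s a] A by blast
  ultimately have b: "0 < - b" by simp
  have "B \<noteq> LS"
  proof
    assume "B = LS"
    then have "tight [(LS, b), (A, a)]" using tAB tight_rev[of "[(A, a), (B, b)]"] by simp
    then show False using tight_diagonal_neighbour a b by (fastforce simp: zero_less_mult_iff)
  qed
  then have AB: "shear_pair A B" using shear_pair_cases[of A B] A by auto
  have "cheap [(LS, s), (A, a), (B, - (- b))]" using tight_cheap[OF t3] by simp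
  then have "a\<^sup>2 = 2" using diagonal_corner_length[OF AB s a b] by simp
  then have ar: "a = sqrt 2" using a by (simp add: real_sqrt_unique)
  have "C \<noteq> LS"
  proof
    assume C: "C = LS"
    have "tight [(LS, c), (B, b), (A, a)]" using tABC tight_rev[of "[(A, a), (B, b), (C, c)]"] C by simp
    then have t: "tight [(LS, - c), (B, - b), (A, - a)]" using tight_neg[of "[(LS, c), (B, b), (A, a)]"] by simp
    have "tight [(LS, - c), (B, - b)]" using t tight_init[of "[(LS, - c), (B, - b)]"] by simp
    then have c: "0 < - c" using tight_diagonal_neighbour b by (fastforce simp: zero_less_mult_iff)
    have "(- b)\<^sup>2 = 2" using diagonal_corner_length[OF shear_pair_sym[OF AB] c b a tight_cheap[OF t]] .
    then have br: "- b = sqrt 2" using b real_sqrt_unique[of "- b" 2] by simp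
    then have br': "b = - sqrt 2" by simp
    let ?v = "[(A, sqrt 2), (B, - sqrt 2), (LS, c - s)]"
    have "weight [(LS, s), (A, a), (B, b), (C, c)] \<le> weight ?v"
    proof (rule tightD[OF tight])
      show "?v \<preceq> [(LS, s), (A, a), (B, b), (C, c)]" using s c ar br' by (auto simp: prec_def)
      have "eval [(LS, s), (A, a), (B, b), (C, c)] = eval [(LS, s), (A, sqrt 2), (B, - sqrt 2)] ** shear LS c"
        by (simp add: ar br' C matrix_mul_assoc[symmetric] del: shear.simps)
      also have "\<dots> = eval ?v"
        unfolding corner_swaps_diagonal[OF AB sqrt2_sq(1)]
        by (simp add: matrix_mul_assoc[symmetric] shear_add del: shear.simps)
      finally show "eval ?v = eval [(LS, s), (A, a), (B, b), (C, c)]" ..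
      show "cost ?v \<le> cost [(LS, s), (A, a), (B, b), (C, c)]" using s c ar br' C by simp
    qed
    then show False using AB C by (auto simp: shear_pair_def)
  qed
  then have C: "C = A" using A AB by (cases C) (auto simp: shear_pair_def)
  have cheap: "cheap [(LS, s), (A, a), (B, - (- b)), (A, c)]" using tight_cheap[OF tight] C by simp
  have c: "0 < c"
  proof (rule ccontr)
    assume "\<not> 0 < c"
    then have "0 < - c" using \<open>c \<noteq> 0\<close> by simp
    then show False using diagonal_turn_not_cheap[OF AB s a b] cheap by (metis minus_minus)
  qed
  have "- b = 2 * sqrt 2" using diagonal_zigzag_lengths(2)[OF AB s a b c cheap] .
  then show ?thesis using AB C ar c by simp
qed

text \<open>A fourth letter that is diagonal forces $c = \sqrt 2$; the first diagonal letter can then be moved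
across two corners and merged with it. A shear is excluded by \<open>diagonal_tail_not_cheap\<close>.\<close>

lemma diagonal_right_four_pos:
  assumes tight: "tight [(LS, s), (A, a), (B, b), (C, c), (D, d)]" and s: "0 < s"
  shows False
proof -
  have t4: "tight [(LS, s), (A, a), (B, b), (C, c)]"
    using tight tight_init[of "[(LS, s), (A, a), (B, b), (C, c)]"] by simp
  have *: "shear_pair A B" "C = A" "a = sqrt 2" "b = - (2 * sqrt 2)" "0 < c"
    using diagonal_right_three[OF t4 s] by auto
  have tBCD: "tight [(B, b), (C, c), (D, d)]" using tight_tl[OF tight_tl[OF tight]] .
  have tCD: "tight [(C, c), (D, d)]" using tight_tl[OF tBCD] .
  have d: "d \<noteq> 0" "D \<noteq> A" using tight_nonzero tight_tl[OF tCD] tight_adjacent[OF tCD] * by auto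
  show False
  proof (cases "D = LS")
    case True
    have t: "tight [(LS, d), (A, c), (B, - (2 * sqrt 2))]"
      using tBCD tight_rev[of "[(B, b), (C, c), (D, d)]"] * True by simp
    have "tight [(LS, d), (A, c)]" using t tight_init[of "[(LS, d), (A, c)]"] by simp
    then have d: "0 < d" using tight_diagonal_neighbour *(5) by (fastforce simp: zero_less_mult_iff)
    have "c\<^sup>2 = 2" using diagonal_corner_length[OF *(1) d *(5) _ tight_cheap[OF t]] by simp
    then have c: "c = sqrt 2" using *(5) by (simp add: real_sqrt_unique)
    let ?r = "sqrt 2"
    let ?v = "[(A, ?r), (B, - (2 * ?r)), (A, ?r), (LS, s + d)]"
    have "weight [(LS, s), (A, a), (B, b), (C, c), (D, d)] \<le> weight ?v"
    proof (rule tightD[OF tight])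
      show "?v \<preceq> [(LS, s), (A, a), (B, b), (C, c), (D, d)]" using s d * c by (auto simp: prec_def)
      have "eval [(LS, s), (A, a), (B, b), (C, c), (D, d)] = eval ([(LS, s), (A, ?r), (B, - (2 * ?r))] @ [(A, ?r), (LS, d)])"
        by (simp add: * c True)
      also have "\<dots> = eval [(A, ?r), (B, - ?r)] ** (eval [(LS, - s), (B, - ?r), (A, - (- ?r))] ** shear LS d)"
        unfolding move_diagonal[OF *(1)] by (simp add: matrix_mul_assoc[symmetric] del: shear.simps)
      also have "eval [(LS, - s), (B, - ?r), (A, - (- ?r))] = eval [(B, - ?r), (A, - (- ?r)), (LS, - (- s))]"
        by (rule corner_swaps_diagonal[OF shear_pair_sym[OF *(1)]]) simp
      also have "eval [(A, ?r), (B, - ?r)] ** (eval [(B, - ?r), (A, - (- ?r)), (LS, - (- s))] ** shear LS d) = eval ?v"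
        by (simp add: matrix_mul_assoc[symmetric] shear_add del: shear.simps)
          (simp add: matrix_mul_assoc shear_add del: shear.simps)
      finally show "eval ?v = eval [(LS, s), (A, a), (B, b), (C, c), (D, d)]" ..
      show "cost ?v \<le> cost [(LS, s), (A, a), (B, b), (C, c), (D, d)]" using s d * c True by simp
    qed
    then show False using *(1,2) True by (auto simp: shear_pair_def)
  next
    case False
    then have "D = B" using d(2) *(1) by (cases D) (auto simp: shear_pair_def)
    then show False
      using diagonal_tail_not_cheap[OF *(1) s, of a "2 * sqrt 2" c d] tight_cheap[OF tight] * d by simp
  qed
qed

lemma diagonal_right_length:
  assumes tight: "tight ((LS, s) # w)"
  shows "length w \<le> 3"
proof (rule ccontr)
  assume "\<not> length w \<le> 3"
  then obtain r1 r2 r3 r4 w' where w: "w = r1 # r2 # r3 # r4 # w'"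
    by (metis (no_types, lifting) One_nat_def Suc_le_eq length_Suc_conv less_Suc_eq_le list.exhaust list.size(3) not_le numeral_3_eq_3 zero_less_Suc Suc_leI le_add1 plus_1_eq_Suc)
  have t: "tight [(LS, s), r1, r2, r3, r4]"
    using tight tight_init[of "[(LS, s), r1, r2, r3, r4]" w'] w by simp
  have "s \<noteq> 0" using tight_nonzero tight_init[of "[(LS, s)]" w] tight by simp
  then consider "0 < s" | "0 < - s" by linarith
  then show False
  proof cases
    case 1
    then show False using diagonal_right_four_pos t by (metis surj_pair)
  next
    case 2
    have "tight (neg [(LS, s), r1, r2, r3, r4])" using t by (simp only: tight_neg)
    moreover obtain A a B b C c D d where "r1 = (A, a)" "r2 = (B, b)" "r3 = (C, c)" "r4 = (D, d)"
      by (metis surj_pair)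
    ultimately have "tight [(LS, - s), (A, - a), (B, - b), (C, - c), (D, - d)]" by simp
    then show False using diagonal_right_four_pos 2 by blast
  qed
qed

text \<open>Three equal signs in a row are staircases; the patterns with one sign different from the other three
in an inner place are excluded by \<open>zigzag_then_straight_not_cheap\<close> and its mirror image.\<close>

lemma shear_window_signs:
  assumes XY: "shear_pair X Y" and tight: "tight [(X, a), (Y, b), (X, c), (Y, d)]" and a: "0 < a"
  shows "b < 0 \<and> 0 < c \<and> d < 0 \<or> 0 < b \<and> c < 0 \<and> d < 0 \<or> b < 0 \<and> c < 0 \<and> 0 < d"
proof -
  have nS: "X \<noteq> LS" "Y \<noteq> LS" using XY by (auto simp: shear_pair_def)
  have t3: "tight [(X, a), (Y, b), (X, c)]" using tight tight_init[of "[(X, a), (Y, b), (X, c)]"] by simp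
  have t3': "tight [(Y, b), (X, c), (Y, d)]" using tight_tl[OF tight] .
  have nz: "b \<noteq> 0" "c \<noteq> 0" "d \<noteq> 0"
    using tight_nonzero tight_factor[of "[(X, a)]" "[(Y, b)]" "[(X, c), (Y, d)]"]
      tight_factor[of "[(X, a), (Y, b)]" "[(X, c)]" "[(Y, d)]"] tight_factor[of "[(X, a), (Y, b), (X, c)]" "[(Y, d)]" "[]"] tight by auto
  have 1: "\<not> (0 < b \<and> 0 < c)" using tight_straight_pos[OF t3 a] nS by blast
  have 2: "\<not> (b < 0 \<and> c < 0 \<and> d < 0)"
  proof
    assume "b < 0 \<and> c < 0 \<and> d < 0"
    moreover have "tight [(Y, - b), (X, - c), (Y, - d)]" using t3' tight_neg[of "[(Y, b), (X, c), (Y, d)]"] by simp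
    ultimately show False using tight_straight_pos nS by (metis neg_0_less_iff_less)
  qed
  have 3: "\<not> (0 < b \<and> c < 0 \<and> 0 < d)"
  proof
    assume *: "0 < b \<and> c < 0 \<and> 0 < d"
    have "tight [(Y, d), (X, - (- c)), (Y, b), (X, a)]"
      using tight tight_rev[of "[(X, a), (Y, b), (X, c), (Y, d)]"] by simp
    then show False using zigzag_then_straight_not_cheap[OF shear_pair_sym[OF XY], of d "- c" b a] * a tight_cheap by simp
  qed
  have 4: "\<not> (b < 0 \<and> 0 < c \<and> 0 < d)"
  proof
    assume *: "b < 0 \<and> 0 < c \<and> 0 < d"
    have "tight [(X, a), (Y, - (- b)), (X, c), (Y, d)]" using tight by simp
    then show False using zigzag_then_straight_not_cheap[OF XY, of a "- b" c d] * a tight_cheap by simp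
  qed
  show ?thesis using 1 2 3 4 nz by linarith
qed

text \<open>Two overlapping windows with the patterns of \<open>shear_window_signs\<close> form a zigzag or one of the two
hooks.\<close>

lemma shear_five_zigzag:
  assumes XY: "shear_pair X Y" and tight: "tight [(X, a), (Y, b), (X, c), (Y, d), (X, e)]" and a: "0 < a"
  shows "b < 0 \<and> 0 < c \<and> d < 0 \<and> 0 < e"
proof -
  have t1: "tight [(X, a), (Y, b), (X, c), (Y, d)]"
    using tight tight_init[of "[(X, a), (Y, b), (X, c), (Y, d)]"] by simp
  have t2: "tight [(Y, b), (X, c), (Y, d), (X, e)]" using tight_tl[OF tight] .
  have t2': "tight [(Y, - b), (X, - c), (Y, - d), (X, - e)]" using t2 tight_neg[of "[(Y, b), (X, c), (Y, d), (X, e)]"] by simp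
  from shear_window_signs[OF XY t1 a]
  consider "b < 0" "0 < c" "d < 0" | "0 < b" "c < 0" "d < 0" | "b < 0" "c < 0" "0 < d" by blast
  then show ?thesis
  proof cases
    case 1
    then show ?thesis using shear_window_signs[OF shear_pair_sym[OF XY] t2'] by simp
  next
    case 2
    then have "0 < e" using shear_window_signs[OF shear_pair_sym[OF XY] t2] by simp
    then show ?thesis using hook_not_cheap[OF XY a, of b "- c" "- d" e] 2 tight_cheap[OF tight] by simp
  next
    case 3
    then have "0 < e" using shear_window_signs[OF shear_pair_sym[OF XY] t2'] by simp
    moreover have "cheap [(X, e), (Y, d), (X, c), (Y, b), (X, a)]"
      using tight_cheap[OF tight] cheap_rev[of "[(X, a), (Y, b), (X, c), (Y, d), (X, e)]"] by simp
    ultimately show ?thesis using hook_not_cheap[OF XY, of e d "- c" "- b" a] 3 a by simp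
  qed
qed

lemma seven_shears_not_tight_pos:
  assumes XY: "shear_pair X Y" and a: "0 < a"
    and tight: "tight [(X, a), (Y, b), (X, c), (Y, d), (X, e), (Y, f), (X, g)]"
  shows False
proof -
  have t5: "tight [(X, a), (Y, b), (X, c), (Y, d), (X, e)]"
    using tight tight_init[of "[(X, a), (Y, b), (X, c), (Y, d), (X, e)]"] by simp
  have s1: "b < 0" "0 < c" "d < 0" "0 < e" using shear_five_zigzag[OF XY t5 a] by auto
  have t5': "tight [(X, c), (Y, d), (X, e), (Y, f), (X, g)]" using tight_tl[OF tight_tl[OF tight]] .
  have s2: "f < 0" "0 < g" using shear_five_zigzag[OF XY t5' s1(2)] by auto
  note cheap = tight_cheap[OF tight]
  have "cheap [(X, a), (Y, - (- b)), (X, c), (Y, - (- d))]"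
    using cheap cheap_init[of "[(X, a), (Y, b), (X, c), (Y, d)]"] by simp
  then have bc: "- b = c" using zigzag_equal[OF XY a, of "- b" c "- d"] s1 by simp
  have "cheap [(X, c), (Y, - (- d)), (X, e), (Y, - (- f))]"
    using cheap cheap_factor[of "[(X, a), (Y, b)]" "[(X, c), (Y, d), (X, e), (Y, f)]" "[(X, g)]"] by simp
  then have de: "- d = e" using zigzag_equal[OF XY s1(2), of "- d" e "- f"] s1 s2 by simp
  have "cheap (neg [(Y, b), (X, c), (Y, d), (X, e)])"
    using cheap cheap_factor[of "[(X, a)]" "[(Y, b), (X, c), (Y, d), (X, e)]" "[(Y, f), (X, g)]"] by (simp only: cheap_neg) simp
  then have cd: "c = - d" using zigzag_equal[OF shear_pair_sym[OF XY], of "- b" c "- d" e] s1 by simp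
  have "cheap (neg [(Y, d), (X, e), (Y, f), (X, g)])"
    using cheap cheap_factor[of "[(X, a), (Y, b), (X, c)]" "[(Y, d), (X, e), (Y, f), (X, g)]" "[]"] by (simp only: cheap_neg) simp
  then have ef: "e = - f" using zigzag_equal[OF shear_pair_sym[OF XY], of "- d" e "- f" g] s1 s2 by simp
  have eqs: "b = - c" "d = - c" "e = c" "f = - c" using bc de cd ef by simp_all
  show False
  proof (cases "c\<^sup>2 < 2")
    case True
    show False using short_zigzag_not_cheap[OF XY a s1(2) s1(2) True] tight_cheap[OF t5] eqs by simp
  next
    case False
    have "cheap (neg [(Y, b), (X, c), (Y, d), (X, e), (Y, f)])"
      using cheap cheap_factor[of "[(X, a)]" "[(Y, b), (X, c), (Y, d), (X, e), (Y, f)]" "[(X, g)]"] by (simp only: cheap_neg) simp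
    then show False using long_zigzag_not_cheap[OF shear_pair_sym[OF XY] s1(2)] False eqs by simp
  qed
qed

lemma seven_shears_not_tight:
  assumes XY: "shear_pair X Y"
    and tight: "tight [(X, a), (Y, b), (X, c), (Y, d), (X, e), (Y, f), (X, g)]"
  shows False
proof -
  have "tight [(X, a)]" using tight tight_init[of "[(X, a)]"] by simp
  then have "a \<noteq> 0" by (rule tight_nonzero)
  then consider "0 < a" | "0 < - a" by linarith
  then show False
  proof cases
    case 1
    then show False using seven_shears_not_tight_pos[OF XY _ tight] by simp
  next
    case 2
    have "tight (neg [(X, a), (Y, b), (X, c), (Y, d), (X, e), (Y, f), (X, g)])"
      using tight by (simp only: tight_neg)
    then show False using seven_shears_not_tight_pos[OF XY 2] by simp
  qed
qed

lemma seven_with_diagonal_not_tight: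
  assumes tight: "tight [p1, p2, p3, (LS, s), p5, p6, p7]"
  shows False
proof -
  have pos: False if t: "tight [(A, a), (B, b), (C, c), (LS, s), (D, d), (E, e), (F, f)]" and s: "0 < s"
    for A a B b C c s D d E e F f
  proof -
    have "tight [(LS, s), (D, d), (E, e), (F, f)]"
      using t tight_factor[of "[(A, a), (B, b), (C, c)]" "[(LS, s), (D, d), (E, e), (F, f)]" "[]"] by simp
    from diagonal_right_three[OF this s]
    have R: "shear_pair D E" "F = D" "d = sqrt 2" "e = - (2 * sqrt 2)" "0 < f" by auto
    have "tight [(A, a), (B, b), (C, c), (LS, s)]"
      using t tight_init[of "[(A, a), (B, b), (C, c), (LS, s)]"] by simp
    then have "tight [(LS, s), (C, c), (B, b), (A, a)]"
      using tight_rev[of "[(A, a), (B, b), (C, c), (LS, s)]"] by simp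
    from diagonal_right_three[OF this s]
    have L: "shear_pair C B" "A = C" "c = sqrt 2" "b = - (2 * sqrt 2)" "0 < a" by auto
    show False
      using seven_letters_not_cheap[OF R(1) L(1) s L(5) R(5)] tight_cheap[OF t] R L by simp
  qed
  have "s \<noteq> 0" using tight tight_nonzero tight_factor[of "[p1, p2, p3]" "[(LS, s)]" "[p5, p6, p7]"] by simp
  then consider "0 < s" | "0 < - s" by linarith
  then show False
  proof cases
    case 1
    then show False using pos tight by (cases p1; cases p2; cases p3; cases p5; cases p6; cases p7) blast
  next
    case 2
    have "tight (neg [p1, p2, p3, (LS, s), p5, p6, p7])" using tight by (simp only: tight_neg)
    moreover obtain A a B b C c D d E e F f where
      "p1 = (A, a)" "p2 = (B, b)" "p3 = (C, c)" "p5 = (D, d)" "p6 = (E, e)" "p7 = (F, f)"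
      by (metis surj_pair)
    ultimately have "tight [(A, - a), (B, - b), (C, - c), (LS, - s), (D, - d), (E, - e), (F, - f)]" by simp
    then show False using pos 2 by blast
  qed
qed

lemma tight_length:
  assumes tight: "tight w"
  shows "length w \<le> 6"
proof (rule ccontr)
  assume "\<not> length w \<le> 6"
  define u where "u = take 7 w"
  have u: "length u = 7" "tight u"
    using \<open>\<not> length w \<le> 6\<close> tight tight_init[of u "drop 7 w"] by (simp_all add: u_def)
  have no_S: "fst (u ! i) \<noteq> LS" if "i < 7" for i
  proof
    assume S: "fst (u ! i) = LS"
    have split: "u = take i u @ [u ! i] @ drop (Suc i) u"
      using id_take_nth_drop[of i u] u that by simp
    have "tight ([u ! i] @ drop (Suc i) u)" using tight_factor[of "take i u" _ "[]"] split u by simp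
    then have 1: "length (drop (Suc i) u) \<le> 3" using diagonal_right_length S by (cases "u ! i") (simp del: length_drop)
    have "tight (take i u @ [u ! i])" by (metis append_assoc split u(2) tight_init)
    then have "tight (rev (take i u @ [u ! i]))" by (simp only: tight_rev)
    then have "length (rev (take i u)) \<le> 3" using diagonal_right_length S
      by (cases "u ! i") (simp del: length_rev length_take)
    with 1 have i: "i = 3" using u that by simp
    obtain p1 p2 p3 p4 p5 p6 p7 where p: "u = [p1, p2, p3, p4, p5, p6, p7]"
      using u(1) by (auto simp: numeral_eq_Suc length_Suc_conv)
    then have "p4 = (LS, snd p4)" using S i by (cases p4) simp
    then show False using seven_with_diagonal_not_tight u(2) p by metis
  qed
  obtain A a B b C c D d E e F f G g where p: "u = [(A, a), (B, b), (C, c), (D, d), (E, e), (F, f), (G, g)]"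
    using u(1) by (auto simp: numeral_eq_Suc length_Suc_conv)
  have nS: "A \<noteq> LS" "B \<noteq> LS" "C \<noteq> LS" "D \<noteq> LS" "E \<noteq> LS" "F \<noteq> LS" "G \<noteq> LS"
    using no_S[of 0] no_S[of 1] no_S[of 2] no_S[of 3] no_S[of 4] no_S[of 5] no_S[of 6] by (auto simp: p)
  have ne: "A \<noteq> B" "B \<noteq> C" "C \<noteq> D" "D \<noteq> E" "E \<noteq> F" "F \<noteq> G"
    using u(2) tight_adjacent tight_factor[of "[]" "[(A, a), (B, b)]" "[(C, c), (D, d), (E, e), (F, f), (G, g)]"]
      tight_factor[of "[(A, a)]" "[(B, b), (C, c)]" "[(D, d), (E, e), (F, f), (G, g)]"]
      tight_factor[of "[(A, a), (B, b)]" "[(C, c), (D, d)]" "[(E, e), (F, f), (G, g)]"]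
      tight_factor[of "[(A, a), (B, b), (C, c)]" "[(D, d), (E, e)]" "[(F, f), (G, g)]"]
      tight_factor[of "[(A, a), (B, b), (C, c), (D, d)]" "[(E, e), (F, f)]" "[(G, g)]"]
      tight_factor[of "[(A, a), (B, b), (C, c), (D, d), (E, e)]" "[(F, f), (G, g)]" "[]"]
    unfolding p by auto
  have third: "L = N" if "L \<noteq> LS" "M \<noteq> LS" "N \<noteq> LS" "L \<noteq> M" "M \<noteq> N" for L M N
    using that by (cases L; cases M; cases N) simp_all
  have alt: "C = A" "D = B" "E = A" "F = B" "G = A"
    using third[of A B C] third[of B C D] third[of C D E] third[of D E F] third[of E F G] nS ne by simp_all
  have "shear_pair A B" using shear_pair_cases[of A B] nS ne by blast
  then show False using seven_shears_not_tight u(2) p alt by blast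
qed

section \<open>Existence of shortest words\<close>

fun sg :: "bool \<Rightarrow> real" where "sg s = (if s then 1 else - 1)"

text \<open>Matrices and upper bounds for the costs of products of \<open>n + 1\<close> blocks of alternating sign, the first
one of sign \<open>s\<close>.\<close>

fun reach :: "nat \<Rightarrow> bool \<Rightarrow> ((real^2^2) \<times> real) set" where
  "reach 0 s = block (sg s) {(mat 1, c) | c. 0 \<le> c}"
| "reach (Suc n) s = block (sg s) (reach n (\<not> s))"

lemma reach_block: "\<exists>R. reach n s = block (sg s) R"
  by (cases n) auto

lemma reach_nonneg: "reach n s \<subseteq> UNIV \<times> {0..}"
  by (induction n arbitrary: s) (auto intro!: block_nonneg simp del: sg.simps)

lemma closed_reach: "closed (reach n s)"
proof (induction n arbitrary: s)
  case 0
  have "closed ({mat 1} \<times> {0..} :: ((real^2^2) \<times> real) set)"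
    by (intro closed_Times) auto
  moreover have "{mat 1} \<times> {0..} = {(mat 1 :: real^2^2, c :: real) | c. 0 \<le> c}" by auto
  ultimately show ?case unfolding reach.simps by (intro closed_block) auto
next
  case (Suc n)
  then show ?case unfolding reach.simps by (intro closed_block reach_nonneg)
qed

lemma blockI:
  assumes "X \<noteq> LS" "Y \<noteq> LS" "0 \<le> \<sigma> * a" "0 \<le> \<sigma> * s" "0 \<le> \<sigma> * b" "(g, c) \<in> R"
  shows "(eval [(X, a), (LS, s), (Y, b)] ** g, \<bar>a\<bar> + 2 * \<bar>s\<bar> + \<bar>b\<bar> + c) \<in> block \<sigma> R"
proof -
  have "(shear X a ** (shear LS s ** (shear Y b ** g)), speed X * \<bar>a\<bar> + (speed LS * \<bar>s\<bar> + (speed Y * \<bar>b\<bar> + c)))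
      \<in> prepend \<sigma> X (prepend \<sigma> LS (prepend \<sigma> Y R))"
    using assms by (intro prependI)
  moreover have "X \<in> {LP, LQ}" "Y \<in> {LP, LQ}" using assms(1,2) by (cases X; cases Y; auto)+
  ultimately show ?thesis
    unfolding block_def using assms(1,2)
    by (auto simp: speed_shear matrix_mul_assoc add.assoc simp del: shear.simps)
qed

lemma blockE:
  assumes "(g, c) \<in> block \<sigma> R"
  obtains X Y a s b g' c' where "X \<noteq> LS" "Y \<noteq> LS" "0 \<le> \<sigma> * a" "0 \<le> \<sigma> * s" "0 \<le> \<sigma> * b" "(g', c') \<in> R"
    "g = eval [(X, a), (LS, s), (Y, b)] ** g'" "c = \<bar>a\<bar> + 2 * \<bar>s\<bar> + \<bar>b\<bar> + c'"
proof -
  obtain X Y where XY: "X \<in> {LP, LQ}" "Y \<in> {LP, LQ}" "(g, c) \<in> prepend \<sigma> X (prepend \<sigma> LS (prepend \<sigma> Y R))"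
    using assms unfolding block_def by blast
  from XY(3) obtain a s b g' c' where "0 \<le> \<sigma> * a" "0 \<le> \<sigma> * s" "0 \<le> \<sigma> * b" "(g', c') \<in> R"
     "g = shear X a ** (shear LS s ** (shear Y b ** g'))" "c = speed X * \<bar>a\<bar> + (speed LS * \<bar>s\<bar> + (speed Y * \<bar>b\<bar> + c'))"
    by (elim prependE) blast
  then show ?thesis
    using XY(1,2) by (intro that[of X Y a s b g' c']) (auto simp: matrix_mul_assoc simp del: shear.simps)
qed

lemma signed_word_to_block:
  assumes "\<forall>(l, x)\<in>set w. 0 \<le> sg q * x"
  shows "\<exists>X Y a s b. X \<noteq> LS \<and> Y \<noteq> LS \<and> 0 \<le> sg q * a \<and> 0 \<le> sg q * s \<and> 0 \<le> sg q * b \<and>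
     eval [(X, a), (LS, s), (Y, b)] = eval w \<and> \<bar>a\<bar> + 2 * \<bar>s\<bar> + \<bar>b\<bar> \<le> cost w"
proof (cases q)
  case True
  with assms have "\<forall>(l, x)\<in>set w. 0 \<le> x" by simp
  from nonneg_word_to_block[OF this] obtain X Y a s b where
    "X \<noteq> LS" "Y \<noteq> LS" "0 \<le> a" "0 \<le> s" "0 \<le> b" "eval [(X, a), (LS, s), (Y, b)] = eval w" "a + 2 * s + b \<le> cost w"
    by blast
  then show ?thesis using True
    by (intro exI[of _ X] exI[of _ Y] exI[of _ a] exI[of _ s] exI[of _ b]) simp
next
  case False
  have "\<forall>(l, x)\<in>set (neg w). 0 \<le> x" using assms False by (auto simp: neg_def)
  from nonneg_word_to_block[OF this] obtain X Y a s b where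
    *: "X \<noteq> LS" "Y \<noteq> LS" "0 \<le> a" "0 \<le> s" "0 \<le> b" "eval [(X, a), (LS, s), (Y, b)] = eval (neg w)" "a + 2 * s + b \<le> cost w"
    by auto
  have "eval (neg [(X, a), (LS, s), (Y, b)]) = eval (neg (neg w))"
    by (rule eval_neg_eq) fact
  then have "eval [(X, - a), (LS, - s), (Y, - b)] = eval w" by (simp only: neg_simps)
  then show ?thesis using False *
    by (intro exI[of _ X] exI[of _ Y] exI[of _ "- a"] exI[of _ "- s"] exI[of _ "- b"]) simp
qed

lemma block_id: "(g, c) \<in> R \<Longrightarrow> (g, c) \<in> block \<sigma> R"
  using blockI[of LP LP \<sigma> 0 0 0 g c R] by (simp del: shear.simps)

text \<open>The block and a letter of the same sign form a word of constant sign, which is again a block.\<close>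

lemma block_letter:
  assumes "(g, c) \<in> block (sg q) R" "0 \<le> sg q * t"
  shows "\<exists>c' \<le> speed l * \<bar>t\<bar> + c. (shear l t ** g, c') \<in> block (sg q) R"
proof -
  obtain X Y a s b g' c' where *: "X \<noteq> LS" "Y \<noteq> LS" "0 \<le> sg q * a" "0 \<le> sg q * s" "0 \<le> sg q * b" "(g', c') \<in> R"
    "g = eval [(X, a), (LS, s), (Y, b)] ** g'" "c = \<bar>a\<bar> + 2 * \<bar>s\<bar> + \<bar>b\<bar> + c'"
    using assms(1) by (rule blockE)
  have "\<forall>(l, x)\<in>set [(l, t), (X, a), (LS, s), (Y, b)]. 0 \<le> sg q * x" using * assms by simp
  from signed_word_to_block[OF this] obtain X' Y' a' s' b' where
    v: "X' \<noteq> LS" "Y' \<noteq> LS" "0 \<le> sg q * a'" "0 \<le> sg q * s'" "0 \<le> sg q * b'"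
      "eval [(X', a'), (LS, s'), (Y', b')] = eval [(l, t), (X, a), (LS, s), (Y, b)]"
      "\<bar>a'\<bar> + 2 * \<bar>s'\<bar> + \<bar>b'\<bar> \<le> cost [(l, t), (X, a), (LS, s), (Y, b)]"
    by blast
  have "shear l t ** g = eval [(X', a'), (LS, s'), (Y', b')] ** g'"
    unfolding v(6) *(7) by (simp add: matrix_mul_assoc del: shear.simps)
  moreover have "\<bar>a'\<bar> + 2 * \<bar>s'\<bar> + \<bar>b'\<bar> + c' \<le> speed l * \<bar>t\<bar> + c"
    using v(7) * by (simp add: speed_shear)
  ultimately show ?thesis using blockI[OF v(1-5) *(6)] by metis
qed

lemma reach_word:
  assumes "(g, c) \<in> reach n s"
  shows "\<exists>w r. eval w = g \<and> cost w \<le> c \<and> flips s w r \<le> n"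
proof -
  have add: "\<exists>w r. eval w = g \<and> cost w \<le> c \<and> flips s w r \<le> k"
    if b: "(g, c) \<in> block (sg s) R"
    and R: "\<And>g c. (g, c) \<in> R \<Longrightarrow> \<exists>w r. eval w = g \<and> cost w \<le> c \<and> flips s w r \<le> k" for g c R k and s
  proof -
    obtain X Y a t b g' c' where *: "X \<noteq> LS" "Y \<noteq> LS" "0 \<le> sg s * a" "0 \<le> sg s * t" "0 \<le> sg s * b" "(g', c') \<in> R"
      "g = eval [(X, a), (LS, t), (Y, b)] ** g'" "c = \<bar>a\<bar> + 2 * \<bar>t\<bar> + \<bar>b\<bar> + c'"
      using b by (rule blockE)
    obtain w r where w: "eval w = g'" "cost w \<le> c'" "flips s w r \<le> k" using R[OF *(6)] by blast
    have "flips s [(X, a), (LS, t), (Y, b)] s = 0" using * by (cases s) auto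
    then have "flips s ([(X, a), (LS, t), (Y, b)] @ w) r \<le> k"
      using flips_append_le[of s "[(X, a), (LS, t), (Y, b)]" w r s] w(3) by linarith
    moreover have "eval ([(X, a), (LS, t), (Y, b)] @ w) = g" unfolding eval_append w(1) *(7) ..
    moreover have "cost ([(X, a), (LS, t), (Y, b)] @ w) \<le> c" using * w(2) by (simp add: speed_shear)
    ultimately show ?thesis by blast
  qed
  show ?thesis using assms
  proof (induction n arbitrary: g c s)
    case 0
    have "\<exists>w r. eval w = g \<and> cost w \<le> c \<and> flips s w r \<le> 0"
      if "(g, c) \<in> {(mat 1, c) | c. 0 \<le> c}" for g c
      using that by (intro exI[of _ "[]"] exI[of _ s]) auto
    from add[OF 0[unfolded reach.simps] this] show ?case by simp
  next
    case (Suc n)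
    have "\<exists>w r. eval w = g \<and> cost w \<le> c \<and> flips s w r \<le> Suc n" if gc: "(g, c) \<in> reach n (\<not> s)" for g c
    proof -
      obtain w r where "eval w = g" "cost w \<le> c" "flips (\<not> s) w r \<le> n" using Suc.IH[OF gc] by blast
      moreover have "flips s w r \<le> 1 + flips (\<not> s) w r" using flips_switch[of s w r "\<not> s"] by simp
      ultimately show ?thesis by (intro exI[of _ w] exI[of _ r]) simp
    qed
    from add[OF Suc.prems[unfolded reach.simps] this] show ?case .
  qed
qed

lemma word_reach:
  assumes "flips s w r \<le> n"
  shows "\<exists>c \<le> cost w. (eval w, c) \<in> reach n s"
  using assms
proof (induction w arbitrary: n s)
  case Nil
  have "(mat 1, 0) \<in> reach n s" by (induction n arbitrary: s) (auto intro!: block_id simp del: sg.simps)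
  then show ?case by auto
next
  case (Cons a w)
  obtain l t where a: "a = (l, t)" by fastforce
  show ?case
  proof (cases "t = 0")
    case True
    then show ?thesis using Cons a by (simp del: shear.simps)
  next
    case nz: False
    show ?thesis
    proof (cases "s = (0 < t)")
      case True
      then obtain c where c: "c \<le> cost w" "(eval w, c) \<in> reach n s"
        using Cons.IH[of s n] Cons.prems a nz by auto
      have st: "0 \<le> sg s * t" using True nz by auto
      obtain R where R: "reach n s = block (sg s) R" using reach_block by blast
      obtain c' where "c' \<le> speed l * \<bar>t\<bar> + c" "(shear l t ** eval w, c') \<in> reach n s"
        using block_letter[OF _ st, of "eval w" c R l] c(2) unfolding R by blast
      then show ?thesis using c(1) a by (intro exI[of _ c']) (simp del: shear.simps)
    next
      case False
      then obtain k where n: "n = Suc k" and "flips (\<not> s) w r \<le> k"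
        using Cons.prems a nz by (cases n) auto
      then obtain c where c: "c \<le> cost w" "(eval w, c) \<in> reach k (\<not> s)"
        using Cons.IH[of "\<not> s" k] by auto
      have st: "0 \<le> sg (\<not> s) * t" using False nz by auto
      obtain R where R: "reach k (\<not> s) = block (sg (\<not> s)) R" using reach_block by blast
      obtain c' where c': "c' \<le> speed l * \<bar>t\<bar> + c" "(shear l t ** eval w, c') \<in> reach k (\<not> s)"
        using block_letter[OF _ st, of "eval w" c R l] c(2) unfolding R by blast
      have "(shear l t ** eval w, c') \<in> reach n s"
        unfolding n reach.simps by (rule block_id) (rule c'(2))
      then show ?thesis using c(1) c'(1) a by (intro exI[of _ c']) (simp del: shear.simps)
    qed
  qed
qed

text \<open>A smallest cost exists because \<open>reach n True\<close> is closed and consists, up to lowering costs, of the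
words with at most \<open>n\<close> sign changes, counted from a positive start. A word of this cost is cheap, and the lightest of its equally
expensive rewritings is tight.\<close>

lemma minimiser_exists:
  assumes "flips True w0 r0 \<le> n"
  shows "\<exists>w. tight w \<and> eval w = eval w0 \<and>
    (\<forall>v r. eval v = eval w0 \<longrightarrow> flips True v r \<le> n \<longrightarrow> cost w \<le> cost v)"
proof -
  define g where "g = eval w0"
  define C where "C = {c. (g, c) \<in> reach n True}"
  have "closed C"
  proof -
    have "C = (\<lambda>c. (g, c)) -` reach n True" by (auto simp: C_def)
    then show ?thesis by (simp add: closed_vimage[OF closed_reach] continuous_on_Pair)
  qed
  have bdd: "bdd_below C" using reach_nonneg by (intro bdd_belowI[of _ 0]) (auto simp: C_def)
  have "C \<noteq> {}" using word_reach[OF assms] by (auto simp: C_def g_def)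
  then have "Inf C \<in> C" using closed_contains_Inf[OF _ bdd \<open>closed C\<close>] by simp
  then obtain w1 r1 where w1: "eval w1 = g" "cost w1 \<le> Inf C" "flips True w1 r1 \<le> n"
    using reach_word unfolding C_def by blast
  have min: "cost w1 \<le> cost v" if v: "eval v = g" "flips True v r \<le> n" for v r
  proof -
    obtain c where "c \<le> cost v" "(g, c) \<in> reach n True" using word_reach[OF v(2)] v(1) by auto
    then have "Inf C \<le> cost v" using cInf_lower[OF _ bdd, of c] by (simp add: C_def)
    then show ?thesis using w1(2) by simp
  qed
  have cheap: "cheap w1"
    unfolding cheap_def
  proof (intro allI impI)
    fix v assume "v \<preceq> w1" "eval v = eval w1"
    then have "flips True v r1 \<le> n" using w1(3) unfolding prec_def by (meson le_trans)
    then show "cost w1 \<le> cost v" using min \<open>eval v = eval w1\<close> w1(1) by simp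
  qed
  define Q where "Q v \<longleftrightarrow> v \<preceq> w1 \<and> eval v = eval w1 \<and> cost v \<le> cost w1" for v
  have "Q w1" by (simp add: Q_def)
  then obtain w where w: "Q w" "\<And>v. Q v \<Longrightarrow> weight w \<le> weight v"
    using ex_has_least_nat[of Q w1 weight] by blast
  have "tight w"
    unfolding tight_def
  proof (intro conjI allI impI)
    show "cheap w" using cheap_replace[OF cheap] w(1) by (simp add: Q_def)
    fix v assume "v \<preceq> w" "eval v = eval w" "cost v \<le> cost w"
    then show "weight w \<le> weight v" using w by (intro w(2)) (auto simp: Q_def intro: prec_trans)
  qed
  moreover have "cost w \<le> cost v" if "eval v = g" "flips True v r \<le> n" for v r
    using min[OF that] w(1) by (simp add: Q_def)
  moreover have "eval w = g" using w(1) w1(1) by (simp add: Q_def)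
  ultimately show ?thesis unfolding g_def by blast
qed

lemma flips_le_length: "flips s w r \<le> length w + 1"
proof (induction w arbitrary: s)
  case (Cons a w)
  obtain l t where "a = (l, t)" by fastforce
  then show ?case using Cons[of s] Cons[of "0 < t"] by (simp add: of_bool_def)
qed simp

text \<open>A minimiser among words with at most seven sign changes is a minimiser among all words: any
competitor can first be reduced to six letters, and six letters have at most seven sign changes even
when the signs before and after the word are prescribed.\<close>

theorem six_letters_suffice:
  "\<exists>w. length w \<le> 6 \<and> eval w = eval w0 \<and> (\<forall>v. eval v = eval w0 \<longrightarrow> cost w \<le> cost v)"
proof -
  have short: "\<exists>w. length w \<le> 6 \<and> eval w = eval v \<and> cost w \<le> cost v" for v
    using minimiser_exists[OF order_refl, of v True] tight_length by (metis order_refl)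
  obtain w1 where w1: "length w1 \<le> 6" "eval w1 = eval w0" using short by blast
  have "flips True w1 True \<le> 7" using flips_le_length[of True w1 True] w1(1) by simp
  from minimiser_exists[OF this] obtain w where w: "tight w" "eval w = eval w0"
      "\<And>v r. eval v = eval w0 \<Longrightarrow> flips True v r \<le> 7 \<Longrightarrow> cost w \<le> cost v"
    using w1(2) by metis
  have "cost w \<le> cost v" if "eval v = eval w0" for v
  proof -
    obtain v' where v': "length v' \<le> 6" "eval v' = eval v" "cost v' \<le> cost v" using short by blast
    have "flips True v' True \<le> 7" using flips_le_length[of True v' True] v'(1) by simp
    then show ?thesis using w(3)[of v' True] v' that by simp
  qed
  then show ?thesis using w tight_length by blast
qed

section \<open>Factorizations of elements of the special linear group\<close>

text \<open>If the lower left entry $c$ is nonzero, the matrix is $P^{(a-1)/c}\,Q^c\,P^{(d-1)/c}$. Otherwise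
multiply by $Q$ first.\<close>

lemma eval_surj:
  assumes "g \<in> SL2"
  shows "\<exists>w. eval w = g"
proof -
  obtain a b c d where g: "g = mk a b c d" using mk_surj by blast
  have det: "a * d - b * c = 1" using assms by (simp add: SL2_def g)
  have lower: "\<exists>w. eval w = mk a b c d" if "c \<noteq> 0" "a * d - b * c = 1" for a b c d
    using that by (intro exI[of _ "[(LP, (a - 1) / c), (LQ, c), (LP, (d - 1) / c)]"])
      (simp add: mk_mult mat_1_mk field_simps)
  show ?thesis
  proof (cases "c = 0")
    case False
    then show ?thesis using lower det g by simp
  next
    case True
    then have "a \<noteq> 0" using det by auto
    then obtain w where "eval w = mk a b (c + a) (d + b)"
      using lower[of "c + a" a "d + b" b] det True by (auto simp: algebra_simps)
    then have "eval ((LQ, - 1) # w) = g" by (simp add: mk_mult g)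
    then show ?thesis by blast
  qed
qed

lemma approximate_by_shears:
  assumes "0 < e"
  shows "\<exists>v. LS \<notin> fst ` set v \<and> eval v = eval w \<and> cost v \<le> cost w + e"
  using assms
proof (induction w arbitrary: e)
  case Nil
  then show ?case by (intro exI[of _ "[]"]) simp
next
  case (Cons a w)
  obtain l t where a: "a = (l, t)" by fastforce
  have e: "0 < e / 2" using Cons.prems by simp
  obtain v where v: "LS \<notin> fst ` set v" "eval v = eval w" "cost v \<le> cost w + e / 2"
    using Cons.IH[OF e] by blast
  obtain u where u: "LS \<notin> fst ` set u" "eval u = shear l t" "cost u \<le> speed l * \<bar>t\<bar> + e / 2"
  proof (cases "l = LS")
    case False
    then show ?thesis using e by (intro that[of "[(l, t)]"]) (auto simp del: shear.simps)
  next
    case True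
    obtain u where u: "\<forall>(l, x)\<in>set u. l \<noteq> LS \<and> 0 \<le> x" "eval u = shear LS \<bar>t\<bar>" "cost u \<le> 2 * \<bar>t\<bar> + e / 2"
      using diagonal_by_shears[OF _ e, of "\<bar>t\<bar>"] by auto
    show ?thesis
    proof (cases "0 \<le> t")
      case True
      then show ?thesis using u \<open>l = LS\<close> by (intro that[of u]) (auto simp del: shear.simps)
    next
      case False
      have "eval (neg u) = eval (neg [(LS, \<bar>t\<bar>)])"
        by (rule eval_neg_eq) (simp add: u(2) del: shear.simps)
      then have "eval (neg u) = shear LS t" using False by (simp del: shear.simps)
      then show ?thesis using u \<open>l = LS\<close> by (intro that[of "neg u"]) (auto simp: neg_def cost_neg[unfolded neg_def] simp del: shear.simps)
    qed
  qed
  show ?case using u v a by (intro exI[of _ "u @ v"]) (auto simp del: shear.simps)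
qed

definition fword_of :: "word \<Rightarrow> fword" where
  "fword_of w = map (\<lambda>(l, t). (t, gen l)) w"

lemma word_prod_fword_of: "word_prod (fword_of w) = eval w"
  unfolding fword_of_def word_prod_def eval_def
  by (induction w) (auto simp: mexp_gen simp del: shear.simps gen.simps)

lemma gen_inj: "gen l = gen m \<Longrightarrow> l = m"
  unfolding gen_mk by (cases l; cases m) auto

lemma word_cost_fword_of: "word_cost (fword_of w) = cost w"
proof -
  have "factor_cost (t, gen l) = speed l * \<bar>t\<bar>" for l t
    using gen_inj[of l LS] by (cases "l = LS") (auto simp: factor_cost_def speed_shear)
  then show ?thesis unfolding word_cost_def fword_of_def cost_def
    by (simp add: case_prod_beta' comp_def)
qed

lemma shear_words: "words_over {mat_P, mat_Q} = fword_of ` {w. LS \<notin> fst ` set w}"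
proof
  show "fword_of ` {w. LS \<notin> fst ` set w} \<subseteq> words_over {mat_P, mat_Q}"
  proof clarify
    fix w :: word assume "LS \<notin> fst ` set w"
    then have "gen l = mat_P \<or> gen l = mat_Q" if "(l, t) \<in> set w" for l t
      using that by (cases l) force+
    then show "fword_of w \<in> words_over {mat_P, mat_Q}"
      by (auto simp: words_over_def fword_of_def simp del: gen.simps)
  qed
  show "words_over {mat_P, mat_Q} \<subseteq> fword_of ` {w. LS \<notin> fst ` set w}"
  proof
    fix f assume "f \<in> words_over {mat_P, mat_Q}"
    then have "\<exists>w. LS \<notin> fst ` set w \<and> f = fword_of w"
    proof (induction f)
      case Nil
      show ?case by (intro exI[of _ "[]"]) (simp add: fword_of_def)
    next
      case (Cons x f)
      obtain t A where x: "x = (t, A)" by fastforce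
      have "f \<in> words_over {mat_P, mat_Q}" "A = mat_P \<or> A = mat_Q" using Cons.prems x by (auto simp: words_over_def)
      with Cons.IH obtain w where w: "LS \<notin> fst ` set w" "f = fword_of w" by blast
      obtain l where "l \<noteq> LS" "A = gen l" using \<open>A = mat_P \<or> A = mat_Q\<close> by (metis gen.simps(1,2) letter.distinct(3,5))
      then show ?case using w x by (intro exI[of _ "(l, t) # w"]) (auto simp: fword_of_def)
    qed
    then show "f \<in> fword_of ` {w. LS \<notin> fst ` set w}" by blast
  qed
qed

lemma shear_word_cost: "LS \<notin> fst ` set w \<Longrightarrow> (\<Sum>(t, A) \<leftarrow> fword_of w. \<bar>t\<bar>) = cost w"
proof (induction w)
  case (Cons a w)
  obtain l t where "a = (l, t)" by fastforce
  then show ?case using Cons by (auto simp: fword_of_def speed_shear)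
qed (simp add: fword_of_def)

text \<open>Shear words are words, so the infimum is at least the minimum over all words; approximation of
diagonal letters by shears gives the other inequality.\<close>

lemma factorization_cost_eqI:
  assumes w: "eval w = g" and min: "\<And>v. eval v = g \<Longrightarrow> cost w \<le> cost v"
  shows "factorization_cost g = cost w"
proof -
  let ?A = "{\<Sum>(t, A) \<leftarrow> f. \<bar>t\<bar> | f. f \<in> words_over {mat_P, mat_Q} \<and> g = word_prod f}"
  have A: "?A = {cost v | v. LS \<notin> fst ` set v \<and> eval v = g}"
  proof -
    have "?A = (\<lambda>f. \<Sum>(t, A) \<leftarrow> f. \<bar>t\<bar>) ` (fword_of ` {v. LS \<notin> fst ` set v} \<inter> {f. g = word_prod f})"
      unfolding shear_words by blast
    also have "\<dots> = (\<lambda>v. \<Sum>(t, A) \<leftarrow> fword_of v. \<bar>t\<bar>) ` {v. LS \<notin> fst ` set v \<and> eval v = g}"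
      by (auto simp: word_prod_fword_of)
    also have "\<dots> = cost ` {v. LS \<notin> fst ` set v \<and> eval v = g}"
      by (intro image_cong refl shear_word_cost) auto
    finally show ?thesis by blast
  qed
  have ge: "x \<ge> cost w" if "x \<in> ?A" for x using that min unfolding A by blast
  have approx: "\<exists>x\<in>?A. x \<le> cost w + e" if "0 < e" for e
    using approximate_by_shears[OF that, of w] w unfolding A by blast
  show ?thesis
    unfolding factorization_cost_def
  proof (rule antisym)
    show "cost w \<le> Inf ?A" using approx[of 1] ge by (intro cInf_greatest) auto
    show "Inf ?A \<le> cost w"
    proof (rule field_le_epsilon)
      fix e :: real assume "0 < e"
      then obtain x where "x \<in> ?A" "x \<le> cost w + e" using approx by blast
      then show "Inf ?A \<le> cost w + e" using cInf_lower[of x ?A] ge by (meson bdd_belowI order_trans)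
    qed
  qed
qed

theorem theorem1p1:
  fixes g :: "real^2^2"
  assumes "g \<in> SL2"
  shows "\<exists>w. length w = 6 \<and> optimal_factorization g w"
proof -
  obtain w0 where "eval w0 = g" using eval_surj[OF assms] by blast
  then obtain w where w: "length w \<le> 6" "eval w = g" "\<And>v. eval v = g \<Longrightarrow> cost w \<le> cost v"
    using six_letters_suffice[of w0] by blast
  define v where "v = w @ replicate (6 - length w) (LP, 0)"
  have "eval (replicate k (LP, 0)) = mat 1" "cost (replicate k (LP, 0)) = 0" for k
    by (induction k) (simp_all del: shear.simps)
  then have v: "length v = 6" "eval v = g" "cost v = cost w"
    using w(1,2) by (simp_all add: v_def)
  have "gen l \<in> {mat_P, mat_Q, mat_P + mat_Q}" for l by (cases l) auto
  then have "fword_of v \<in> words_over {mat_P, mat_Q, mat_P + mat_Q}"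
    by (auto simp: words_over_def fword_of_def simp del: gen.simps)
  then have "optimal_factorization g (fword_of v)"
    using factorization_cost_eqI[OF w(2,3)] v
    by (simp add: optimal_factorization_def word_prod_fword_of word_cost_fword_of)
  then show ?thesis using v(1) by (intro exI[of _ "fword_of v"]) (simp add: fword_of_def)
qed

end
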